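(* Let $\Omega\subset\mathbb{R}^2\cong\mathbb{C}$ be a bounded open domain with Lipschitz boundary, and let $\gamma=\sigma+i\omega\epsilon$ with $\sigma,\epsilon$ real-valued, $\sigma>\sigma_0$ and $\|\sigma\|_{W^{1,\infty}},\|\epsilon\|_{W^{1,\infty}}\le\beta$ on $\Omega$ and (after extension) on $\mathbb{R}^2$, for positive constants $\sigma_0,\beta$, with $\gamma\equiv1$ outside a fixed ball containing $\Omega$. For all sufficiently small $\omega\ge0$ (smaller than a constant depending only on $\beta,\sigma_0,\Omega$), the functions $Q_{12}=-\frac12\partial_z\log\gamma$ and $Q_{21}=-\frac12\bar\partial_z\log\gamma$ can be calculated from $M(z,0)$ via $$Q_{12}(z)=\frac{\bar\partial_zM_+(z,0)}{M_-(z,0)},\qquad Q_{21}(z)=\frac{\partial_zM_-(z,0)}{M_+(z,0)},$$ where $$M_+(z,k)=M_{11}(z,k)+e(z,-k)M_{12}(z,k),\qquad M_-(z,k)=M_{22}(z,k)+e(z,k)M_{21}(z,k).$$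
   Context: Write $z=x+iy$, $\partial_z=\frac12(\partial_x-i\partial_y)$, $\bar\partial_z=\frac12(\partial_x+i\partial_y)$, $e(z,k)=\exp\{i(zk+\bar z\bar k)\}$; $\log\gamma$ is the principal branch ($\mathrm{Re}\,\gamma>0$). For $\omega$ sufficiently small it is known (Francini) that for every $k\in\mathbb{C}$ there is a unique $2\times2$ matrix $M(\cdot,k)$ with $M(\cdot,k)-I\in L^q(\mathbb{R}^2)$ for some $q>2$ solving $$\bar\partial_zM_{11}=Q_{12}M_{21},\quad(\bar\partial_z-ik)M_{12}=Q_{12}M_{22},\quad(\partial_z+ik)M_{21}=Q_{21}M_{11},\quad\partial_zM_{22}=Q_{21}M_{12}$$ in $\mathbb{R}^2$. This is the matrix $M$ in the claim. Identities between weak derivatives hold almost everywhere. *)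

theory Defs
  imports "HOL-Analysis.Analysis" "HOL-Probability.Essential_Supremum"
begin

text \<open>The plane is identified with the type of complex numbers, and z = x + iy.\<close>

section \<open>Classical first-order operators and test functions\<close>

definition dx :: "(complex \<Rightarrow> complex) \<Rightarrow> complex \<Rightarrow> complex" where
  "dx f z = frechet_derivative f (at z) 1"

definition dy :: "(complex \<Rightarrow> complex) \<Rightarrow> complex \<Rightarrow> complex" where
  "dy f z = frechet_derivative f (at z) \<i>"

definition dz :: "(complex \<Rightarrow> complex) \<Rightarrow> complex \<Rightarrow> complex" where
  "dz f z = (dx f z - \<i> * dy f z) / 2"

definition dzbar :: "(complex \<Rightarrow> complex) \<Rightarrow> complex \<Rightarrow> complex" where
  "dzbar f z = (dx f z + \<i> * dy f z) / 2"

text \<open>Infinitely often real-differentiable: the function and all its iterated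
  partial derivatives are (Frechet) differentiable everywhere.\<close>

coinductive smooth :: "(complex \<Rightarrow> complex) \<Rightarrow> bool" where
  "(\<forall>z. f differentiable (at z)) \<Longrightarrow> smooth (dx f) \<Longrightarrow> smooth (dy f) \<Longrightarrow> smooth f"

definition test_function :: "complex set \<Rightarrow> (complex \<Rightarrow> complex) \<Rightarrow> bool" where
  "test_function U \<phi> \<longleftrightarrow>
     smooth \<phi> \<and> compact (closure {z. \<phi> z \<noteq> 0}) \<and> closure {z. \<phi> z \<noteq> 0} \<subseteq> U"

section \<open>Weak derivatives\<close>

definition loc_integrable :: "complex set \<Rightarrow> (complex \<Rightarrow> complex) \<Rightarrow> bool" where
  "loc_integrable U f \<longleftrightarrow> (\<forall>K. compact K \<and> K \<subseteq> U \<longrightarrow> f absolutely_integrable_on K)"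

text \<open>Here P is one of the operators dx, dy, dz, dzbar; the definition says that P f = g
  in the sense of distributions on the open set U.\<close>

definition has_weak_deriv ::
    "((complex \<Rightarrow> complex) \<Rightarrow> complex \<Rightarrow> complex) \<Rightarrow> complex set \<Rightarrow>
     (complex \<Rightarrow> complex) \<Rightarrow> (complex \<Rightarrow> complex) \<Rightarrow> bool" where
  "has_weak_deriv P U f g \<longleftrightarrow> loc_integrable U f \<and> loc_integrable U g \<and>
     (\<forall>\<phi>. test_function U \<phi> \<longrightarrow>
        (LINT z:U|lebesgue. f z * P \<phi> z) = - (LINT z:U|lebesgue. g z * \<phi> z))"

definition weakly_diff ::
    "((complex \<Rightarrow> complex) \<Rightarrow> complex \<Rightarrow> complex) \<Rightarrow> complex set \<Rightarrow>
     (complex \<Rightarrow> complex) \<Rightarrow> bool" where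
  "weakly_diff P U f \<longleftrightarrow> (\<exists>g. has_weak_deriv P U f g)"

text \<open>A representative of the weak derivative, which is unique up to null sets. It is
  only meaningful together with \<^const>\<open>weakly_diff\<close>.\<close>

definition weak_deriv ::
    "((complex \<Rightarrow> complex) \<Rightarrow> complex \<Rightarrow> complex) \<Rightarrow> complex set \<Rightarrow>
     (complex \<Rightarrow> complex) \<Rightarrow> complex \<Rightarrow> complex" where
  "weak_deriv P U f = (SOME g. has_weak_deriv P U f g)"

section \<open>Function spaces and domains\<close>

definition Linf_norm :: "complex set \<Rightarrow> (complex \<Rightarrow> complex) \<Rightarrow> ereal" where
  "Linf_norm U f = esssup (restrict_space lebesgue U) (\<lambda>z. ereal (cmod (f z)))"

text \<open>The norm of the Sobolev space of order 1 and exponent infinity, with value infinity for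
  functions outside the space.\<close>

definition W1inf_norm :: "complex set \<Rightarrow> (complex \<Rightarrow> complex) \<Rightarrow> ereal" where
  "W1inf_norm U f =
     (if weakly_diff dx U f \<and> weakly_diff dy U f
      then Max {Linf_norm U f, Linf_norm U (weak_deriv dx U f), Linf_norm U (weak_deriv dy U f)}
      else \<infinity>)"

definition Lq :: "real \<Rightarrow> (complex \<Rightarrow> complex) \<Rightarrow> bool" where
  "Lq q f \<longleftrightarrow> f \<in> borel_measurable lebesgue \<and> integrable lebesgue (\<lambda>z. cmod (f z) powr q)"

text \<open>Near every boundary point p, in coordinates centred at p and rotated by a unimodular
  number u, the domain is the region strictly above the graph of a Lipschitz function.\<close>

definition lipschitz_boundary :: "complex set \<Rightarrow> bool" where
  "lipschitz_boundary \<Omega> \<longleftrightarrow>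
     (\<forall>p\<in>frontier \<Omega>. \<exists>r>0. \<exists>u. cmod u = 1 \<and>
        (\<exists>(g::real \<Rightarrow> real) L. L-lipschitz_on UNIV g \<and>
           (\<forall>z\<in>ball p r. z \<in> \<Omega> \<longleftrightarrow> Im (u * (z - p)) > g (Re (u * (z - p))))))"

definition bounded_lipschitz_domain :: "complex set \<Rightarrow> bool" where
  "bounded_lipschitz_domain \<Omega> \<longleftrightarrow>
     \<Omega> \<noteq> {} \<and> open \<Omega> \<and> connected \<Omega> \<and> bounded \<Omega> \<and> lipschitz_boundary \<Omega>"

section \<open>The first-order system\<close>

definition admittivity :: "real \<Rightarrow> (complex \<Rightarrow> real) \<Rightarrow> (complex \<Rightarrow> real) \<Rightarrow> complex \<Rightarrow> complex" where
  "admittivity \<omega> \<sigma> \<epsilon> z = of_real (\<sigma> z) + \<i> * of_real \<omega> * of_real (\<epsilon> z)"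

definition Q12 :: "(complex \<Rightarrow> complex) \<Rightarrow> complex \<Rightarrow> complex" where
  "Q12 \<gamma> z = - (1/2) * weak_deriv dz UNIV (\<lambda>w. Ln (\<gamma> w)) z"

definition Q21 :: "(complex \<Rightarrow> complex) \<Rightarrow> complex \<Rightarrow> complex" where
  "Q21 \<gamma> z = - (1/2) * weak_deriv dzbar UNIV (\<lambda>w. Ln (\<gamma> w)) z"

definition e :: "complex \<Rightarrow> complex \<Rightarrow> complex" where
  "e z k = exp (\<i> * (z * k + cnj z * cnj k))"

text \<open>For a fixed spectral parameter k, the function m is the matrix M(.,k).\<close>

definition cgo_matrix :: "(complex \<Rightarrow> complex) \<Rightarrow> complex \<Rightarrow> (complex \<Rightarrow> complex^2^2) \<Rightarrow> bool" where
  "cgo_matrix \<gamma> k m \<longleftrightarrow>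
     (\<exists>q>2. \<forall>i j. Lq q (\<lambda>z. (m z - mat 1) $ i $ j)) \<and>
     weakly_diff dzbar UNIV (\<lambda>z. m z $ 1 $ 1) \<and>
     weakly_diff dzbar UNIV (\<lambda>z. m z $ 1 $ 2) \<and>
     weakly_diff dz UNIV (\<lambda>z. m z $ 2 $ 1) \<and>
     weakly_diff dz UNIV (\<lambda>z. m z $ 2 $ 2) \<and>
     (AE z in lebesgue.
        weak_deriv dzbar UNIV (\<lambda>w. m w $ 1 $ 1) z = Q12 \<gamma> z * m z $ 2 $ 1) \<and>
     (AE z in lebesgue.
        weak_deriv dzbar UNIV (\<lambda>w. m w $ 1 $ 2) z - \<i> * k * m z $ 1 $ 2 = Q12 \<gamma> z * m z $ 2 $ 2) \<and>
     (AE z in lebesgue.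
        weak_deriv dz UNIV (\<lambda>w. m w $ 2 $ 1) z + \<i> * k * m z $ 2 $ 1 = Q21 \<gamma> z * m z $ 1 $ 1) \<and>
     (AE z in lebesgue.
        weak_deriv dz UNIV (\<lambda>w. m w $ 2 $ 2) z = Q21 \<gamma> z * m z $ 1 $ 2)"

definition M_plus :: "(complex \<Rightarrow> complex \<Rightarrow> complex^2^2) \<Rightarrow> complex \<Rightarrow> complex \<Rightarrow> complex" where
  "M_plus M z k = M z k $ 1 $ 1 + e z (- k) * M z k $ 1 $ 2"

definition M_minus :: "(complex \<Rightarrow> complex \<Rightarrow> complex^2^2) \<Rightarrow> complex \<Rightarrow> complex \<Rightarrow> complex" where
  "M_minus M z k = M z k $ 2 $ 2 + e z k * M z k $ 2 $ 1"

end

theory Submission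
  imports Defs
begin

text \<open>
  At \<open>k = 0\<close> the entries combine to \<open>u = M_+\<close> and \<open>v = M_-\<close> with \<open>\<partial>\<close>-bar \<open>u = Q12 v\<close> and
  \<open>\<partial> v = Q21 u\<close>, so everything hinges on \<open>u\<close> and \<open>v\<close> having no zeros. For real \<open>\<gamma>\<close> one has
  \<open>Q21 = cnj Q12\<close>, and \<open>u\<close> is a pseudoanalytic function tending to 1; in general \<open>Q21\<close> and
  \<open>cnj Q12\<close> differ by a term of order \<open>\<omega>\<close>. With \<open>a = cnj v\<close>, the functions \<open>u - a\<close> and \<open>u + a\<close>
  solve pseudoanalytic equations up to errors of that order, and Bers' similarity principle bounds
  the first from above and the second from below, uniformly in \<open>\<sigma>\<close> and \<open>\<epsilon>\<close>.

  All calculus runs through the Cauchy transform \<open>C\<close>. Functions \<open>f\<close> in \<open>L^q\<close> with compactly supported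
  \<open>g = \<partial>\<close>-bar \<open>f\<close> satisfy \<open>f = C g\<close>, and the product rule becomes
  \<open>C g C h = C (g C h + h C g)\<close>, which is a partial fraction identity under Fubini's theorem. It
  exponentiates to \<open>f exp (- C \<alpha>) = k + C ((g - \<alpha> f) exp (- C \<alpha>))\<close> for \<open>f = k + C g\<close>. This
  identity gives the similarity principle and, with \<open>f = \<gamma>\<close> and \<open>\<alpha> = (\<partial>\<close>-bar \<open>\<gamma>) / \<gamma>\<close>, the chain rule
  for \<open>Ln \<gamma>\<close>.
\<close>

section \<open>Explicit smooth functions\<close>

text \<open>The bound on \<omega> is fixed before \<sigma>, \<epsilon> and M, so a Liouville
  argument for an individual solution does not suffice. The similarity principle gives uniform
  constants because \<open>cnj f / f\<close> has modulus at most 1 whatever f is: the exponent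
  depends on the unknown solution, but it is the transform of a function bounded by \<open>A\<close>
  on a fixed ball. The error terms contain sup |u|, which is not controlled in advance. It is finite
  because q > 2 makes the dual exponent less than 2, and 1/|z - w| to that power is integrable on
  balls; the bounds for u + a and u - a then absorb it.

  Working with C avoids smoothing and the chain rule for Sobolev functions: once Fubini's theorem
  applies, the identities hold at every point. Fubini's theorem asks for Borel functions, whereas
  the given functions are Lebesgue measurable and their weak derivatives are arbitrary
  representatives; hence the passage to Borel representatives. It is enough to invert
  \<partial>-bar, since conjugation exchanges it with \<partial> and turns \<gamma> into the
  admittivity for - \<omega>.\<close>

lemma power_le_fact_exp:
  fixes x :: real
  assumes "x \<ge> 0"
  shows "x ^ n \<le> fact n * exp x"
proof -
  have "(\<Sum>k\<in>{n}. inverse (fact k) *\<^sub>R x ^ k) \<le> (\<Sum>k. inverse (fact k) *\<^sub>R x ^ k)"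
    by (rule sum_le_suminf) (use assms summable_exp_generic[of x] in auto)
  then have "inverse (fact n) * x ^ n \<le> exp x"
    by (simp add: exp_def)
  then show ?thesis
    by (simp add: field_simps)
qed

definition flat :: "nat \<Rightarrow> real \<Rightarrow> real" where
  "flat m t = (if t > 0 then exp (- (1 / t)) / t ^ m else 0)"

lemma flat_nonneg: "0 \<le> flat m t"
  by (simp add: flat_def)

text \<open>One term of the exponential series, of order m + n, shows vanishing to every order at 0.
  The case n = 2 gives the derivative at 0, the case n = 0 boundedness.\<close>

lemma flat_le: "flat m t \<le> fact (m + n) * \<bar>t\<bar> ^ n"
proof (cases "t > 0")
  case True
  have "(1 / t) ^ (m + n) \<le> fact (m + n) * exp (1 / t)"
    by (rule power_le_fact_exp) (use True in simp)
  then show ?thesis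
    using True by (simp add: flat_def exp_minus field_simps power_add)
qed (simp add: flat_def)

text \<open>Up to linear combinations the family over all \<open>m\<close> is closed under
  differentiation, so iterated derivatives call for no induction on their order.\<close>

lemma flat_has_field_derivative:
  "(flat m has_field_derivative (flat (m + 2) t - real m * flat (m + 1) t)) (at t)"
proof (cases t "0::real" rule: linorder_cases)
  case less
  have "((\<lambda>_. 0) has_field_derivative 0) (at t)"
    by simp
  then have "(flat m has_field_derivative 0) (at t)"
    by (rule has_field_derivative_transform_within_open[where S="{..<0}"]) (use less in \<open>auto simp: flat_def\<close>)
  then show ?thesis using less by (simp add: flat_def)
next
  case equal
  have "((\<lambda>h. (flat m (t + h) - flat m t) / h) \<longlongrightarrow> 0) (at 0)"
  proof (rule Lim_null_comparison)
    show "\<forall>\<^sub>F h in at 0. norm ((flat m (t + h) - flat m t) / h) \<le> fact (m + 2) * \<bar>h\<bar>"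
    proof (rule always_eventually, rule allI)
      fix h :: real
      have *: "flat m h \<le> fact (m + 2) * \<bar>h\<bar> * \<bar>h\<bar>"
        using flat_le[of m h 2] by (simp only: power2_eq_square mult.assoc)
      show "norm ((flat m (t + h) - flat m t) / h) \<le> fact (m + 2) * \<bar>h\<bar>"
        using equal flat_nonneg[of m h] *
        by (cases "h = 0") (simp_all add: flat_def[of _ 0] divide_le_eq del: fact_Suc)
    qed
    show "((\<lambda>h. fact (m + 2) * \<bar>h\<bar>) \<longlongrightarrow> 0) (at (0::real))"
      by (auto intro!: tendsto_eq_intros)
  qed
  then show ?thesis
    using equal by (simp add: DERIV_def flat_def[of _ 0])
next
  case greater
  have "((\<lambda>t. exp (- (1 / t)) / t ^ m) has_field_derivative
      (exp (- (1 / t)) * (1 / t\<^sup>2) * t ^ m - exp (- (1 / t)) * (real m * t ^ (m - 1))) / (t ^ m * t ^ m)) (at t)"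
    using greater by (auto intro!: derivative_eq_intros simp: power2_eq_square)
  moreover have "(exp (- (1 / t)) * (1 / t\<^sup>2) * t ^ m - exp (- (1 / t)) * (real m * t ^ (m - 1))) / (t ^ m * t ^ m)
      = flat (m + 2) t - real m * flat (m + 1) t"
    using greater by (cases m) (auto simp: flat_def field_simps power2_eq_square)
  ultimately have "((\<lambda>t. exp (- (1 / t)) / t ^ m) has_field_derivative (flat (m + 2) t - real m * flat (m + 1) t)) (at t)"
    by simp
  then show ?thesis
    by (rule has_field_derivative_transform_within_open[where S="{0<..}"]) (use greater in \<open>auto simp: flat_def\<close>)
qed

text \<open>The class is closed under partial derivatives, so that the coinductive
  \<^const>\<open>smooth\<close> follows from a single coinduction. Taking \<open>flat m\<close> for all \<open>m\<close> makes the bump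
  functions part of it.\<close>

inductive elem_smooth :: "(complex \<Rightarrow> complex) \<Rightarrow> bool" where
  const: "elem_smooth (\<lambda>z. c)"
| ident: "elem_smooth (\<lambda>z. z)"
| cnj: "elem_smooth f \<Longrightarrow> elem_smooth (\<lambda>z. cnj (f z))"
| add: "elem_smooth f \<Longrightarrow> elem_smooth g \<Longrightarrow> elem_smooth (\<lambda>z. f z + g z)"
| mult: "elem_smooth f \<Longrightarrow> elem_smooth g \<Longrightarrow> elem_smooth (\<lambda>z. f z * g z)"
| inverse: "elem_smooth f \<Longrightarrow> (\<And>z. f z \<noteq> 0) \<Longrightarrow> elem_smooth (\<lambda>z. inverse (f z))"
| flat: "elem_smooth f \<Longrightarrow> elem_smooth (\<lambda>z. of_real (flat m (Re (f z))))"

lemma elem_smooth_minus: "elem_smooth f \<Longrightarrow> elem_smooth (\<lambda>z. - f z)"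
  using elem_smooth.mult[OF elem_smooth.const[of "-1"], of f] by simp

lemma elem_smooth_diff: "elem_smooth f \<Longrightarrow> elem_smooth g \<Longrightarrow> elem_smooth (\<lambda>z. f z - g z)"
  using elem_smooth.add[OF _ elem_smooth_minus, of f g] by simp

lemma elem_smooth_Re: "elem_smooth f \<Longrightarrow> elem_smooth (\<lambda>z. of_real (Re (f z)))"
proof -
  assume "elem_smooth f"
  then have "elem_smooth (\<lambda>z. (1/2) * (f z + cnj (f z)))"
    by (intro elem_smooth.intros)
  moreover have "(\<lambda>z. (1/2) * (f z + cnj (f z))) = (\<lambda>z. of_real (Re (f z)))"
    by (auto simp: fun_eq_iff complex_eq_iff)
  ultimately show ?thesis by simp
qed

lemmas elem_smooth_intros = elem_smooth.intros elem_smooth_minus elem_smooth_diff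

text \<open>One derivative field serves all directions: the chain and product rules need the whole
  linear map, while closure of the class concerns a fixed direction \<open>v\<close>. The partial
  derivatives are the directions 1 and \<i>.\<close>

lemma elem_smooth_has_derivative:
  assumes "elem_smooth f"
  shows "\<exists>f'. (\<forall>z. (f has_derivative f' z) (at z)) \<and> (\<forall>v. elem_smooth (\<lambda>z. f' z v))"
  using assms
proof induction
  case (const c)
  have "((\<lambda>z::complex. c) has_derivative (\<lambda>v. 0)) (at z)" for z by simp
  then show ?case by (intro exI[of _ "\<lambda>z v. 0"]) (auto intro: elem_smooth.const)
next
  case ident
  show ?case by (intro exI[of _ "\<lambda>z v. v"]) (auto intro: elem_smooth.const)
next
  case (cnj f)
  then obtain f' where "\<forall>z. (f has_derivative f' z) (at z)" "\<forall>v. elem_smooth (\<lambda>z. f' z v)" by blast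
  then show ?case
    by (intro exI[of _ "\<lambda>z v. cnj (f' z v)"])
      (auto intro: elem_smooth.cnj bounded_linear.has_derivative[OF bounded_linear_cnj])
next
  case (add f g)
  then obtain f' g' where "\<forall>z. (f has_derivative f' z) (at z)" "\<forall>v. elem_smooth (\<lambda>z. f' z v)"
    "\<forall>z. (g has_derivative g' z) (at z)" "\<forall>v. elem_smooth (\<lambda>z. g' z v)" by blast
  then show ?case
    by (intro exI[of _ "\<lambda>z v. f' z v + g' z v"]) (auto intro: elem_smooth.add has_derivative_add)
next
  case (mult f g)
  then obtain f' g' where "\<forall>z. (f has_derivative f' z) (at z)" "\<forall>v. elem_smooth (\<lambda>z. f' z v)"
    "\<forall>z. (g has_derivative g' z) (at z)" "\<forall>v. elem_smooth (\<lambda>z. g' z v)" by blast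
  then show ?case
    by (intro exI[of _ "\<lambda>z v. f z * g' z v + f' z v * g z"])
      (auto intro!: elem_smooth.intros mult.hyps has_derivative_mult)
next
  case (inverse f)
  then obtain f' where "\<forall>z. (f has_derivative f' z) (at z)" "\<forall>v. elem_smooth (\<lambda>z. f' z v)" by blast
  then show ?case
    using inverse.hyps
    by (intro exI[of _ "\<lambda>z v. - (inverse (f z) * f' z v * inverse (f z))"])
      (auto intro!: elem_smooth_intros has_derivative_inverse)
next
  case (flat f m)
  then obtain f' where f': "\<And>z. (f has_derivative f' z) (at z)" "\<And>v. elem_smooth (\<lambda>z. f' z v)" by blast
  let ?D = "\<lambda>z v. of_real (Re (f' z v)) * (of_real (flat (m + 2) (Re (f z)))
     - of_real (real m) * of_real (flat (m + 1) (Re (f z)))) :: complex"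
  have "((\<lambda>z. of_real (flat m (Re (f z)))) has_derivative ?D z) (at z)" for z
  proof -
    have "((\<lambda>z. Re (f z)) has_derivative (\<lambda>v. Re (f' z v))) (at z)"
      by (rule bounded_linear.has_derivative[OF bounded_linear_Re f'(1)])
    moreover have "(flat m has_derivative (\<lambda>h. h * (flat (m + 2) (Re (f z)) - real m * flat (m + 1) (Re (f z))))) (at (Re (f z)))"
      using flat_has_field_derivative[of m "Re (f z)"] by (simp add: has_field_derivative_def mult_commute_abs)
    ultimately have "((\<lambda>z. flat m (Re (f z))) has_derivative
       (\<lambda>v. Re (f' z v) * (flat (m + 2) (Re (f z)) - real m * flat (m + 1) (Re (f z))))) (at z)"
      using diff_chain_at[of "\<lambda>z. Re (f z)" _ z "flat m"] by (simp add: o_def)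
    from bounded_linear.has_derivative[OF bounded_linear_of_real this]
    show ?thesis by simp
  qed
  moreover have "elem_smooth (\<lambda>z. ?D z v)" for v
    by (intro elem_smooth_intros elem_smooth_Re f'(2) flat.hyps)
  ultimately show ?case
    by (intro exI[of _ ?D]) blast
qed

lemma elem_smooth_differentiable: "elem_smooth f \<Longrightarrow> f differentiable (at z)"
  using elem_smooth_has_derivative[of f] unfolding differentiable_def by blast

lemma elem_smooth_frechet:
  assumes "elem_smooth f" shows "elem_smooth (\<lambda>z. frechet_derivative f (at z) v)"
proof -
  obtain f' where f': "\<And>z. (f has_derivative f' z) (at z)" "\<And>v. elem_smooth (\<lambda>z. f' z v)"
    using elem_smooth_has_derivative[OF assms] by blast
  have "frechet_derivative f (at z) = f' z" for z
    using f'(1) frechet_derivative_at by metis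
  then show ?thesis using f'(2) by simp
qed

lemma smooth_elem:
  assumes "elem_smooth f" shows "smooth f"
  using assms
proof (coinduction arbitrary: f)
  case smooth
  then show ?case
    using elem_smooth_differentiable elem_smooth_frechet unfolding dx_def[abs_def] dy_def[abs_def] by blast
qed

text \<open>Conjugation commutes with both real partial derivatives, so conjugates of smooth
  functions are closed under them. This allows weak equations for \<partial> to be conjugated into
  equations for \<partial>-bar.\<close>

lemma smooth_cnj:
  assumes "smooth f" shows "smooth (\<lambda>z. cnj (f z))"
  using assms
proof (coinduction arbitrary: f)
  case smooth
  then have f: "\<And>z. f differentiable (at z)" "smooth (dx f)" "smooth (dy f)"
    by (auto elim: smooth.cases)
  have D: "((\<lambda>z. cnj (f z)) has_derivative (\<lambda>v. cnj (frechet_derivative f (at z) v))) (at z)" for z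
    by (intro bounded_linear.has_derivative[OF bounded_linear_cnj])
      (use f(1) frechet_derivative_works in blast)
  then have "frechet_derivative (\<lambda>z. cnj (f z)) (at z) = (\<lambda>v. cnj (frechet_derivative f (at z) v))" for z
    using frechet_derivative_at by metis
  then have "dx (\<lambda>z. cnj (f z)) = (\<lambda>z. cnj (dx f z))" "dy (\<lambda>z. cnj (f z)) = (\<lambda>z. cnj (dy f z))"
    by (simp_all add: dx_def[abs_def] dy_def[abs_def])
  with D f show ?case
    unfolding differentiable_def by (metis (lifting))
qed

section \<open>Test functions\<close>

lemma ball_borel [measurable]: "ball (c::'a::euclidean_space) r \<in> sets borel"
  by simp

lemma integrable_indicator_ball:
  "integrable lborel (\<lambda>z. indicator (ball (c::'a::euclidean_space) r) z :: real)"
  using emeasure_bounded_finite[of "ball c r"] by (intro integrable_real_indicator) auto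

lemma lborel_integral_affine:
  fixes f :: "'a::euclidean_space \<Rightarrow> 'b::{banach,second_countable_topology}"
  assumes [measurable]: "f \<in> borel_measurable borel" and c: "c \<noteq> 0"
  shows "integral\<^sup>L lborel f = \<bar>c\<bar> ^ DIM('a) *\<^sub>R (LINT x|lborel. f (t + c *\<^sub>R x))"
proof -
  have "integral\<^sup>L lborel f = integral\<^sup>L (density (distr lborel borel (\<lambda>x. t + c *\<^sub>R x)) (\<lambda>_. \<bar>c\<bar> ^ DIM('a))) f"
    using lborel_affine[OF c, of t] by simp
  also have "\<dots> = \<bar>c\<bar> ^ DIM('a) *\<^sub>R (LINT x|lborel. f (t + c *\<^sub>R x))"
    by (simp add: integral_density integral_distr)
  finally show ?thesis .
qed

lemma lborel_nn_integral_affine: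
  fixes f :: "'a::euclidean_space \<Rightarrow> ennreal"
  assumes [measurable]: "f \<in> borel_measurable borel" and c: "c \<noteq> 0"
  shows "integral\<^sup>N lborel f = ennreal (\<bar>c\<bar> ^ DIM('a)) * (\<integral>\<^sup>+x. f (t + c *\<^sub>R x) \<partial>lborel)"
proof -
  have "integral\<^sup>N lborel f = integral\<^sup>N (density (distr lborel borel (\<lambda>x. t + c *\<^sub>R x)) (\<lambda>_. \<bar>c\<bar> ^ DIM('a))) f"
    using lborel_affine[OF c, of t] by simp
  also have "\<dots> = ennreal (\<bar>c\<bar> ^ DIM('a)) * (\<integral>\<^sup>+x. f (t + c *\<^sub>R x) \<partial>lborel)"
    by (simp add: nn_integral_density nn_integral_distr nn_integral_cmult)
  finally show ?thesis .
qed

lemma lborel_integrable_affine: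
  fixes f :: "'a::euclidean_space \<Rightarrow> 'b::{banach,second_countable_topology}"
  assumes f: "integrable lborel f" and c: "c \<noteq> 0"
  shows "integrable lborel (\<lambda>x. f (t + c *\<^sub>R x))"
proof -
  have [measurable]: "f \<in> borel_measurable borel"
    using borel_measurable_integrable[OF f] by simp
  have "(\<integral>\<^sup>+x. norm (f x) \<partial>lborel) = ennreal (\<bar>c\<bar> ^ DIM('a)) * (\<integral>\<^sup>+x. norm (f (t + c *\<^sub>R x)) \<partial>lborel)"
    by (rule lborel_nn_integral_affine) (use c in auto)
  moreover have "(\<integral>\<^sup>+x. norm (f x) \<partial>lborel) < \<infinity>"
    using f by (simp add: integrable_iff_bounded)
  ultimately show ?thesis
    using c by (auto simp: integrable_iff_bounded ennreal_mult_less_top)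
qed

lemma test_function_props:
  assumes "test_function U \<phi>"
  shows "\<And>z. \<phi> differentiable (at z)" "continuous_on UNIV \<phi>"
    "continuous_on UNIV (dx \<phi>)" "continuous_on UNIV (dy \<phi>)"
    "\<And>z. (\<phi> has_derivative frechet_derivative \<phi> (at z)) (at z)"
proof -
  have s: "smooth \<phi>" using assms by (simp add: test_function_def)
  have diff: "f differentiable (at z)" if "smooth f" for f z using that by cases blast
  have cont: "continuous_on UNIV f" if "smooth f" for f
    using diff[OF that] by (intro continuous_at_imp_continuous_on ballI differentiable_imp_continuous_within)
  have der: "smooth (dx f)" "smooth (dy f)" if "smooth f" for f
    using that by (cases, blast)+
  show d: "\<phi> differentiable (at z)" for z using diff s by blast
  show "continuous_on UNIV \<phi>" "continuous_on UNIV (dx \<phi>)" "continuous_on UNIV (dy \<phi>)"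
    using cont der s by blast+
  show "(\<phi> has_derivative frechet_derivative \<phi> (at z)) (at z)" for z
    using d frechet_derivative_works by blast
qed

lemma compact_support_bounded:
  fixes f :: "complex \<Rightarrow> complex"
  assumes "continuous_on UNIV f" "compact K" "\<And>z. z \<notin> K \<Longrightarrow> f z = 0"
  obtains B where "0 \<le> B" "\<And>z. cmod (f z) \<le> B"
proof -
  have "compact (f ` K)"
    using assms by (meson compact_continuous_image continuous_on_subset top_greatest)
  then obtain B where B: "\<And>z. z \<in> K \<Longrightarrow> cmod (f z) \<le> B"
    using compact_imp_bounded bounded_iff by (metis imageI)
  have "cmod (f z) \<le> max B 0" for z
    using B[of z] assms(3)[of z] by (cases "z \<in> K") auto
  then show ?thesis using that[of "max B 0"] by auto
qed

lemma integrable_compact_support: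
  fixes f :: "complex \<Rightarrow> complex"
  assumes "continuous_on UNIV f" "compact K" "\<And>z. z \<notin> K \<Longrightarrow> f z = 0"
  shows "integrable lborel f"
proof -
  have "integrable lborel (\<lambda>z. indicator K z *\<^sub>R f z)"
    by (intro borel_integrable_compact assms continuous_on_subset[OF assms(1)]) auto
  moreover have "(\<lambda>z. indicator K z *\<^sub>R f z) = f"
    using assms(3) by (auto simp: fun_eq_iff indicator_def)
  ultimately show ?thesis by simp
qed

lemma has_derivative_eq_0_outside:
  assumes "(f has_derivative f') (at z)" "closed K" "z \<notin> K" "\<And>w. w \<notin> K \<Longrightarrow> f w = 0"
  shows "f' = (\<lambda>_. 0)"
proof -
  have "((\<lambda>_. 0) has_derivative f') (at z)"
    by (rule has_derivative_transform_within_open[OF assms(1), of "- K"]) (use assms in auto)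
  then show ?thesis
    using has_derivative_unique has_derivative_const by metis
qed

text \<open>By translation invariance every difference quotient has integral 0, and dominated
  convergence carries this over to the derivative.\<close>

lemma integral_directional_derivative_eq_0:
  fixes \<Phi> :: "complex \<Rightarrow> complex"
  assumes D: "\<And>z. (\<Phi> has_derivative \<Phi>' z) (at z)"
    and cont: "continuous_on UNIV (\<lambda>z. \<Phi>' z v)"
    and K: "compact K" "\<And>z. z \<notin> K \<Longrightarrow> \<Phi> z = 0"
  shows "integrable lborel (\<lambda>z. \<Phi>' z v)" "(LINT z|lborel. \<Phi>' z v) = 0"
proof -
  have [measurable]: "\<Phi> \<in> borel_measurable borel" "(\<lambda>z. \<Phi>' z v) \<in> borel_measurable borel"
    using D cont by (auto intro!: borel_measurable_continuous_onI continuous_at_imp_continuous_on has_derivative_continuous)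
  have zero: "\<Phi>' z v = 0" if "z \<notin> K" for z
    using has_derivative_eq_0_outside[OF D compact_imp_closed[OF K(1)] that K(2)] by simp
  obtain B where B: "0 \<le> B" "\<And>z. cmod (\<Phi>' z v) \<le> B"
    using compact_support_bounded[OF cont K(1) zero] by blast
  obtain r where r: "K \<subseteq> ball 0 r" using K(1) compact_imp_bounded bounded_subset_ballD by blast
  define h where "h n = 1 / real (Suc n)" for n
  define Dq where "Dq n z = (\<Phi> (z + h n *\<^sub>R v) - \<Phi> z) /\<^sub>R h n" for n z
  have h: "0 < h n" "h n \<le> 1" for n by (auto simp: h_def)
  have hlim: "h \<longlonglongrightarrow> 0" unfolding h_def by (rule LIMSEQ_Suc[OF lim_1_over_n])
  \<comment> \<open>The steps \<open>h n\<close> are at most 1, so all difference quotients live in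
    one ball, enlarged by |v|; there the mean value inequality along the segment gives the bound
    \<open>B\<close>.\<close>
  have Dq_bound: "cmod (Dq n z) \<le> indicator (ball 0 (r + cmod v)) z * B" for n z
  proof (cases "z \<in> ball 0 (r + cmod v)")
    case True
    have "cmod (\<Phi> (z + h n *\<^sub>R v) - \<Phi> (z + 0 *\<^sub>R v)) \<le> B * norm (h n - 0)"
    proof (rule differentiable_bound[where S=UNIV and f="\<lambda>t. \<Phi> (z + t *\<^sub>R v)"
          and f'="\<lambda>t s. \<Phi>' (z + t *\<^sub>R v) (s *\<^sub>R v)"])
      fix t :: real
      show "((\<lambda>t. \<Phi> (z + t *\<^sub>R v)) has_derivative (\<lambda>s. \<Phi>' (z + t *\<^sub>R v) (s *\<^sub>R v))) (at t within UNIV)"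
        by (rule has_derivative_compose[of "\<lambda>t. z + t *\<^sub>R v" "\<lambda>s. s *\<^sub>R v" t UNIV \<Phi>]) (auto intro!: derivative_eq_intros D)
      show "onorm (\<lambda>s. \<Phi>' (z + t *\<^sub>R v) (s *\<^sub>R v)) \<le> B"
      proof (rule onorm_bound[OF B(1)])
        fix s :: real
        have "\<Phi>' (z + t *\<^sub>R v) (s *\<^sub>R v) = s *\<^sub>R \<Phi>' (z + t *\<^sub>R v) v"
          using D has_derivative_linear linear_scale by blast
        then show "norm (\<Phi>' (z + t *\<^sub>R v) (s *\<^sub>R v)) \<le> B * norm s"
          using B by (simp add: mult.commute[of B] mult_left_mono)
      qed
    qed auto
    then have "cmod (\<Phi> (z + h n *\<^sub>R v) - \<Phi> z) \<le> h n * B" using h[of n] by (simp add: mult.commute)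
    then show ?thesis using True h[of n] by (simp add: Dq_def inverse_eq_divide divide_le_eq mult.commute)
  next
    case False
    then have "r + cmod v \<le> cmod z" by simp
    moreover have "cmod (h n *\<^sub>R v) \<le> cmod v" using h[of n] by (simp add: mult_left_le_one_le)
    moreover have "cmod z \<le> cmod (z + h n *\<^sub>R v) + cmod (h n *\<^sub>R v)"
      using norm_triangle_ineq4[of "z + h n *\<^sub>R v" "h n *\<^sub>R v"] by simp
    ultimately have "z \<notin> ball 0 r" "z + h n *\<^sub>R v \<notin> ball 0 r"
      using norm_ge_zero[of v] by (auto simp del: norm_ge_zero)
    then have "z \<notin> K" "z + h n *\<^sub>R v \<notin> K" using r by auto
    then show ?thesis using K(2) B by (simp add: Dq_def indicator_def)
  qed
  have Dq_lim: "(\<lambda>n. Dq n z) \<longlonglongrightarrow> \<Phi>' z v" for z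
  proof -
    have "((\<lambda>t. \<Phi> (z + t *\<^sub>R v)) has_derivative (\<lambda>s. \<Phi>' (z + 0 *\<^sub>R v) (s *\<^sub>R v))) (at 0 within UNIV)"
      by (rule has_derivative_compose[of "\<lambda>t. z + t *\<^sub>R v" "\<lambda>s. s *\<^sub>R v" 0 UNIV \<Phi>]) (auto intro!: derivative_eq_intros D)
    then have lim: "(\<lambda>t. norm (\<Phi> (z + t *\<^sub>R v) - \<Phi> z - \<Phi>' z (t *\<^sub>R v)) / norm t) \<midarrow>0\<rightarrow> 0"
      by (simp add: has_derivative_at)
    have "(\<lambda>n. norm (\<Phi> (z + h n *\<^sub>R v) - \<Phi> z - \<Phi>' z (h n *\<^sub>R v)) / norm (h n)) \<longlonglongrightarrow> 0"
      by (rule filterlim_compose[OF lim]) (use h hlim in \<open>auto simp: filterlim_at less_imp_neq[symmetric]\<close>)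
    moreover have "norm (\<Phi> (z + h n *\<^sub>R v) - \<Phi> z - \<Phi>' z (h n *\<^sub>R v)) / norm (h n) = norm (Dq n z - \<Phi>' z v)" for n
    proof -
      have "\<Phi>' z (h n *\<^sub>R v) = h n *\<^sub>R \<Phi>' z v"
        using D has_derivative_linear linear_scale by blast
      then have "Dq n z - \<Phi>' z v = (\<Phi> (z + h n *\<^sub>R v) - \<Phi> z - \<Phi>' z (h n *\<^sub>R v)) /\<^sub>R h n"
        using h[of n] by (simp add: Dq_def scaleR_diff_right)
      then show ?thesis using h[of n] by (simp add: divide_inverse mult.commute)
    qed
    ultimately have "(\<lambda>n. norm (Dq n z - \<Phi>' z v)) \<longlonglongrightarrow> 0" by simp
    then show ?thesis using tendsto_norm_zero_iff LIM_zero_cancel by blast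
  qed
  have int_ball: "integrable lborel (\<lambda>z::complex. indicator (ball 0 (r + cmod v)) z * B)"
    by (intro integrable_mult_left integrable_indicator_ball)
  have Phi_int: "integrable lborel \<Phi>"
    by (rule integrable_compact_support[OF _ K])
      (use D in \<open>auto intro!: continuous_at_imp_continuous_on has_derivative_continuous\<close>)
  have "(LINT z|lborel. Dq n z) = 0" for n
  proof -
    have "(LINT z|lborel. \<Phi> (z + h n *\<^sub>R v)) = integral\<^sup>L lborel \<Phi>"
      using lborel_integral_affine[of \<Phi> 1 "h n *\<^sub>R v"] by (simp add: add.commute)
    moreover have "integrable lborel (\<lambda>z. \<Phi> (z + h n *\<^sub>R v))"
      using lborel_integrable_affine[OF Phi_int, of 1 "h n *\<^sub>R v"] by (simp add: add.commute)
    ultimately show ?thesis using Phi_int unfolding Dq_def by simp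
  qed
  moreover have "(\<lambda>n. LINT z|lborel. Dq n z) \<longlonglongrightarrow> (LINT z|lborel. \<Phi>' z v)"
    by (rule integral_dominated_convergence[OF _ _ int_ball]) (use Dq_lim Dq_bound in \<open>auto simp: Dq_def\<close>)
  ultimately show "(LINT z|lborel. \<Phi>' z v) = 0"
    by (simp add: LIMSEQ_const_iff)
  show "integrable lborel (\<lambda>z. \<Phi>' z v)"
    by (rule integrable_compact_support[OF cont K(1) zero])
qed

section \<open>The fundamental lemma of the calculus of variations\<close>

lemma AE_eq_0_if_integral_box_eq_0:
  fixes h :: "'a::euclidean_space \<Rightarrow> 'b::{banach,second_countable_topology}"
  assumes int: "integrable lborel h" and tot: "integral\<^sup>L lborel h = 0"
    and box: "\<And>p q. (LINT z|lborel. indicator (box p q) z *\<^sub>R h z) = 0"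
  shows "AE z in lborel. h z = 0"
proof (rule sigma_finite_measure.density_zero[OF sigma_finite_lborel int])
  fix A :: "'a set" assume "A \<in> sets lborel"
  have si: "set_integrable lborel X h" if "X \<in> sets borel" for X
    using int that unfolding set_integrable_def by (intro integrable_mult_indicator) auto
  let ?G = "range (\<lambda>(a, b). box a b :: 'a set)"
  have *: "A \<in> sigma_sets UNIV ?G"
    using \<open>A \<in> sets lborel\<close> by (simp add: borel_eq_box)
  have **: "Int_stable ?G" "?G \<subseteq> Pow UNIV"
    by (auto simp: Int_stable_def box_Int_box)
  \<comment> \<open>Dynkin's argument: open boxes are stable under intersection and generate the
    Borel sets, and the vanishing total integral handles complements.\<close>
  show "(LINT z:A|lborel. h z) = 0"
    using **(1,2) *
  proof (induction rule: sigma_sets_induct_disjoint)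
    case (basic A)
    then show ?case using box by (auto simp: set_lebesgue_integral_def)
  next
    case empty
    then show ?case by (simp add: set_lebesgue_integral_def)
  next
    case (compl A)
    then have A: "A \<in> sets borel" by (simp add: borel_eq_box)
    have "(LINT z:UNIV - A|lborel. h z) = integral\<^sup>L lborel h - (LINT z:A|lborel. h z)"
    proof -
      have "(\<lambda>z. indicator (UNIV - A) z *\<^sub>R h z) = (\<lambda>z. h z - indicator A z *\<^sub>R h z)"
        by (auto simp: fun_eq_iff indicator_def)
      then show ?thesis
        using si[OF A] int unfolding set_lebesgue_integral_def by (simp add: set_integrable_def)
    qed
    then show ?case using tot compl by simp
  next
    case (union A)
    then have A: "A i \<in> sets borel" for i by (auto simp: borel_eq_box)
    have "(LINT z:(\<Union>i. A i)|lborel. h z) = (\<Sum>i. (LINT z:A i|lborel. h z))"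
      by (rule lebesgue_integral_countable_add)
        (use A union si in \<open>auto simp: disjoint_family_on_def\<close>)
    then show ?case using union by simp
  qed
qed

lemma flat0_le_1: "flat 0 t \<le> 1"
  by (simp add: flat_def)

lemma flat0_scaled_tendsto: "(\<lambda>n. flat 0 (real (Suc n) * t)) \<longlonglongrightarrow> indicator {0<..} t"
proof (cases "t > 0")
  case True
  have "(\<lambda>n. exp (- (1 / t * (1 / real (Suc n))))) \<longlonglongrightarrow> exp (- (1 / t * 0))"
    by (intro tendsto_intros LIMSEQ_Suc[OF lim_1_over_n])
  then show ?thesis using True by (simp add: flat_def zero_less_mult_iff mult.commute divide_inverse)
qed (simp add: flat_def zero_less_mult_iff)

text \<open>If Re p < Re q, the product (Re z - Re p) * (Re q - Re z) is positive exactly between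
  the endpoints, and similarly for Im. The growing factor \<open>Suc n\<close> drives the values
  there to 1, so the limit is the indicator of the open box.\<close>

definition bump :: "nat \<Rightarrow> complex \<Rightarrow> complex \<Rightarrow> complex \<Rightarrow> complex" where
  "bump n p q z =
     of_real (flat 0 (real (Suc n) * ((Re z - Re p) * (Re q - Re z))))
     * of_real (flat 0 (real (Suc n) * ((Im z - Im p) * (Im q - Im z))))"

lemma elem_smooth_bump: "elem_smooth (bump n p q)"
proof -
  have re: "elem_smooth (\<lambda>z. of_real (Re z))" by (intro elem_smooth_Re elem_smooth_intros)
  have "elem_smooth (\<lambda>z. of_real (Re ((-\<i>) * z)))" by (intro elem_smooth_Re elem_smooth_intros)
  then have im: "elem_smooth (\<lambda>z. of_real (Im z))" by simp
  have "elem_smooth (\<lambda>z. of_real (flat 0 (Re (of_nat (Suc n) * ((of_real (Re z) - of_real (Re p)) * (of_real (Re q) - of_real (Re z))))))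
     * of_real (flat 0 (Re (of_nat (Suc n) * ((of_real (Im z) - of_real (Im p)) * (of_real (Im q) - of_real (Im z)))))))"
    by (intro elem_smooth_intros re im)
  then show ?thesis by (simp add: bump_def[abs_def] distrib_right flip: of_real_diff)
qed

lemma mem_box_complex: "z \<in> box p q \<longleftrightarrow> Re p < Re z \<and> Re z < Re q \<and> Im p < Im z \<and> Im z < Im q"
  by (auto simp: box_def Basis_complex_def)

lemma bump_eq_0:
  assumes "box p q \<noteq> {}" "z \<notin> box p q"
  shows "bump n p q z = 0"
proof -
  have "Re p < Re q" "Im p < Im q" using assms(1) by (auto simp: mem_box_complex)
  then have "(Re z - Re p) * (Re q - Re z) \<le> 0 \<or> (Im z - Im p) * (Im q - Im z) \<le> 0"
    using assms(2) by (auto simp: mem_box_complex mult_le_0_iff)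
  then show ?thesis by (auto simp: bump_def flat_def zero_less_mult_iff mult_le_0_iff)
qed

lemma bump_tendsto:
  assumes "z \<in> box p q"
  shows "(\<lambda>n. bump n p q z) \<longlonglongrightarrow> 1"
proof -
  have "(\<lambda>n. bump n p q z) \<longlonglongrightarrow> of_real (indicator {0<..} ((Re z - Re p) * (Re q - Re z))) * of_real (indicator {0<..} ((Im z - Im p) * (Im q - Im z)))"
    unfolding bump_def by (intro tendsto_intros flat0_scaled_tendsto)
  then show ?thesis using assms by (simp add: mem_box_complex)
qed

lemma norm_bump_le: "cmod (bump n p q z) \<le> 1"
  unfolding bump_def by (simp add: norm_mult flat_nonneg flat0_le_1 mult_le_one)

lemma test_function_bump:
  assumes "box p q \<noteq> {}" "cbox p q \<subseteq> U"
  shows "test_function U (bump n p q)"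
proof -
  have "closure {z. bump n p q z \<noteq> 0} \<subseteq> cbox p q"
    by (rule closure_minimal[OF _ closed_cbox]) (use bump_eq_0[OF assms(1)] box_subset_cbox[of p q] in blast)
  moreover from this have "compact (closure {z. bump n p q z \<noteq> 0})"
    by (meson bounded_subset bounded_cbox closed_closure compact_eq_bounded_closed)
  ultimately show ?thesis
    using assms(2) smooth_elem[OF elem_smooth_bump] by (auto simp: test_function_def)
qed

text \<open>Bump functions recover the integral of g over every open box whose closed box lies in U.
  The box lemma then applies to g restricted to one such box, and countably many of them cover U up
  to their null boundaries.\<close>

lemma AE_eq_0_if_test_function:
  assumes "open U" and g[measurable]: "g \<in> borel_measurable borel"
    and loc: "\<And>K. compact K \<Longrightarrow> K \<subseteq> U \<Longrightarrow> set_integrable lborel K g"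
    and test: "\<And>\<phi>. test_function U \<phi> \<Longrightarrow> (LINT z|lborel. g z * \<phi> z) = 0"
  shows "AE z in lborel. z \<in> U \<longrightarrow> g z = 0"
proof -
  have box0: "(LINT z|lborel. indicator (box p q) z *\<^sub>R g z) = 0" if "cbox p q \<subseteq> U" for p q
  proof (cases "box p q = {}")
    case False
    have "(\<lambda>n. LINT z|lborel. g z * bump n p q z) \<longlonglongrightarrow> (LINT z|lborel. indicator (box p q) z *\<^sub>R g z)"
    proof (rule integral_dominated_convergence[where w="\<lambda>z. norm (indicator (cbox p q) z *\<^sub>R g z)"])
      show "integrable lborel (\<lambda>z. norm (indicator (cbox p q) z *\<^sub>R g z))"
        using loc[OF compact_cbox that] by (simp only: set_integrable_def integrable_norm)
      show "AE z in lborel. (\<lambda>n. g z * bump n p q z) \<longlonglongrightarrow> indicator (box p q) z *\<^sub>R g z"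
      proof (rule AE_I2)
        fix z
        show "(\<lambda>n. g z * bump n p q z) \<longlonglongrightarrow> indicator (box p q) z *\<^sub>R g z"
        proof (cases "z \<in> box p q")
          case True
          from tendsto_mult[OF tendsto_const bump_tendsto[OF this]] show ?thesis using True by simp
        qed (simp add: bump_eq_0[OF False])
      qed
      show "AE z in lborel. norm (g z * bump n p q z) \<le> norm (indicator (cbox p q) z *\<^sub>R g z)" for n
      proof (rule AE_I2)
        fix z
        show "norm (g z * bump n p q z) \<le> norm (indicator (cbox p q) z *\<^sub>R g z)"
        proof (cases "z \<in> box p q")
          case True
          then show ?thesis using norm_bump_le[of n p q z] box_subset_cbox[of p q]
            by (auto simp: norm_mult mult_left_le)
        qed (simp add: bump_eq_0[OF False])
      qed
      have "bump n p q \<in> borel_measurable borel" for n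
        using test_function_props(2)[OF test_function_bump[OF False that]] by (rule borel_measurable_continuous_onI)
      then show "(\<lambda>z. g z * bump n p q z) \<in> borel_measurable lborel" for n by simp
    qed simp
    moreover have "(LINT z|lborel. g z * bump n p q z) = 0" for n
      by (rule test[OF test_function_bump[OF False that]])
    ultimately show ?thesis by (simp add: LIMSEQ_const_iff)
  qed simp
  have cb: "AE z in lborel. z \<in> box a b \<longrightarrow> g z = 0" if "cbox a b \<subseteq> U" for a b
  proof -
    have sub: "cbox p q \<subseteq> U" if "box p q \<subseteq> box a b" "box p q \<noteq> {}" for p q
    proof -
      have "cbox p q = closure (box p q)" using that(2) by (simp add: closure_box)
      also have "\<dots> \<subseteq> cbox a b"
        by (rule closure_minimal[OF order_trans[OF that(1) box_subset_cbox] closed_cbox])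
      finally show ?thesis using \<open>cbox a b \<subseteq> U\<close> by blast
    qed
    have "AE z in lborel. indicator (box a b) z *\<^sub>R g z = 0"
    proof (rule AE_eq_0_if_integral_box_eq_0)
      have "set_integrable lborel (box a b) g"
        by (rule set_integrable_subset[OF loc[OF compact_cbox that]]) (auto simp: box_subset_cbox)
      then show "integrable lborel (\<lambda>z. indicator (box a b) z *\<^sub>R g z)"
        by (simp add: set_integrable_def)
      show "(LINT z|lborel. indicator (box a b) z *\<^sub>R g z) = 0" by (rule box0[OF that])
      fix p q :: complex
      obtain r s where rs: "box p q \<inter> box a b = box r s" by (simp only: box_Int_box)
      \<comment> \<open>An empty intersection is treated apart, because its corners \<open>r\<close>
        and \<open>s\<close> say nothing about where \<open>cbox r s\<close> lies.\<close>
      have "(LINT z|lborel. indicator (box r s) z *\<^sub>R g z) = 0"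
        using sub[of r s] box0[of r s] rs by (cases "box r s = {}") auto
      then show "(LINT z|lborel. indicator (box p q) z *\<^sub>R indicator (box a b) z *\<^sub>R g z) = 0"
        unfolding rs[symmetric] by (simp add: indicator_inter_arith mult.commute)
    qed
    then show ?thesis by eventually_elim auto
  qed
  obtain D where D: "countable D" "D \<subseteq> Pow U" "\<And>X. X \<in> D \<Longrightarrow> \<exists>a b. X = cbox a b" "\<Union>D = U"
    using open_countable_Union_open_cbox[OF \<open>open U\<close>] by metis
  have "AE z in lborel. \<forall>X\<in>D. z \<in> X \<longrightarrow> g z = 0"
  proof (subst AE_ball_countable[OF D(1)], intro ballI)
    fix X assume X: "X \<in> D"
    then obtain a b where ab: "X = cbox a b" using D(3) by blast
    have "cbox a b - box a b \<in> null_sets lborel"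
      using negligible_frontier_interval[of a b] by (simp add: negligible_iff_null_sets null_sets_completion_iff)
    then have "AE z in lborel. z \<notin> cbox a b - box a b" by (rule AE_not_in)
    moreover have "AE z in lborel. z \<in> box a b \<longrightarrow> g z = 0" using cb X D(2) ab by blast
    ultimately show "AE z in lborel. z \<in> X \<longrightarrow> g z = 0" unfolding ab by eventually_elim auto
  qed
  then show ?thesis unfolding D(4)[symmetric] by eventually_elim auto
qed

section \<open>The Cauchy transform\<close>

lemma emeasure_ball_complex: "r \<ge> 0 \<Longrightarrow> emeasure lborel (ball c r :: complex set) = ennreal (pi * r\<^sup>2)"
  by (simp add: emeasure_ball unit_ball_vol_2)

text \<open>A replacement for polar coordinates: f is dominated by the sum of the constants
  \<open>c j\<close> on the balls, whose integral is the sum of constants times areas. Both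
  applications take dyadic radii.\<close>

lemma integrable_ball_sums:
  fixes f :: "complex \<Rightarrow> real" and c r :: "nat \<Rightarrow> real"
  assumes [measurable]: "f \<in> borel_measurable borel"
    and nn: "\<And>z. 0 \<le> f z" "\<And>j. 0 \<le> c j" "\<And>j. 0 \<le> r j"
    and sm: "summable (\<lambda>j. c j * (r j)\<^sup>2)"
    and ex: "\<And>z. f z \<noteq> 0 \<Longrightarrow> \<exists>j. z \<in> ball 0 (r j) \<and> f z \<le> c j"
  shows "integrable lborel f"
proof -
  have "ennreal (f z) \<le> (\<Sum>j. ennreal (c j) * indicator (ball 0 (r j)) z)" for z
  proof (cases "f z = 0")
    case False
    then obtain j where j: "z \<in> ball 0 (r j)" "f z \<le> c j" using ex by blast
    have "ennreal (f z) \<le> (\<Sum>j\<in>{j}. ennreal (c j) * indicator (ball 0 (r j)) z)"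
      using j by (simp add: ennreal_leI)
    also have "\<dots> \<le> (\<Sum>j. ennreal (c j) * indicator (ball 0 (r j)) z)"
      by (rule sum_le_suminf) auto
    finally show ?thesis .
  qed simp
  then have "(\<integral>\<^sup>+z. ennreal (f z) \<partial>lborel) \<le> (\<integral>\<^sup>+z. (\<Sum>j. ennreal (c j) * indicator (ball (0::complex) (r j)) z) \<partial>lborel)"
    by (intro nn_integral_mono)
  also have "\<dots> = (\<Sum>j. ennreal (c j) * emeasure lborel (ball 0 (r j) :: complex set))"
    by (subst nn_integral_suminf) (auto simp: nn_integral_cmult_indicator)
  also have "\<dots> = (\<Sum>j. ennreal (pi * (c j * (r j)\<^sup>2)))"
    by (simp add: emeasure_ball_complex nn ennreal_mult[symmetric] mult.left_commute)
  also have "\<dots> < \<infinity>"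
    using sm nn by (subst suminf_ennreal2) (auto intro!: summable_mult)
  finally show ?thesis
    using nn by (simp add: integrable_iff_bounded)
qed

text \<open>On the shell 2^-(j+1) \<le> |z| < 2^-j the integrand is at most 2^(p (j+1)), against an
  area of order 4^-j. The ratio 2^p / 4 is below 1 exactly for p < 2.\<close>

lemma integrable_norm_powr_ball:
  assumes "0 \<le> p" "p < 2"
  shows "integrable lborel (\<lambda>w::complex. indicator (ball 0 1) w * norm w powr - p)"
proof (rule integrable_ball_sums[where c="\<lambda>j. (2 powr p) ^ Suc j" and r="\<lambda>j. (1/2) ^ j"])
  have "2 powr p < 2 powr 2" by (rule powr_less_mono) (use assms in auto)
  then have "summable (\<lambda>j. 2 powr p * (2 powr p / 4) ^ j)"
    by (intro summable_mult summable_geometric) auto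
  moreover have "(\<lambda>j. (2 powr p) ^ Suc j * ((1/2) ^ j)\<^sup>2) = (\<lambda>j. 2 powr p * (2 powr p / 4) ^ j)"
    by (auto simp: fun_eq_iff power_divide power2_eq_square power_mult_distrib[symmetric] divide_simps)
  ultimately show "summable (\<lambda>j. (2 powr p) ^ Suc j * ((1/2) ^ j)\<^sup>2)" by simp
next
  fix z :: complex
  assume nz: "indicator (ball 0 1) z * norm z powr - p \<noteq> 0"
  then have z: "0 < norm z" "norm z < 1" by (auto simp: indicator_def split: if_splits)
  define j where "j = (LEAST n. (1/2) ^ Suc n \<le> norm z)"
  obtain n0 where "(1/2) ^ n0 < norm z" using real_arch_pow_inv[OF z(1), of "1/2"] by auto
  then have "(1/2) ^ Suc n0 \<le> norm z" using z(1) unfolding power_Suc by linarith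
  then have 1: "(1/2) ^ Suc j \<le> norm z" unfolding j_def by (rule LeastI)
  have 2: "norm z < (1/2) ^ j"
  proof (cases j)
    case (Suc i)
    then have "\<not> (1/2) ^ Suc i \<le> norm z" using not_less_Least[of i "\<lambda>n. (1/2) ^ Suc n \<le> norm z"] unfolding j_def[symmetric] by auto
    then show ?thesis using Suc by simp
  qed (use z in simp)
  have "norm z powr - p \<le> ((1/2) ^ Suc j) powr - p"
    by (rule powr_mono2') (use 1 assms in auto)
  also have "\<dots> = (2 powr p) ^ Suc j"
  proof -
    have "((1/2) ^ Suc j) powr - p = ((2::real) powr - real (Suc j)) powr - p"
      by (subst powr_minus, subst powr_realpow) (auto simp: power_divide inverse_eq_divide)
    also have "\<dots> = (2 powr p) powr real (Suc j)"
      by (simp add: powr_powr algebra_simps)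
    also have "\<dots> = (2 powr p) ^ Suc j" by (rule powr_realpow) simp
    finally show ?thesis .
  qed
  finally show "\<exists>j. z \<in> ball 0 ((1/2) ^ j) \<and> indicator (ball 0 1) z * norm z powr - p \<le> (2 powr p) ^ Suc j"
    using 2 z by (intro exI[of _ j]) auto
next
  show "(\<lambda>w::complex. indicator (ball 0 1) w * norm w powr - p) \<in> borel_measurable borel" by measurable
qed auto

text \<open>On the shell 2^j \<le> |z| < 2^(j+1), which is replaced by the full ball of radius 2 for
  j = 0, the bound 16^-j meets an area of order 4^j. Up to a factor this is the stereographic area
  density; it is the common profile of all \<open>rho d\<close>.\<close>

lemma integrable_decay: "integrable lborel (\<lambda>w::complex. 1 / (1 + (norm w)\<^sup>2)\<^sup>2)"
proof (rule integrable_ball_sums[where c="\<lambda>j. (1/16) ^ j" and r="\<lambda>j. 2 ^ Suc j"])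
  have "(\<lambda>j. (1/16) ^ j * (2 ^ Suc j)\<^sup>2) = (\<lambda>j. 4 * (1/4::real) ^ j)"
    by (auto simp: fun_eq_iff power_divide power2_eq_square power_mult_distrib[symmetric] divide_simps)
  then show "summable (\<lambda>j. (1/16) ^ j * (2 ^ Suc j)\<^sup>2 :: real)"
    by (simp add: summable_mult summable_geometric)
next
  fix z :: complex
  define j where "j = (LEAST n. norm z < 2 ^ Suc n)"
  obtain n0 where n0: "norm z < 2 ^ n0" using real_arch_pow[of 2 "norm z"] by auto
  have "norm z < 2 ^ Suc n0" by (rule less_le_trans[OF n0]) simp
  then have 1: "norm z < 2 ^ Suc j" unfolding j_def by (rule LeastI)
  have "16 ^ j \<le> (1 + (norm z)\<^sup>2)\<^sup>2"
  proof (cases j)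
    case (Suc i)
    then have "\<not> norm z < 2 ^ Suc i" using not_less_Least[of i "\<lambda>n. norm z < 2 ^ Suc n"] unfolding j_def[symmetric] by auto
    then have "2 ^ j \<le> norm z" using Suc by simp
    then have "(2 ^ j) ^ 4 \<le> norm z ^ 4" by (intro power_mono) auto
    also have "norm z ^ 4 = ((norm z)\<^sup>2)\<^sup>2" by simp
    also have "\<dots> \<le> (1 + (norm z)\<^sup>2)\<^sup>2" by (intro power_mono) auto
    finally show ?thesis by (simp add: power_mult[symmetric] mult.commute[of j]) (simp add: power_mult)
  qed (simp add: one_le_power)
  then show "\<exists>j. z \<in> ball 0 (2 ^ Suc j) \<and> 1 / (1 + (norm z)\<^sup>2)\<^sup>2 \<le> (1/16) ^ j"
    using 1 by (intro exI[of _ j]) (auto simp: power_divide divide_simps add_pos_nonneg)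
qed auto

text \<open>The uniformity in z is the point. Within distance 1 of z the integral is at most a
  reflected and translated copy of one fixed integral; elsewhere the integrand is at most 1 on a
  ball of fixed area.\<close>

lemma nn_integral_norm_powr_diff:
  fixes c :: complex
  assumes "0 \<le> p" "p < 2"
  obtains K where "0 \<le> K"
    "\<And>z. (\<integral>\<^sup>+w. indicator (ball c R) w * norm (z - w) powr - p \<partial>lborel) \<le> ennreal K"
proof -
  let ?f = "\<lambda>w::complex. indicator (ball 0 1) w * norm w powr - p"
  define K1 where "K1 = integral\<^sup>L lborel ?f"
  define K2 where "K2 = measure lborel (ball c R)"
  have fin: "emeasure lborel (ball c R) < \<infinity>" by (rule emeasure_bounded_finite) auto
  have "(\<integral>\<^sup>+w. indicator (ball c R) w * norm (z - w) powr - p \<partial>lborel) \<le> ennreal (K1 + K2)" for z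
  proof -
    have "(\<integral>\<^sup>+w. indicator (ball c R) w * norm (z - w) powr - p \<partial>lborel)
        \<le> (\<integral>\<^sup>+w. ennreal (?f (z - w)) + indicator (ball c R) w \<partial>lborel)"
    proof (intro nn_integral_mono)
      fix w
      show "ennreal (indicator (ball c R) w * norm (z - w) powr - p) \<le> ennreal (?f (z - w)) + indicator (ball c R) w"
      proof (cases "norm (z - w) < 1")
        case True
        then show ?thesis by (auto simp: indicator_def intro: ennreal_leI)
      next
        case False
        then have "norm (z - w) powr - p \<le> 1 powr - p"
          by (intro powr_mono2') (use assms in auto)
        then show ?thesis by (auto simp: indicator_def)
      qed
    qed
    also have "\<dots> = (\<integral>\<^sup>+w. ennreal (?f (z - w)) \<partial>lborel) + emeasure lborel (ball c R)"
      by (subst nn_integral_add; measurable; simp)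
    also have "(\<integral>\<^sup>+w. ennreal (?f (z - w)) \<partial>lborel) = (\<integral>\<^sup>+w. ennreal (?f w) \<partial>lborel)"
      using lborel_nn_integral_affine[of "\<lambda>w. ennreal (?f w)" "-1" z] by simp
    also have "\<dots> = ennreal K1"
      unfolding K1_def by (rule nn_integral_eq_integral[OF integrable_norm_powr_ball[OF assms]]) auto
    also have "emeasure lborel (ball c R) = ennreal K2"
      unfolding K2_def using fin by (intro emeasure_eq_ennreal_measure) auto
    finally show ?thesis
      by (simp add: K1_def K2_def)
  qed
  moreover have "0 \<le> K1 + K2" unfolding K1_def K2_def by auto
  ultimately show ?thesis using that by blast
qed

text \<open>Admissible densities have a bounded potential; this covers both bounded and, for \<open>q > 2\<close>, \<open>L^q\<close>
  functions of bounded support.\<close>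

definition admissible :: "(complex \<Rightarrow> complex) \<Rightarrow> real \<Rightarrow> bool" where
  "admissible g N \<longleftrightarrow> g \<in> borel_measurable borel \<and> 0 \<le> N \<and>
     (\<forall>z. (\<integral>\<^sup>+w. ennreal (cmod (g w) / cmod (z - w)) \<partial>lborel) \<le> ennreal N)"

text \<open>The value of this integral is \<open>pi\<close>, which is never needed.\<close>

definition bubble_mass :: real where
  "bubble_mass = (LINT w|lborel. 1 / (1 + (cmod w)\<^sup>2)\<^sup>2)"

text \<open>The denominator is the mass of each approximate Dirac measure \<open>rho d\<close>,
  which makes this the usual inverse of \<partial>-bar. The convention that the quotient is 0 at w =
  z concerns a null set.\<close>

definition cauchy :: "(complex \<Rightarrow> complex) \<Rightarrow> complex \<Rightarrow> complex" where
  "cauchy g z = (LINT w|lborel. g w / (z - w)) / of_real bubble_mass"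

lemma bubble_mass_pos: "0 < bubble_mass"
proof -
  have "bubble_mass \<noteq> 0"
  proof
    assume "bubble_mass = 0"
    then have "AE w::complex in lborel. 1 / (1 + (norm w)\<^sup>2)\<^sup>2 = 0"
      unfolding bubble_mass_def by (subst (asm) integral_nonneg_eq_0_iff_AE[OF integrable_decay]) auto
    then have "AE w::complex in lborel. False"
    proof eventually_elim
      fix w :: complex
      have "0 < 1 + (norm w)\<^sup>2" by (simp add: add_pos_nonneg)
      moreover assume "1 / (1 + (norm w)\<^sup>2)\<^sup>2 = 0"
      ultimately show False by simp
    qed
    then show False by (simp add: AE_iff_null null_sets_def)
  qed
  moreover have "0 \<le> bubble_mass" unfolding bubble_mass_def by (rule Bochner_Integration.integral_nonneg) auto
  ultimately show ?thesis by simp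
qed

lemma admissible_measurable: "admissible g N \<Longrightarrow> g \<in> borel_measurable borel"
  by (simp add: admissible_def)

lemma admissible_integrable:
  assumes "admissible g N"
  shows "integrable lborel (\<lambda>w. g w / (z - w))"
    "(LINT w|lborel. cmod (g w) / cmod (z - w)) \<le> N"
proof -
  have [measurable]: "g \<in> borel_measurable borel" using assms by (simp add: admissible_def)
  have *: "(\<integral>\<^sup>+w. ennreal (cmod (g w) / cmod (z - w)) \<partial>lborel) \<le> ennreal N" using assms by (simp add: admissible_def)
  also have "\<dots> < \<infinity>" by simp
  finally show "integrable lborel (\<lambda>w. g w / (z - w))"
    by (simp add: integrable_iff_bounded norm_divide)
  show "(LINT w|lborel. cmod (g w) / cmod (z - w)) \<le> N"
    using * assms by (subst integral_eq_nn_integral) (auto simp: admissible_def intro!: enn2real_leI)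
qed

lemma cauchy_bound:
  assumes "admissible g N"
  shows "cmod (cauchy g z) \<le> N / bubble_mass"
proof -
  have "cmod (LINT w|lborel. g w / (z - w)) \<le> (LINT w|lborel. cmod (g w / (z - w)))" by simp
  also have "\<dots> \<le> N" using admissible_integrable(2)[OF assms, of z] by (simp add: norm_divide)
  finally show ?thesis using bubble_mass_pos by (simp add: cauchy_def norm_divide divide_right_mono)
qed

lemma cauchy_measurable [measurable]:
  assumes [measurable]: "g \<in> borel_measurable borel"
  shows "cauchy g \<in> borel_measurable borel"
  unfolding cauchy_def[abs_def] by measurable

lemma admissible_mono:
  assumes "admissible g N" "h \<in> borel_measurable borel" "0 \<le> B" "\<And>w. cmod (h w) \<le> B * cmod (g w)"
  shows "admissible h (B * N)"
proof -
  have [measurable]: "g \<in> borel_measurable borel" using assms by (simp add: admissible_def)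
  have "(\<integral>\<^sup>+w. ennreal (cmod (h w) / cmod (z - w)) \<partial>lborel) \<le> ennreal (B * N)" for z
  proof -
    have "(\<integral>\<^sup>+w. ennreal (cmod (h w) / cmod (z - w)) \<partial>lborel) \<le> (\<integral>\<^sup>+w. ennreal B * ennreal (cmod (g w) / cmod (z - w)) \<partial>lborel)"
    proof (intro nn_integral_mono)
      fix w
      have "cmod (h w) / cmod (z - w) \<le> B * cmod (g w) / cmod (z - w)"
        by (intro divide_right_mono assms) simp
      then show "ennreal (cmod (h w) / cmod (z - w)) \<le> ennreal B * ennreal (cmod (g w) / cmod (z - w))"
        using assms(3) by (simp add: ennreal_mult[symmetric] ennreal_leI)
    qed
    also have "\<dots> = ennreal B * (\<integral>\<^sup>+w. ennreal (cmod (g w) / cmod (z - w)) \<partial>lborel)"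
      by (intro nn_integral_cmult) auto
    also have "\<dots> \<le> ennreal B * ennreal N"
      using assms(1) by (intro mult_left_mono) (auto simp: admissible_def)
    also have "\<dots> = ennreal (B * N)" using assms by (simp add: ennreal_mult admissible_def)
    finally show ?thesis .
  qed
  then show ?thesis using assms by (simp add: admissible_def)
qed

lemma admissible_times:
  assumes "admissible g N" "b \<in> borel_measurable borel" "\<And>w. cmod (b w) \<le> B"
  shows "admissible (\<lambda>w. g w * b w) (B * N)" "admissible (\<lambda>w. b w * g w) (B * N)"
proof -
  have [measurable]: "g \<in> borel_measurable borel" "b \<in> borel_measurable borel" using assms by (auto simp: admissible_def)
  have "0 \<le> B" using assms(3)[of 0] norm_ge_zero order_trans by blast
  then show "admissible (\<lambda>w. g w * b w) (B * N)" "admissible (\<lambda>w. b w * g w) (B * N)"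
    using assms(3) by (intro admissible_mono[OF assms(1)]; simp add: norm_mult mult.commute mult_right_mono)+
qed

lemma admissible_add:
  assumes "admissible g N" "admissible h N'"
  shows "admissible (\<lambda>w. g w + h w) (N + N')"
proof -
  have [measurable]: "g \<in> borel_measurable borel" "h \<in> borel_measurable borel" using assms by (auto simp: admissible_def)
  have "(\<integral>\<^sup>+w. ennreal (cmod (g w + h w) / cmod (z - w)) \<partial>lborel) \<le> ennreal (N + N')" for z
  proof -
    have "(\<integral>\<^sup>+w. ennreal (cmod (g w + h w) / cmod (z - w)) \<partial>lborel)
      \<le> (\<integral>\<^sup>+w. ennreal (cmod (g w) / cmod (z - w)) + ennreal (cmod (h w) / cmod (z - w)) \<partial>lborel)"
      by (intro nn_integral_mono)
        (auto simp: ennreal_plus[symmetric] add_divide_distrib[symmetric] norm_triangle_ineq divide_right_mono simp del: ennreal_plus intro!: ennreal_leI)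
    also have "\<dots> = (\<integral>\<^sup>+w. ennreal (cmod (g w) / cmod (z - w)) \<partial>lborel) + (\<integral>\<^sup>+w. ennreal (cmod (h w) / cmod (z - w)) \<partial>lborel)"
      by (intro nn_integral_add) auto
    also have "\<dots> \<le> ennreal N + ennreal N'"
      using assms by (intro add_mono) (auto simp: admissible_def)
    finally show ?thesis using assms by (simp add: admissible_def)
  qed
  then show ?thesis using assms by (simp add: admissible_def)
qed

lemma cauchy_add:
  assumes "admissible g N" "admissible h N'"
  shows "cauchy (\<lambda>w. g w + h w) z = cauchy g z + cauchy h z"
  using admissible_integrable(1)[OF assms(1), of z] admissible_integrable(1)[OF assms(2), of z]
  by (simp add: cauchy_def add_divide_distrib)

lemma cauchy_cmult: "cauchy (\<lambda>w. k * g w) z = k * cauchy g z"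
proof -
  have "(LINT w|lborel. k * g w / (z - w)) = (LINT w|lborel. k * (g w / (z - w)))" by simp
  also have "\<dots> = k * (LINT w|lborel. g w / (z - w))" by (rule integral_mult_right_zero)
  finally show ?thesis by (simp add: cauchy_def)
qed

lemma cauchy_cong_AE:
  assumes "AE w in lborel. g w = h w" "g \<in> borel_measurable borel" "h \<in> borel_measurable borel"
  shows "cauchy g z = cauchy h z"
proof -
  have [measurable]: "g \<in> borel_measurable borel" "h \<in> borel_measurable borel" using assms by auto
  have "(LINT w|lborel. g w / (z - w)) = (LINT w|lborel. h w / (z - w))"
    by (rule integral_cong_AE) (use assms(1) in auto)
  then show ?thesis by (simp add: cauchy_def)
qed

section \<open>Products and exponentials of Cauchy transforms\<close>

lemma pair_kernel_integrable:
  assumes g: "admissible g N" and h: "admissible h N'"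
  shows "integrable (lborel \<Otimes>\<^sub>M lborel) (\<lambda>(w, t). g w / (z - w) * (h t / (w - t)))"
proof (rule lborel_pair.Fubini_integrable)
  have [measurable]: "g \<in> borel_measurable borel" "h \<in> borel_measurable borel" using g h by (auto simp: admissible_def)
  show "(\<lambda>(w, t). g w / (z - w) * (h t / (w - t))) \<in> borel_measurable (lborel \<Otimes>\<^sub>M lborel)"
    by measurable
  have *: "(LINT t|lborel. norm (g w / (z - w) * (h t / (w - t)))) =
      cmod (g w / (z - w)) * (LINT t|lborel. cmod (h t) / cmod (w - t))" for w
  proof -
    have "(\<lambda>t. norm (g w / (z - w) * (h t / (w - t)))) = (\<lambda>t. cmod (g w / (z - w)) * (cmod (h t) / cmod (w - t)))"
      by (simp add: fun_eq_iff norm_mult norm_divide)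
    then show ?thesis by (simp only: integral_mult_right_zero)
  qed
  have "integrable lborel (\<lambda>w. cmod (g w / (z - w)) * (LINT t|lborel. cmod (h t) / cmod (w - t)))"
  proof (rule Bochner_Integration.integrable_bound)
    show "integrable lborel (\<lambda>w. N' * cmod (g w / (z - w)))"
      using admissible_integrable(1)[OF g] by (intro integrable_mult_right integrable_norm)
    show "AE w in lborel. norm (cmod (g w / (z - w)) * (LINT t|lborel. cmod (h t) / cmod (w - t))) \<le> norm (N' * cmod (g w / (z - w)))"
    proof (rule AE_I2)
      fix w
      have "0 \<le> (LINT t|lborel. cmod (h t) / cmod (w - t))" by (rule Bochner_Integration.integral_nonneg) auto
      moreover have "(LINT t|lborel. cmod (h t) / cmod (w - t)) \<le> N'" by (rule admissible_integrable(2)[OF h])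
      ultimately show "norm (cmod (g w / (z - w)) * (LINT t|lborel. cmod (h t) / cmod (w - t))) \<le> norm (N' * cmod (g w / (z - w)))"
        using admissible_def[of h N'] h
        by (subst (1 2) real_norm_def, subst (1 2) abs_of_nonneg) (auto simp: mult.commute[of N'] intro!: mult_left_mono mult_nonneg_nonneg simp del: norm_divide)
    qed
  qed measurable
  then show "integrable lborel (\<lambda>w. LINT t|lborel. norm (case (w, t) of (w, t) \<Rightarrow> g w / (z - w) * (h t / (w - t))))"
    using * by simp
  show "AE w in lborel. integrable lborel (\<lambda>t. case (w, t) of (w, t) \<Rightarrow> g w / (z - w) * (h t / (w - t)))"
    unfolding prod.case by (intro AE_I2 integrable_mult_right admissible_integrable(1)[OF h])
qed

lemma partial_fraction:
  fixes a b :: "'a::field"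
  assumes "a \<noteq> 0" "b \<noteq> 0" "a \<noteq> b"
  shows "1 / a * (1 / (b - a)) + 1 / b * (1 / (a - b)) = 1 / (a * b)"
proof -
  have "1 / (a - b) = - (1 / (b - a))" using minus_divide_right[of 1 "b - a"] by simp
  moreover have "1 / a - 1 / b = (b - a) / (a * b)" using assms by (simp add: diff_frac_eq)
  then have "(1 / a - 1 / b) * (1 / (b - a)) = 1 / (a * b)" using assms by simp
  ultimately show ?thesis by (simp only: left_diff_distrib mult_minus_right add_uminus_conv_diff)
qed

lemma AE_lborel_neq: "AE w in lborel. w \<noteq> (z::complex)"
  using AE_lborel_singleton by blast

text \<open>The Leibniz rule for the inverse of the \<open>\<partial>\<close>-bar operator is the partial fraction
  \<open>1/((z-w)(z-t)) = 1/((z-w)(w-t)) + 1/((z-t)(t-w))\<close> under the integral sign.\<close>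

lemma cauchy_times_cauchy:
  assumes g: "admissible g N" and h: "admissible h N'"
  shows "cauchy g z * cauchy h z = cauchy (\<lambda>w. g w * cauchy h w + h w * cauchy g w) z"
proof -
  have [measurable]: "g \<in> borel_measurable borel" "h \<in> borel_measurable borel" using g h by (auto simp: admissible_def)
  let ?m = "of_real bubble_mass :: complex"
  have m: "?m \<noteq> 0" using bubble_mass_pos by simp
  have int: "(LINT w|lborel. ?m * (f w / (z - w))) = ?m * (?m * cauchy f z)" for f
    using m by (subst integral_mult_right_zero) (simp add: cauchy_def)
  let ?F = "\<lambda>w t. g w / (z - w) * (h t / (w - t))"
  let ?G = "\<lambda>w t. h t / (z - t) * (g w / (t - w))"
  have F: "integrable (lborel \<Otimes>\<^sub>M lborel) (\<lambda>(w, t). ?F w t)" by (rule pair_kernel_integrable[OF g h])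
  have G': "integrable (lborel \<Otimes>\<^sub>M lborel) (\<lambda>(t, w). ?G w t)" by (rule pair_kernel_integrable[OF h g])
  have G: "integrable (lborel \<Otimes>\<^sub>M lborel) (\<lambda>(w, t). ?G w t)"
    using lborel_pair.integrable_product_swap[OF G'] by simp
  have iF: "integrable lborel (\<lambda>w. LINT t|lborel. ?F w t)" using lborel_pair.integrable_fst[OF F] by simp
  have iG: "integrable lborel (\<lambda>w. LINT t|lborel. ?G w t)" using lborel_pair.integrable_fst[OF G] by simp
  \<comment> \<open>The second kernel is written with its variables exchanged, so that both inner
    integrals run over t. They add up by partial fractions away from the null sets on which two of
    z, w, t coincide.\<close>
  have FG: "(LINT w|lborel. (LINT t|lborel. ?F w t) + (LINT t|lborel. ?G w t)) = (LINT w|lborel. g w / (z - w) * (LINT t|lborel. h t / (z - t)))"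
  proof (rule integral_cong_AE)
    have "AE w in lborel. integrable lborel (?G w)" using lborel_pair.AE_integrable_fst[OF G] by simp
    moreover have "AE w in lborel. w \<noteq> z" by (rule AE_lborel_neq)
    ultimately show "AE w in lborel. (LINT t|lborel. ?F w t) + (LINT t|lborel. ?G w t) = g w / (z - w) * (LINT t|lborel. h t / (z - t))"
    proof eventually_elim
      fix w assume iG: "integrable lborel (?G w)" and w: "w \<noteq> z"
      have "integrable lborel (?F w)" by (intro integrable_mult_right admissible_integrable(1)[OF h])
      then have "(LINT t|lborel. ?F w t) + (LINT t|lborel. ?G w t) = (LINT t|lborel. ?F w t + ?G w t)"
        using iG by simp
      also have "\<dots> = (LINT t|lborel. g w / (z - w) * (h t / (z - t)))"
      proof (rule integral_cong_AE)
        have "AE t in lborel. t \<noteq> z" "AE t in lborel. t \<noteq> w" by (rule AE_lborel_neq)+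
        then show "AE t in lborel. ?F w t + ?G w t = g w / (z - w) * (h t / (z - t))"
        proof eventually_elim
          fix t assume t: "t \<noteq> z" "t \<noteq> w"
          have "1 / (z - w) * (1 / (w - t)) + 1 / (z - t) * (1 / (t - w)) = 1 / ((z - w) * (z - t))"
            using partial_fraction[of "z - w" "z - t"] t w by simp
          then have "g w * h t * (1 / (z - w) * (1 / (w - t)) + 1 / (z - t) * (1 / (t - w))) = g w * h t * (1 / ((z - w) * (z - t)))" by simp
          then show "?F w t + ?G w t = g w / (z - w) * (h t / (z - t))"
            by (simp add: algebra_simps)
        qed
      qed measurable
      also have "\<dots> = g w / (z - w) * (LINT t|lborel. h t / (z - t))" by (rule integral_mult_right_zero)
      finally show "(LINT t|lborel. ?F w t) + (LINT t|lborel. ?G w t) = g w / (z - w) * (LINT t|lborel. h t / (z - t))" .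
    qed
  qed measurable
  have "(LINT w|lborel. LINT t|lborel. ?F w t) = (LINT w|lborel. ?m * ((g w * cauchy h w) / (z - w)))"
  proof (rule Bochner_Integration.integral_cong)
    fix w
    have "(LINT t|lborel. ?F w t) = g w / (z - w) * (LINT t|lborel. h t / (w - t))" by (rule integral_mult_right_zero)
    then show "(LINT t|lborel. ?F w t) = ?m * ((g w * cauchy h w) / (z - w))" using m by (simp add: cauchy_def)
  qed simp
  also have "\<dots> = ?m * (?m * cauchy (\<lambda>w. g w * cauchy h w) z)" by (rule int)
  finally have eF: "(LINT w|lborel. LINT t|lborel. ?F w t) = ?m * (?m * cauchy (\<lambda>w. g w * cauchy h w) z)" .
  have "(LINT w|lborel. LINT t|lborel. ?G w t) = (LINT t|lborel. LINT w|lborel. ?G w t)"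
    using lborel_pair.Fubini_integral[OF G] by simp
  also have "\<dots> = (LINT t|lborel. ?m * ((h t * cauchy g t) / (z - t)))"
  proof (rule Bochner_Integration.integral_cong)
    fix t
    have "(LINT w|lborel. ?G w t) = h t / (z - t) * (LINT w|lborel. g w / (t - w))" by (rule integral_mult_right_zero)
    then show "(LINT w|lborel. ?G w t) = ?m * ((h t * cauchy g t) / (z - t))" using m by (simp add: cauchy_def)
  qed simp
  also have "\<dots> = ?m * (?m * cauchy (\<lambda>w. h w * cauchy g w) z)" by (rule int)
  finally have eG: "(LINT w|lborel. LINT t|lborel. ?G w t) = ?m * (?m * cauchy (\<lambda>w. h w * cauchy g w) z)" .
  have "?m * cauchy g z * (?m * cauchy h z) = (LINT w|lborel. g w / (z - w) * (LINT t|lborel. h t / (z - t)))"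
    using m by (subst integral_mult_left_zero) (simp add: cauchy_def)
  also have "\<dots> = (LINT w|lborel. LINT t|lborel. ?F w t) + (LINT w|lborel. LINT t|lborel. ?G w t)"
    unfolding FG[symmetric] using iF iG by simp
  finally have "?m * (?m * (cauchy g z * cauchy h z)) = ?m * (?m * (cauchy (\<lambda>w. g w * cauchy h w) z + cauchy (\<lambda>w. h w * cauchy g w) z))"
    unfolding eF eG by (simp add: algebra_simps)
  then have "cauchy g z * cauchy h z = cauchy (\<lambda>w. g w * cauchy h w) z + cauchy (\<lambda>w. h w * cauchy g w) z"
    using m by simp
  also have "\<dots> = cauchy (\<lambda>w. g w * cauchy h w + h w * cauchy g w) z"
    by (rule cauchy_add[symmetric]; rule admissible_times(1)[OF g] admissible_times(1)[OF h])
      (auto intro: cauchy_bound g h)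
  finally show ?thesis .
qed

text \<open>The density is the formal \<partial>-bar derivative of (C \<alpha>)^n f, obtained by
  iterating the Leibniz rule. The constant k survives only for n = 0, because one factor C \<alpha>
  turns it into the transform of k \<alpha>. Growth in n is left open here and controlled when the
  series is summed.\<close>

lemma power_cauchy_times:
  assumes a: "admissible \<alpha> A" and g: "admissible g N" and f: "\<And>z. f z = k + cauchy g z"
  shows "\<exists>M. admissible (\<lambda>w. cauchy \<alpha> w ^ n * g w + of_nat n * cauchy \<alpha> w ^ (n - 1) * \<alpha> w * f w) M \<and>
    (\<forall>z. cauchy \<alpha> z ^ n * f z = (if n = 0 then k else 0)
      + cauchy (\<lambda>w. cauchy \<alpha> w ^ n * g w + of_nat n * cauchy \<alpha> w ^ (n - 1) * \<alpha> w * f w) z)"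
proof (induction n)
  case 0
  then show ?case using g f by auto
next
  case (Suc n)
  have [measurable]: "g \<in> borel_measurable borel" "\<alpha> \<in> borel_measurable borel" using g a by (auto simp: admissible_def)
  have fe: "f = (\<lambda>z. k + cauchy g z)" using f by auto
  have [measurable]: "f \<in> borel_measurable borel" unfolding fe by measurable
  define h where "h w = cauchy \<alpha> w ^ n * g w + of_nat n * cauchy \<alpha> w ^ (n - 1) * \<alpha> w * f w" for w
  define k' where "k' = (if n = 0 then k else 0)"
  obtain M where M: "admissible h M" and eq: "\<And>z. cauchy \<alpha> z ^ n * f z = k' + cauchy h z"
    using Suc unfolding h_def[abs_def] k'_def by blast
  have "cauchy \<alpha> z * (k' + cauchy h z) = cauchy (\<lambda>w. \<alpha> w * (k' + cauchy h w) + cauchy \<alpha> w * h w) z" for z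
  proof -
    have "cauchy \<alpha> z * (k' + cauchy h z) = k' * cauchy \<alpha> z + cauchy (\<lambda>w. \<alpha> w * cauchy h w + h w * cauchy \<alpha> w) z"
      by (simp add: algebra_simps cauchy_times_cauchy[OF a M])
    also have "\<dots> = cauchy (\<lambda>w. k' * \<alpha> w) z + cauchy (\<lambda>w. \<alpha> w * cauchy h w + h w * cauchy \<alpha> w) z"
      by (simp add: cauchy_cmult)
    also have "\<dots> = cauchy (\<lambda>w. k' * \<alpha> w + (\<alpha> w * cauchy h w + h w * cauchy \<alpha> w)) z"
    proof (rule cauchy_add[symmetric])
      show "admissible (\<lambda>w. k' * \<alpha> w) (cmod k' * A)"
        by (intro admissible_times(2)[OF a]) auto
      have "h \<in> borel_measurable borel" using M by (rule admissible_measurable)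
      then show "admissible (\<lambda>w. \<alpha> w * cauchy h w + h w * cauchy \<alpha> w) (M / bubble_mass * A + A / bubble_mass * M)"
        by (intro admissible_add admissible_times(1)[OF a] admissible_times(1)[OF M] cauchy_bound[OF M] cauchy_bound[OF a]) auto
    qed
    finally show ?thesis by (simp add: algebra_simps)
  qed
  then have eq': "cauchy \<alpha> z ^ Suc n * f z = cauchy (\<lambda>w. \<alpha> w * (k' + cauchy h w) + cauchy \<alpha> w * h w) z" for z
    using eq by (simp add: mult.assoc)
  have fn_eq: "(\<lambda>w. \<alpha> w * (k' + cauchy h w) + cauchy \<alpha> w * h w)
     = (\<lambda>w. cauchy \<alpha> w ^ Suc n * g w + of_nat (Suc n) * cauchy \<alpha> w ^ (Suc n - 1) * \<alpha> w * f w)"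
  proof
    fix w
    \<comment> \<open>The truncated \<open>n - 1\<close> is harmless at n = 0, where the factor
      \<open>of_nat n\<close> vanishes.\<close>
    have "cauchy \<alpha> w * (of_nat n * cauchy \<alpha> w ^ (n - 1) * \<alpha> w * f w) = of_nat n * cauchy \<alpha> w ^ n * \<alpha> w * f w"
      by (cases n) auto
    then show "\<alpha> w * (k' + cauchy h w) + cauchy \<alpha> w * h w = cauchy \<alpha> w ^ Suc n * g w + of_nat (Suc n) * cauchy \<alpha> w ^ (Suc n - 1) * \<alpha> w * f w"
      unfolding eq[symmetric] h_def by (simp add: algebra_simps)
  qed
  have "\<exists>M. admissible (\<lambda>w. \<alpha> w * (k' + cauchy h w) + cauchy \<alpha> w * h w) M"
  proof -
    have "cmod (k' + cauchy h w) \<le> cmod k' + M / bubble_mass" for w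
      using cauchy_bound[OF M, of w] norm_triangle_ineq[of k' "cauchy h w"] by linarith
    then have "admissible (\<lambda>w. \<alpha> w * (k' + cauchy h w)) ((cmod k' + M / bubble_mass) * A)"
      using M by (intro admissible_times(1)[OF a]) (auto simp: admissible_def)
    moreover have "admissible (\<lambda>w. cauchy \<alpha> w * h w) (A / bubble_mass * M)"
      by (intro admissible_times(2)[OF M] cauchy_bound[OF a]) simp
    ultimately show ?thesis using admissible_add by blast
  qed
  then show ?case using eq' unfolding fn_eq by auto
qed

text \<open>The identities for powers are summed with the coefficients of exp (- x); the terms n (C
  \<alpha>)^(n-1) add up to - exp (- C \<alpha>), whence the sign of \<alpha> f. If \<alpha> f = g,
  the correction disappears and f = k exp (C \<alpha>).\<close>

lemma cauchy_similarity:
  assumes a: "admissible \<alpha> A" and g: "admissible g N" and f: "\<And>z. f z = k + cauchy g z"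
  shows "f z * exp (- cauchy \<alpha> z) = k + cauchy (\<lambda>w. (g w - \<alpha> w * f w) * exp (- cauchy \<alpha> w)) z"
proof -
  have [measurable]: "g \<in> borel_measurable borel" "\<alpha> \<in> borel_measurable borel" using g a by (auto simp: admissible_def)
  have fe: "f = (\<lambda>z. k + cauchy g z)" using f by auto
  have [measurable]: "f \<in> borel_measurable borel" unfolding fe by measurable
  let ?a = "cauchy \<alpha>" and ?B = "A / bubble_mass"
  define F where "F = cmod k + N / bubble_mass"
  have F: "cmod (f w) \<le> F" for w
    using cauchy_bound[OF g, of w] norm_triangle_ineq[of k "cauchy g w"] by (simp add: f F_def)
  define h where "h n w = ?a w ^ n * g w + of_nat n * ?a w ^ (n - 1) * \<alpha> w * f w" for n w
  define s where "s n = ((- 1) ^ n / fact n :: complex)" for n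
  have adm: "\<exists>M. admissible (h n) M" and eq: "?a z ^ n * f z = (if n = 0 then k else 0) + cauchy (h n) z" for n z
    using power_cauchy_times[OF a g f, of n] unfolding h_def[abs_def] by blast+
  have ser: "(\<lambda>n. s n * ?a w ^ n) sums exp (- ?a w)" for w
  proof -
    have "(\<lambda>n. (- ?a w) ^ n /\<^sub>R fact n) sums exp (- ?a w)" by (rule exp_converges)
    moreover have "(- ?a w) ^ n /\<^sub>R fact n = s n * ?a w ^ n" for n
      by (subst power_minus) (simp add: s_def scaleR_conv_of_real divide_inverse of_real_inverse)
    ultimately show ?thesis by simp
  qed
  \<comment> \<open>The term of index 0 is 0, so this is the exponential series shifted by
    one.\<close>
  have ser': "(\<lambda>n. s n * (of_nat n * ?a w ^ (n - 1))) sums (- exp (- ?a w))" for w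
  proof -
    have "(\<lambda>n. - (s n * ?a w ^ n)) sums - exp (- ?a w)" by (rule sums_minus[OF ser])
    moreover have "- (s n * ?a w ^ n) = s (Suc n) * (of_nat (Suc n) * ?a w ^ (Suc n - 1))" for n
      by (simp add: s_def divide_simps del: of_nat_Suc)
    ultimately have "(\<lambda>n. s (Suc n) * (of_nat (Suc n) * ?a w ^ (Suc n - 1))) sums (- exp (- ?a w))" by (simp only:)
    then show ?thesis using sums_Suc_iff[of "\<lambda>n. s n * (of_nat n * ?a w ^ (n - 1))" "- exp (- ?a w)"] by simp
  qed
  have hser: "(\<lambda>n. s n * h n w) sums ((g w - \<alpha> w * f w) * exp (- ?a w))" for w
  proof -
    have "(\<lambda>n. s n * ?a w ^ n * g w + s n * (of_nat n * ?a w ^ (n - 1)) * (\<alpha> w * f w))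
        sums (exp (- ?a w) * g w + - exp (- ?a w) * (\<alpha> w * f w))"
      by (intro sums_add sums_mult2 ser ser')
    then show ?thesis by (simp add: h_def algebra_simps)
  qed
  have B0: "0 \<le> ?B" using a bubble_mass_pos by (simp add: admissible_def)
  \<comment> \<open>Replacing |C \<alpha>| by its bound \<open>?B\<close> turns both sums into
    partial sums of exp \<open>?B\<close>. The resulting majorant is independent of n and integrable
    against 1/|z - w|.\<close>
  have bnd: "cmod (\<Sum>i<n. s i * h i w) \<le> exp ?B * (cmod (g w) + F * cmod (\<alpha> w))" for n w
  proof -
    have s1: "cmod (\<Sum>i<n. s i * h i w) \<le> (\<Sum>i<n. ?B ^ i / fact i * cmod (g w) + real i * ?B ^ (i - 1) / fact i * (F * cmod (\<alpha> w)))"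
    proof (rule sum_norm_le)
      fix i
      have p: "cmod (?a w) ^ j \<le> ?B ^ j" for j by (intro power_mono cauchy_bound[OF a]) simp
      have "cmod (s i * h i w) \<le> 1 / fact i * (cmod (?a w) ^ i * cmod (g w) + real i * cmod (?a w) ^ (i - 1) * cmod (\<alpha> w) * cmod (f w))"
        unfolding h_def by (simp add: s_def norm_mult norm_divide norm_power divide_right_mono)
          (intro divide_right_mono order_trans[OF norm_triangle_ineq], auto simp: norm_mult norm_power)
      also have "\<dots> \<le> 1 / fact i * (?B ^ i * cmod (g w) + real i * ?B ^ (i - 1) * cmod (\<alpha> w) * F)"
        using B0 by (intro mult_left_mono add_mono mult_mono p F) auto
      finally show "cmod (s i * h i w) \<le> ?B ^ i / fact i * cmod (g w) + real i * ?B ^ (i - 1) / fact i * (F * cmod (\<alpha> w))"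
        by (simp add: algebra_simps)
    qed
    have e1: "(\<Sum>i<m. ?B ^ i / fact i) \<le> exp ?B" for m
    proof -
      have "(\<Sum>i<m. ?B ^ i /\<^sub>R fact i) \<le> (\<Sum>i. ?B ^ i /\<^sub>R fact i)"
        by (rule sum_le_suminf) (use B0 exp_converges[of ?B] in \<open>auto simp: sums_iff\<close>)
      then show ?thesis using exp_converges[of ?B] by (simp add: sums_iff divide_inverse mult.commute)
    qed
    have e2: "(\<Sum>i<m. real i * ?B ^ (i - 1) / fact i) \<le> exp ?B" for m
    proof (cases m)
      case (Suc l)
      have "(\<Sum>i<Suc l. real i * ?B ^ (i - 1) / fact i) = (\<Sum>i<l. real (Suc i) * ?B ^ (Suc i - 1) / fact (Suc i))"
        by (subst sum.lessThan_Suc_shift) simp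
      also have "\<dots> = (\<Sum>i<l. ?B ^ i / fact i)"
        by (intro sum.cong refl) (simp add: divide_simps del: of_nat_Suc)
      finally show ?thesis using e1[of l] Suc by simp
    qed simp
    have F0: "0 \<le> F" using F[of 0] norm_ge_zero order_trans by blast
    have "(\<Sum>i<n. ?B ^ i / fact i * cmod (g w) + real i * ?B ^ (i - 1) / fact i * (F * cmod (\<alpha> w)))
      = (\<Sum>i<n. ?B ^ i / fact i) * cmod (g w) + (\<Sum>i<n. real i * ?B ^ (i - 1) / fact i) * (F * cmod (\<alpha> w))"
      by (simp add: sum.distrib sum_distrib_right)
    also have "\<dots> \<le> exp ?B * cmod (g w) + exp ?B * (F * cmod (\<alpha> w))"
      using F0 by (intro add_mono mult_right_mono e1 e2) auto
    finally show ?thesis using s1 by (simp add: algebra_simps)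
  qed
  let ?S = "\<lambda>n. LINT w|lborel. (\<Sum>i<n. s i * h i w) / (z - w)"
  have hm [measurable]: "h n \<in> borel_measurable borel" for n
    unfolding h_def[abs_def] by measurable
  have "?S \<longlonglongrightarrow> (LINT w|lborel. (g w - \<alpha> w * f w) * exp (- ?a w) / (z - w))"
  proof (rule integral_dominated_convergence[where w="\<lambda>w. exp ?B * (cmod (g w / (z - w)) + F * cmod (\<alpha> w / (z - w)))"])
    show "integrable lborel (\<lambda>w. exp ?B * (cmod (g w / (z - w)) + F * cmod (\<alpha> w / (z - w))))"
      by (intro integrable_mult_right Bochner_Integration.integrable_add integrable_norm admissible_integrable(1)[OF g] admissible_integrable(1)[OF a])
    show "AE w in lborel. (\<lambda>n. (\<Sum>i<n. s i * h i w) / (z - w)) \<longlonglongrightarrow> (g w - \<alpha> w * f w) * exp (- ?a w) / (z - w)"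
      using hser unfolding sums_def divide_inverse by (intro AE_I2 tendsto_mult tendsto_const)
    show "AE w in lborel. norm ((\<Sum>i<n. s i * h i w) / (z - w)) \<le> exp ?B * (cmod (g w / (z - w)) + F * cmod (\<alpha> w / (z - w)))" for n
    proof (rule AE_I2)
      fix w
      have "norm ((\<Sum>i<n. s i * h i w) / (z - w)) \<le> exp ?B * (cmod (g w) + F * cmod (\<alpha> w)) / cmod (z - w)"
        unfolding norm_divide by (intro divide_right_mono bnd) simp
      then show "norm ((\<Sum>i<n. s i * h i w) / (z - w)) \<le> exp ?B * (cmod (g w / (z - w)) + F * cmod (\<alpha> w / (z - w)))"
        by (simp add: norm_divide add_divide_distrib algebra_simps)
    qed
  qed measurable
  then have lim: "(\<lambda>n. ?S n / of_real bubble_mass) \<longlonglongrightarrow> cauchy (\<lambda>w. (g w - \<alpha> w * f w) * exp (- ?a w)) z"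
    unfolding cauchy_def divide_inverse by (intro tendsto_mult tendsto_const)
  have S: "?S n / of_real bubble_mass = (\<Sum>i<n. s i * cauchy (h i) z)" for n
  proof -
    have "?S n = (LINT w|lborel. (\<Sum>i<n. s i * (h i w / (z - w))))"
      by (simp add: sum_divide_distrib)
    also have "\<dots> = (\<Sum>i<n. s i * (LINT w|lborel. h i w / (z - w)))"
    proof (subst Bochner_Integration.integral_sum)
      fix i show "integrable lborel (\<lambda>w. s i * (h i w / (z - w)))"
        using adm[of i] admissible_integrable(1) by (intro integrable_mult_right) blast
    qed (simp only: integral_mult_right_zero)
    finally show ?thesis by (simp add: cauchy_def sum_divide_distrib)
  qed
  \<comment> \<open>Stopping at \<open>Suc n\<close> guarantees that the index 0 is present, which
    contributes k.\<close>
  have "(\<Sum>i<Suc n. s i * (?a z ^ i * f z)) = k + (\<Sum>i<Suc n. s i * cauchy (h i) z)" for n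
    unfolding eq by (simp add: distrib_left sum.distrib sum.lessThan_Suc_shift s_def del: sum.lessThan_Suc)
  moreover have "(\<lambda>n. \<Sum>i<Suc n. s i * (?a z ^ i * f z)) \<longlonglongrightarrow> exp (- ?a z) * f z"
    using sums_mult2[OF ser, of z "f z"] unfolding sums_def mult.assoc by (rule LIMSEQ_Suc)
  moreover have "(\<lambda>n. k + (\<Sum>i<Suc n. s i * cauchy (h i) z)) \<longlonglongrightarrow> k + cauchy (\<lambda>w. (g w - \<alpha> w * f w) * exp (- ?a w)) z"
    using lim unfolding S by (intro tendsto_add tendsto_const LIMSEQ_Suc)
  ultimately show ?thesis
    using LIMSEQ_unique by (simp add: mult.commute)
qed

section \<open>A regularized Cauchy kernel\<close>

lemma wirtinger_unique:
  assumes "(f has_derivative (\<lambda>v. A * v + B * cnj v)) (at z)"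
  shows "dz f z = A" "dzbar f z = B"
proof -
  have "frechet_derivative f (at z) = (\<lambda>v. A * v + B * cnj v)"
    using frechet_derivative_at[OF assms] by simp
  then show "dz f z = A" "dzbar f z = B"
    by (simp_all add: dz_def dzbar_def dx_def dy_def algebra_simps)
qed

lemma wirtinger_has_derivative:
  assumes "f differentiable (at z)"
  shows "(f has_derivative (\<lambda>v. dz f z * v + dzbar f z * cnj v)) (at z)"
proof -
  let ?D = "frechet_derivative f (at z)"
  have D: "(f has_derivative ?D) (at z)" using assms frechet_derivative_works by blast
  then have lin: "linear ?D" by (rule has_derivative_linear)
  have "?D v = dz f z * v + dzbar f z * cnj v" for v
  proof -
    have "v = Re v *\<^sub>R 1 + Im v *\<^sub>R \<i>" by (simp add: complex_eq_iff)
    then have "?D v = ?D (Re v *\<^sub>R 1 + Im v *\<^sub>R \<i>)" by simp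
    also have "\<dots> = Re v *\<^sub>R dx f z + Im v *\<^sub>R dy f z"
      by (simp add: linear_add[OF lin] linear_scale[OF lin] dx_def dy_def)
    also have "\<dots> = dz f z * v + dzbar f z * cnj v"
      by (simp add: dz_def dzbar_def complex_eq_iff field_simps)
    finally show ?thesis .
  qed
  then have "?D = (\<lambda>v. dz f z * v + dzbar f z * cnj v)" by auto
  then show ?thesis using D by simp
qed

lemma wirtinger_mult:
  assumes "f differentiable (at z)" "g differentiable (at z)"
  shows "dz (\<lambda>w. f w * g w) z = dz f z * g z + f z * dz g z"
    "dzbar (\<lambda>w. f w * g w) z = dzbar f z * g z + f z * dzbar g z"
proof -
  have "((\<lambda>w. f w * g w) has_derivative (\<lambda>v. (dz f z * g z + f z * dz g z) * v + (dzbar f z * g z + f z * dzbar g z) * cnj v)) (at z)"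
    using has_derivative_mult[OF wirtinger_has_derivative[OF assms(1)] wirtinger_has_derivative[OF assms(2)]]
    by (rule has_derivative_eq_rhs) (simp add: fun_eq_iff algebra_simps)
  from wirtinger_unique[OF this] show "dz (\<lambda>w. f w * g w) z = dz f z * g z + f z * dz g z"
    "dzbar (\<lambda>w. f w * g w) z = dzbar f z * g z + f z * dzbar g z" .
qed

text \<open>The smooth kernel \<open>kern d\<close> approximates \<open>1 / (z - w)\<close>, and its \<open>\<partial>\<close>-bar derivative in \<open>w\<close> is
  \<open>- rho d (z - w)\<close>, an approximate multiple of the Dirac measure at \<open>z\<close>.\<close>

definition kern :: "real \<Rightarrow> complex \<Rightarrow> complex \<Rightarrow> complex" where
  "kern d z w = cnj (z - w) / of_real ((cmod (z - w))\<^sup>2 + d\<^sup>2)"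

definition rho :: "real \<Rightarrow> complex \<Rightarrow> real" where
  "rho d x = d\<^sup>2 / ((cmod x)\<^sup>2 + d\<^sup>2)\<^sup>2"

text \<open>The factor exp 1 normalises the value at the centre to 1. Since the argument is a
  function of |w|^2, the \<partial>-bar derivative carries a factor w, which later meets the decay
  of \<open>kern\<close>.\<close>

definition cutoff :: "nat \<Rightarrow> complex \<Rightarrow> complex" where
  "cutoff n w = of_real (exp 1 * flat 0 (1 - (cmod w)\<^sup>2 / (real (Suc n))\<^sup>2))"

lemma of_real_norm_square: "(of_real (cmod z))\<^sup>2 = z * cnj z"
  using complex_norm_square[of z] by simp

lemma rho_nonneg: "0 \<le> rho d x" by (simp add: rho_def)

lemma rho_measurable [measurable]: "rho d \<in> borel_measurable borel"
  unfolding rho_def[abs_def] by measurable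

lemma kern_measurable [measurable]: "kern d z \<in> borel_measurable borel"
  "(\<lambda>(z, w). kern d z w) \<in> borel_measurable (borel \<Otimes>\<^sub>M borel)"
proof -
  have [measurable]: "cnj \<in> borel_measurable borel"
    by (intro borel_measurable_continuous_onI continuous_intros)
  show "kern d z \<in> borel_measurable borel"
    "(\<lambda>(z, w). kern d z w) \<in> borel_measurable (borel \<Otimes>\<^sub>M borel)"
  unfolding kern_def[abs_def] by measurable
qed

lemma kern_den_pos: "d > 0 \<Longrightarrow> 0 < (cmod x)\<^sup>2 + d\<^sup>2"
  by (simp add: add_nonneg_pos)

lemma kern_eq:
  assumes "d > 0"
  shows "kern d z w = cnj (z - w) * inverse ((z - w) * cnj (z - w) + of_real (d\<^sup>2))"
  by (simp add: kern_def divide_inverse of_real_norm_square del: complex_cnj_diff)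

lemma kern_den_ne_0:
  assumes "d > 0"
  shows "(z - w) * cnj (z - w) + of_real (d\<^sup>2) \<noteq> 0"
proof -
  have "(z - w) * cnj (z - w) + of_real (d\<^sup>2) = of_real ((cmod (z - w))\<^sup>2 + d\<^sup>2)"
    by (simp add: of_real_norm_square del: complex_cnj_diff)
  then show ?thesis using kern_den_pos[OF assms, of "z - w"] by (simp only: of_real_eq_0_iff)
qed

lemma kern_elem: 
  assumes "d > 0" shows "elem_smooth (kern d z)"
proof -
  have "elem_smooth (\<lambda>w. cnj (z - w) * inverse ((z - w) * cnj (z - w) + of_real (d\<^sup>2)))"
    using kern_den_ne_0[OF assms] by (intro elem_smooth_intros) auto
  moreover have "kern d z = (\<lambda>w. cnj (z - w) * inverse ((z - w) * cnj (z - w) + of_real (d\<^sup>2)))"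
    using kern_eq[OF assms] by auto
  ultimately show ?thesis by simp
qed

lemma dzbar_kern:
  assumes "d > 0"
  shows "dzbar (kern d z) w = - of_real (rho d (z - w))"
proof -
  let ?D = "(z - w) * cnj (z - w) + of_real (d\<^sup>2)"
  have D0: "?D \<noteq> 0" by (rule kern_den_ne_0[OF assms])
  have alg: "b * (inverse D * a * inverse D) - inverse D = (a * b - D) / D\<^sup>2" if "D \<noteq> 0" for a b D :: complex
    using that by (simp add: divide_simps power2_eq_square)
  have c: "((\<lambda>w. cnj (z - w)) has_derivative (\<lambda>v. - cnj v)) (at w)"
    by (auto intro!: derivative_eq_intros bounded_linear.has_derivative[OF bounded_linear_cnj])
  have "((\<lambda>w. (z - w) * cnj (z - w) + of_real (d\<^sup>2)) has_derivative (\<lambda>v. (z - w) * (- cnj v) + (- v) * cnj (z - w))) (at w)"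
    by (rule derivative_eq_intros c refl)+ (simp add: fun_eq_iff)
  from has_derivative_mult[OF c Deriv.has_derivative_inverse[OF D0 this]]
  have "((\<lambda>w. cnj (z - w) * inverse ((z - w) * cnj (z - w) + of_real (d\<^sup>2))) has_derivative
     (\<lambda>v. (inverse ?D * cnj (z - w) * inverse ?D * cnj (z - w)) * v + (cnj (z - w) * (inverse ?D * (z - w) * inverse ?D) - inverse ?D) * cnj v)) (at w)"
    by (rule has_derivative_eq_rhs) (simp add: fun_eq_iff algebra_simps del: complex_cnj_diff)
  moreover have "kern d z = (\<lambda>w. cnj (z - w) * inverse ((z - w) * cnj (z - w) + of_real (d\<^sup>2)))"
    using kern_eq[OF assms] by auto
  ultimately have "(kern d z has_derivative
     (\<lambda>v. (inverse ?D * cnj (z - w) * inverse ?D * cnj (z - w)) * v + (cnj (z - w) * (inverse ?D * (z - w) * inverse ?D) - inverse ?D) * cnj v)) (at w)"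
    by (simp only:)
  then have "dzbar (kern d z) w = cnj (z - w) * (inverse ?D * (z - w) * inverse ?D) - inverse ?D"
    by (rule wirtinger_unique(2))
  also have "\<dots> = ((z - w) * cnj (z - w) - ?D) / ?D\<^sup>2"
    by (rule alg[OF D0])
  also have "\<dots> = - of_real (rho d (z - w))"
    by (simp add: rho_def of_real_norm_square del: complex_cnj_diff)
  finally show ?thesis .
qed

lemma norm_kern: "cmod (kern d z w) = cmod (z - w) / ((cmod (z - w))\<^sup>2 + d\<^sup>2)"
  unfolding kern_def norm_divide complex_mod_cnj norm_of_real by (simp add: add_nonneg_nonneg del: complex_cnj_diff)

lemma norm_kern_le: "cmod (kern d z w) \<le> 1 / cmod (z - w)"
proof (cases "z = w")
  case False
  have "cmod (z - w) * cmod (z - w) \<le> (cmod (z - w))\<^sup>2 + d\<^sup>2" by (simp add: power2_eq_square)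
  moreover have "0 < (cmod (z - w))\<^sup>2 + d\<^sup>2" using False by (simp add: add_pos_nonneg)
  ultimately show ?thesis using False by (simp add: norm_kern divide_simps)
qed (simp add: norm_kern)

lemma norm_kern_le':
  assumes "d > 0" shows "cmod (kern d z w) \<le> 1 / d"
proof -
  let ?t = "cmod (z - w)"
  have "0 \<le> (?t - d)\<^sup>2" by simp
  then have "?t * d \<le> ?t\<^sup>2 + d\<^sup>2" using mult_nonneg_nonneg[of ?t d] assms unfolding power2_diff by (auto simp del: mult_nonneg_nonneg)
  then show ?thesis using kern_den_pos[OF assms, of "z - w"] assms by (simp add: norm_kern divide_simps)
qed

lemma kern_tendsto:
  assumes "h \<longlonglongrightarrow> 0"
  shows "(\<lambda>n. kern (h n) z w) \<longlonglongrightarrow> 1 / (z - w)"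
proof (cases "z = w")
  case False
  have "(\<lambda>n. kern (h n) z w) \<longlonglongrightarrow> cnj (z - w) / of_real ((cmod (z - w))\<^sup>2 + 0\<^sup>2)"
    unfolding kern_def by (intro tendsto_intros assms) (use False in simp)
  also have "cnj (z - w) / of_real ((cmod (z - w))\<^sup>2 + 0\<^sup>2) = 1 / (z - w)"
    using False by (simp add: of_real_norm_square del: complex_cnj_diff)
  finally show ?thesis .
qed (simp add: kern_def)

lemma cutoff_elem: "elem_smooth (cutoff n)"
proof -
  have "elem_smooth (\<lambda>w. of_real (exp 1) * of_real (flat 0 (Re (1 + of_real (- (1 / (real (Suc n))\<^sup>2)) * (w * cnj w)))))"
    by (intro elem_smooth_intros)
  moreover have "(\<lambda>w. of_real (exp 1) * of_real (flat 0 (Re (1 + of_real (- (1 / (real (Suc n))\<^sup>2)) * (w * cnj w))))) = cutoff n"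
    unfolding cutoff_def[abs_def] complex_norm_square[symmetric] by (simp add: fun_eq_iff flip: of_real_mult of_real_add of_real_power)
  ultimately show ?thesis by simp
qed

lemma dzbar_cutoff:
  "dzbar (cutoff n) w = - of_real (exp 1 * flat 2 (1 - (cmod w)\<^sup>2 / (real (Suc n))\<^sup>2) / (real (Suc n))\<^sup>2) * w"
proof -
  let ?N = "(real (Suc n))\<^sup>2" and ?s = "\<lambda>w. 1 - (cmod w)\<^sup>2 / (real (Suc n))\<^sup>2"
  have s: "(?s has_derivative (\<lambda>v. - (2 * (w \<bullet> v)) / ?N)) (at w)"
    unfolding power2_norm_eq_inner
    unfolding divide_inverse
    by (auto intro!: derivative_eq_intros simp: fun_eq_iff inner_commute simp del: of_nat_Suc)
  have "(flat 0 has_derivative (\<lambda>h. h * flat 2 (?s w))) (at (?s w))"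
    using flat_has_field_derivative[of 0 "?s w"] by (simp add: has_field_derivative_def mult_commute_abs numeral_2_eq_2 del: of_nat_Suc)
  from diff_chain_at[OF s this]
  have "((\<lambda>w. flat 0 (?s w)) has_derivative (\<lambda>v. (- (2 * (w \<bullet> v)) / ?N) * flat 2 (?s w))) (at w)"
    by (simp add: o_def del: of_nat_Suc)
  then have "((\<lambda>w. exp 1 * flat 0 (?s w)) has_derivative (\<lambda>v. exp 1 * ((- (2 * (w \<bullet> v)) / ?N) * flat 2 (?s w)))) (at w)"
    by (rule has_derivative_mult_right)
  from bounded_linear.has_derivative[OF bounded_linear_of_real this]
  have "(cutoff n has_derivative (\<lambda>v. of_real (exp 1 * ((- (2 * (w \<bullet> v)) / ?N) * flat 2 (?s w))))) (at w)"
    unfolding cutoff_def[abs_def] .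
  moreover have "of_real (exp 1 * ((- (2 * (w \<bullet> v)) / ?N) * flat 2 (?s w))) =
     (- of_real (exp 1 * flat 2 (?s w) / ?N) * cnj w) * v + (- of_real (exp 1 * flat 2 (?s w) / ?N) * w) * cnj v" for v :: complex
  proof -
    define c where "c = complex_of_real (exp 1 * flat 2 (?s w) / ?N)"
    have "of_real (2 * (w \<bullet> v)) = w * cnj v + cnj w * v"
      by (simp add: inner_complex_def complex_eq_iff)
    moreover have "of_real (exp 1 * ((- (2 * (w \<bullet> v)) / ?N) * flat 2 (?s w))) = - (c * complex_of_real (2 * (w \<bullet> v)))"
      unfolding c_def of_real_mult[symmetric] of_real_minus[symmetric] by (simp del: of_nat_Suc)
    ultimately show ?thesis unfolding c_def[symmetric] by (simp add: algebra_simps del: of_real_mult)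
  qed
  ultimately show ?thesis using wirtinger_unique(2) by (simp only:)
qed

lemma cutoff_eq_0:
  assumes "real (Suc n) \<le> cmod w" shows "flat m (1 - (cmod w)\<^sup>2 / (real (Suc n))\<^sup>2) = 0"
proof -
  have "(real (Suc n))\<^sup>2 \<le> (cmod w)\<^sup>2" using assms by (intro power_mono) auto
  then have "1 \<le> (cmod w)\<^sup>2 / (real (Suc n))\<^sup>2" by (simp add: le_divide_eq del: of_nat_Suc)
  then have "\<not> 0 < 1 - (cmod w)\<^sup>2 / (real (Suc n))\<^sup>2" by linarith
  then show ?thesis unfolding flat_def by (simp only: if_False)
qed

text \<open>The scale of the denominator is that of the area of the ball. As |w|
  |\<open>kern d z w\<close>| is bounded in w, the error caused by the cutoff becomes a mean of |f|
  over growing balls. The constant 2 is \<open>fact 2\<close>, the bound for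
  \<open>flat 2\<close>.\<close>

lemma norm_dzbar_cutoff_le:
  "cmod (dzbar (cutoff n) w) \<le> indicator (ball 0 (real (Suc n))) w * (2 * exp 1 * cmod w / (real (Suc n))\<^sup>2)"
proof (cases "cmod w < real (Suc n)")
  case True
  have "flat 2 (1 - (cmod w)\<^sup>2 / (real (Suc n))\<^sup>2) \<le> 2" using flat_le[of 2 _ 0] by (simp add: eval_nat_numeral)
  then have "exp 1 * flat 2 (1 - (cmod w)\<^sup>2 / (real (Suc n))\<^sup>2) / (real (Suc n))\<^sup>2 * cmod w \<le> exp 1 * 2 / (real (Suc n))\<^sup>2 * cmod w"
    by (intro mult_right_mono divide_right_mono mult_left_mono) auto
  then show ?thesis using True
    unfolding dzbar_cutoff norm_mult norm_minus_cancel norm_of_real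
    by (simp add: flat_nonneg abs_mult del: of_nat_Suc) (simp add: mult_ac del: of_nat_Suc)
next
  case False
  then show ?thesis unfolding dzbar_cutoff using cutoff_eq_0[of n w 2] by simp
qed

lemma cutoff_nonneg_le_1: "cmod (cutoff n w) \<le> 1"
proof -
  let ?s = "1 - (cmod w)\<^sup>2 / (real (Suc n))\<^sup>2"
  have "exp 1 * flat 0 ?s \<le> 1"
  proof (cases "?s > 0")
    case True
    have "?s \<le> 1" by simp
    then have "1 \<le> 1 / ?s" using True by (simp add: le_divide_eq del: of_nat_Suc)
    then have "exp 1 * exp (- (1 / ?s)) \<le> exp 0" unfolding exp_add[symmetric] by (subst exp_le_cancel_iff) simp
    then show ?thesis using True by (simp add: flat_def del: of_nat_Suc)
  qed (simp add: flat_def del: of_nat_Suc)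
  then show ?thesis unfolding cutoff_def norm_of_real by (simp add: flat_nonneg del: of_nat_Suc)
qed

lemma cutoff_tendsto: "(\<lambda>n. cutoff n w) \<longlonglongrightarrow> 1"
proof -
  have s: "(\<lambda>n. 1 - (cmod w)\<^sup>2 / (real (Suc n))\<^sup>2) \<longlonglongrightarrow> 1 - (cmod w)\<^sup>2 * 0\<^sup>2"
    unfolding divide_inverse power_inverse[symmetric]
    by (intro tendsto_intros LIMSEQ_inverse_real_of_nat)
  have "isCont (flat 0) 1" using flat_has_field_derivative DERIV_isCont by blast
  from isCont_tendsto_compose[OF this] s have "(\<lambda>n. flat 0 (1 - (cmod w)\<^sup>2 / (real (Suc n))\<^sup>2)) \<longlonglongrightarrow> flat 0 1"
    by (simp del: of_nat_Suc)
  then have "(\<lambda>n. cutoff n w) \<longlonglongrightarrow> of_real (exp 1 * flat 0 1)"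
    unfolding cutoff_def by (intro tendsto_intros)
  moreover have "exp 1 * flat 0 1 = (1::real)" by (simp add: flat_def exp_minus)
  ultimately show ?thesis by simp
qed

lemma test_function_cutoff_mult:
  assumes "elem_smooth k" shows "test_function UNIV (\<lambda>w. cutoff n w * k w)"
proof -
  have "closure {z. cutoff n z * k z \<noteq> 0} \<subseteq> cball 0 (real (Suc n))"
  proof (rule closure_minimal[OF _ closed_cball], rule subsetI)
    fix z assume "z \<in> {z. cutoff n z * k z \<noteq> 0}"
    then have "\<not> real (Suc n) \<le> cmod z" using cutoff_eq_0[of n z 0] by (auto simp: cutoff_def simp del: of_nat_Suc)
    then show "z \<in> cball 0 (real (Suc n))" by (simp del: of_nat_Suc)
  qed
  moreover from this have "compact (closure {z. cutoff n z * k z \<noteq> 0})"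
    by (meson bounded_subset bounded_cball closed_closure compact_eq_bounded_closed)
  ultimately show ?thesis
    using smooth_elem[OF elem_smooth.mult[OF cutoff_elem assms]] by (auto simp: test_function_def)
qed

lemma rho_scale: "d > 0 \<Longrightarrow> d\<^sup>2 * rho d (d *\<^sub>R x) = 1 / (1 + (cmod x)\<^sup>2)\<^sup>2"
proof -
  assume d: "d > 0"
  have "(d\<^sup>2 * (cmod x)\<^sup>2 + d\<^sup>2)\<^sup>2 = d\<^sup>2 * d\<^sup>2 * (1 + (cmod x)\<^sup>2)\<^sup>2" by algebra
  then show ?thesis using d by (simp add: rho_def power_mult_distrib)
qed

lemma integrable_rho:
  assumes d: "d > 0" shows "integrable lborel (\<lambda>w. rho d (z - w))"
proof -
  have "(\<lambda>w. rho d (z - w)) = (\<lambda>w. 1 / d\<^sup>2 * (1 / (1 + (cmod (z /\<^sub>R d + (- (1 / d)) *\<^sub>R w))\<^sup>2)\<^sup>2))"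
  proof
    fix w
    have "z - w = d *\<^sub>R (z /\<^sub>R d + (- (1 / d)) *\<^sub>R w)" using d by (simp add: scaleR_add_right scaleR_diff_right)
    then show "rho d (z - w) = 1 / d\<^sup>2 * (1 / (1 + (cmod (z /\<^sub>R d + (- (1 / d)) *\<^sub>R w))\<^sup>2)\<^sup>2)"
      unfolding rho_scale[OF d, symmetric] using d by simp
  qed
  moreover have "integrable lborel (\<lambda>w. 1 / d\<^sup>2 * (1 / (1 + (cmod (z /\<^sub>R d + (- (1 / d)) *\<^sub>R w))\<^sup>2)\<^sup>2))"
    by (intro integrable_mult_right lborel_integrable_affine[OF integrable_decay]) (use d in simp)
  ultimately show ?thesis by simp
qed

lemma rho_le: "d > 0 \<Longrightarrow> rho d x \<le> 1 / d\<^sup>2"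
proof -
  assume d: "d > 0"
  have "(d\<^sup>2)\<^sup>2 \<le> ((cmod x)\<^sup>2 + d\<^sup>2)\<^sup>2" by (intro power_mono) auto
  then have "d\<^sup>2 * d\<^sup>2 \<le> ((cmod x)\<^sup>2 + d\<^sup>2)\<^sup>2" by (simp add: power2_eq_square)
  then show ?thesis using d kern_den_pos[OF d, of x] by (simp add: rho_def divide_simps)
qed

text \<open>This replaces Hoelder's inequality: values up to \<epsilon> are absorbed by the
  constant, larger ones by the q-th power.\<close>

lemma le_eps_add_powr:
  fixes x \<epsilon> q :: real
  assumes "0 \<le> x" "0 < \<epsilon>" "1 < q"
  shows "x \<le> \<epsilon> + \<epsilon> powr (1 - q) * x powr q"
proof (cases "x \<le> \<epsilon>")
  case False
  then have "x powr (1 - q) \<le> \<epsilon> powr (1 - q)" using assms by (intro powr_mono2') auto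
  then have "x powr (1 - q) * x powr q \<le> \<epsilon> powr (1 - q) * x powr q" by (intro mult_right_mono) auto
  moreover have "x powr (1 - q) * x powr q = x" using False assms by (simp add: powr_add[symmetric])
  ultimately show ?thesis using assms by linarith
qed (use assms in \<open>simp add: add_increasing2\<close>)

section \<open>Representation by the Cauchy transform\<close>

lemma cutoff_measurable [measurable]:
  "cutoff n \<in> borel_measurable borel" "dzbar (cutoff n) \<in> borel_measurable borel"
proof -
  show "cutoff n \<in> borel_measurable borel"
    by (intro borel_measurable_continuous_onI continuous_at_imp_continuous_on ballI
        differentiable_imp_continuous_within elem_smooth_differentiable cutoff_elem)
  have [measurable]: "flat 2 \<in> borel_measurable borel" unfolding flat_def[abs_def] by measurable
  have "dzbar (cutoff n) = (\<lambda>w. - of_real (exp 1 * flat 2 (1 - (cmod w)\<^sup>2 / (real (Suc n))\<^sup>2) / (real (Suc n))\<^sup>2) * w)"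
    using dzbar_cutoff by auto
  then show "dzbar (cutoff n) \<in> borel_measurable borel" by (simp del: of_nat_Suc of_real_mult of_real_divide)
qed

text \<open>In |f| \<le> 1 + |f|^q the constant is paid for by integrability of the weight and the
  power by its boundedness.\<close>

lemma Lq_locally_integrable:
  fixes f :: "complex \<Rightarrow> complex"
  assumes [measurable]: "f \<in> borel_measurable borel" and int: "integrable lborel (\<lambda>z. cmod (f z) powr q)" and q: "1 < q"
    and b: "integrable lborel b" "\<And>z. \<bar>b z\<bar> \<le> B"
  shows "integrable lborel (\<lambda>z. f z * of_real (b z))"
proof (rule Bochner_Integration.integrable_bound)
  have [measurable]: "b \<in> borel_measurable borel" using borel_measurable_integrable[OF b(1)] by simp
  show "(\<lambda>z. f z * of_real (b z)) \<in> borel_measurable lborel" by simp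
  show "integrable lborel (\<lambda>z. \<bar>b z\<bar> + B * cmod (f z) powr q)"
    using b(1) int by (intro Bochner_Integration.integrable_add integrable_mult_right integrable_abs)
  show "AE z in lborel. norm (f z * of_real (b z)) \<le> norm (\<bar>b z\<bar> + B * cmod (f z) powr q)"
  proof (rule AE_I2)
    fix z
    have B: "0 \<le> B" using b(2)[of 0] by linarith
    have "cmod (f z) * \<bar>b z\<bar> \<le> (1 + cmod (f z) powr q) * \<bar>b z\<bar>"
      using le_eps_add_powr[of "cmod (f z)" 1 q] q by (intro mult_right_mono) auto
    also have "\<dots> \<le> \<bar>b z\<bar> + B * cmod (f z) powr q"
      using mult_right_mono[OF b(2)[of z], of "cmod (f z) powr q"] by (simp add: algebra_simps)
    finally show "norm (f z * of_real (b z)) \<le> norm (\<bar>b z\<bar> + B * cmod (f z) powr q)"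
      using B by (simp add: norm_mult)
  qed
qed

text \<open>The bounded part contributes \<epsilon> times the area and the rest at most a fixed J,
  so only \<epsilon> pi survives the division. Nonzero constants fail this, which is why L^q
  functions are represented without an additive constant.\<close>

lemma Lq_ball_average_tendsto_0:
  fixes f :: "complex \<Rightarrow> complex"
  assumes f[measurable]: "f \<in> borel_measurable borel" and int: "integrable lborel (\<lambda>z. cmod (f z) powr q)" and q: "1 < q"
  shows "(\<lambda>n. (LINT z|lborel. indicator (ball 0 (real (Suc n))) z * cmod (f z)) / (real (Suc n))\<^sup>2) \<longlonglongrightarrow> 0"
proof (rule LIMSEQ_I)
  fix r :: real assume r: "0 < r"
  \<comment> \<open>Half of r goes to the bounded part; the choice of \<open>n0\<close> leaves the
    other half for \<open>J\<close>.\<close>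
  define \<epsilon> where "\<epsilon> = r / (2 * pi)"
  have e0: "0 < \<epsilon>" using r by (simp add: \<epsilon>_def)
  define J where "J = \<epsilon> powr (1 - q) * (LINT z|lborel. cmod (f z) powr q)"
  have J0: "0 \<le> J" unfolding J_def by (intro mult_nonneg_nonneg Bochner_Integration.integral_nonneg) auto
  have bd: "(LINT z|lborel. indicator (ball 0 N) z * cmod (f z)) \<le> \<epsilon> * (pi * N\<^sup>2) + J" if N: "0 \<le> N" for N :: real
  proof -
    have ib: "integrable lborel (\<lambda>z::complex. indicator (ball 0 N) z :: real)"
      by (rule integrable_indicator_ball)
    have i2: "integrable lborel (\<lambda>z. \<epsilon> * indicator (ball 0 N) z + \<epsilon> powr (1 - q) * cmod (f z) powr q)"
      using int ib by (intro Bochner_Integration.integrable_add integrable_mult_right)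
    have le: "indicator (ball 0 N) z * cmod (f z) \<le> \<epsilon> * indicator (ball 0 N) z + \<epsilon> powr (1 - q) * cmod (f z) powr q" for z
      using le_eps_add_powr[of "cmod (f z)" \<epsilon> q] q e0 by (auto simp: indicator_def)
    have "(LINT z|lborel. indicator (ball 0 N) z * cmod (f z)) \<le> (LINT z|lborel. \<epsilon> * indicator (ball 0 N) z + \<epsilon> powr (1 - q) * cmod (f z) powr q)"
    proof (rule integral_mono[OF _ i2 le])
      show "integrable lborel (\<lambda>z. indicator (ball 0 N) z * cmod (f z))"
        by (rule Bochner_Integration.integrable_bound[OF i2]) (use le e0 in \<open>auto intro!: AE_I2 simp: abs_mult abs_of_nonneg\<close>)
    qed
    also have "\<dots> = \<epsilon> * measure lborel (ball (0::complex) N) + J"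
      unfolding J_def using int ib by (subst Bochner_Integration.integral_add) auto
    also have "measure lborel (ball (0::complex) N) = pi * N\<^sup>2"
      using N by (simp add: measure_def emeasure_ball_complex)
    finally show ?thesis .
  qed
  obtain n0 where n0: "2 * J / r < real n0" using reals_Archimedean2 by blast
  show "\<exists>no. \<forall>n\<ge>no. norm ((LINT z|lborel. indicator (ball 0 (real (Suc n))) z * cmod (f z)) / (real (Suc n))\<^sup>2 - 0) < r"
  proof (intro exI allI impI)
    fix n assume n: "n0 \<le> n"
    define N where "N = real (Suc n)"
    have N: "1 \<le> N" "real n0 < N" using n by (auto simp: N_def)
    have "2 * J / r < N" using n0 N by linarith
    then have "J < r / 2 * N" using r by (simp add: divide_less_eq algebra_simps)
    also have "\<dots> \<le> r / 2 * N\<^sup>2" using N r by (intro mult_left_mono) (auto simp: power2_eq_square)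
    finally have "J < r / 2 * N\<^sup>2" .
    moreover have "\<epsilon> * (pi * N\<^sup>2) = r / 2 * N\<^sup>2" by (simp add: \<epsilon>_def)
    ultimately have "(LINT z|lborel. indicator (ball 0 N) z * cmod (f z)) < r * N\<^sup>2"
      using bd[of N] N by linarith
    moreover have "0 \<le> (LINT z|lborel. indicator (ball 0 N) z * cmod (f z))"
      by (rule Bochner_Integration.integral_nonneg) auto
    ultimately show "norm ((LINT z|lborel. indicator (ball 0 (real (Suc n))) z * cmod (f z)) / (real (Suc n))\<^sup>2 - 0) < r"
      using N unfolding N_def[symmetric] by (simp add: divide_less_eq)
  qed
qed

text \<open>The test function is \<open>cutoff n\<close> times \<open>kern d z\<close>. Its
  \<partial>-bar derivative splits into a term with the derivative of the cutoff, whose integral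
  tends to 0 by the decay of ball averages, and the smoothed Dirac measure.\<close>

lemma weak_dzbar_mollified:
  fixes f g :: "complex \<Rightarrow> complex"
  assumes f[measurable]: "f \<in> borel_measurable borel" and int: "integrable lborel (\<lambda>z. cmod (f z) powr q)" and q: "1 < q"
    and g: "admissible g N"
    and weak: "\<And>\<phi>. test_function UNIV \<phi> \<Longrightarrow> (LINT z|lborel. f z * dzbar \<phi> z) = - (LINT z|lborel. g z * \<phi> z)"
    and d: "d > 0"
  shows "(LINT w|lborel. f w * of_real (rho d (z - w))) = (LINT w|lborel. g w * kern d z w)"
proof -
  have gm[measurable]: "g \<in> borel_measurable borel" using g by (rule admissible_measurable)
  let ?k = "kern d z" and ?r = "\<lambda>w. complex_of_real (rho d (z - w))"
  define C where "C = 1 + cmod z / d"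
  have C0: "0 \<le> C" using d by (simp add: C_def)
  \<comment> \<open>Split |w| \<le> |z| + |z - w|: the first part uses the bound 1/d for the kernel,
    the second the bound 1/|z - w|.\<close>
  have wk: "cmod w * cmod (?k w) \<le> C" for w
  proof -
    have "cmod w \<le> cmod z + cmod (z - w)" using norm_triangle_ineq4[of z "z - w"] by simp
    then have "cmod w * cmod (?k w) \<le> (cmod z + cmod (z - w)) * cmod (?k w)" by (intro mult_right_mono) auto
    also have "\<dots> = cmod z * cmod (?k w) + cmod (z - w) * cmod (?k w)" by (simp add: algebra_simps)
    also have "cmod z * cmod (?k w) \<le> cmod z * (1 / d)" by (intro mult_left_mono norm_kern_le' d) simp
    also have "cmod (z - w) * cmod (?k w) \<le> cmod (z - w) * (1 / cmod (z - w))" by (intro mult_left_mono norm_kern_le) simp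
    also have "\<dots> \<le> 1" by simp
    finally show ?thesis by (simp add: C_def)
  qed
  have fr: "integrable lborel (\<lambda>w. f w * ?r w)"
    by (rule Lq_locally_integrable[OF f int q integrable_rho[OF d]]) (use rho_le[OF d] rho_nonneg in \<open>auto simp: abs_of_nonneg\<close>)
  have fb: "integrable lborel (\<lambda>w. indicator (ball 0 (real (Suc n))) w * cmod (f w))" for n
  proof -
    from Lq_locally_integrable[OF f int q integrable_indicator_ball[of 0 "real (Suc n)"], of 1]
    have "integrable lborel (\<lambda>w. f w * of_real (indicator (ball 0 (real (Suc n))) w))" by (simp add: indicator_def del: of_nat_Suc)
    then have "integrable lborel (\<lambda>w. cmod (f w * of_real (indicator (ball 0 (real (Suc n))) w)))" by (rule integrable_norm)
    moreover have "(\<lambda>w. cmod (f w * of_real (indicator (ball 0 (real (Suc n))) w))) = (\<lambda>w. indicator (ball 0 (real (Suc n))) w * cmod (f w))"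
      by (auto simp: fun_eq_iff indicator_def)
    ultimately show ?thesis by (simp only:)
  qed
  have bd: "cmod (f w * (dzbar (cutoff n) w * ?k w)) \<le> 2 * exp 1 * C / (real (Suc n))\<^sup>2 * (indicator (ball 0 (real (Suc n))) w * cmod (f w))" for n w
  proof -
    have "cmod (f w * (dzbar (cutoff n) w * ?k w)) \<le> cmod (f w) * (indicator (ball 0 (real (Suc n))) w * (2 * exp 1 * cmod w / (real (Suc n))\<^sup>2) * cmod (?k w))"
      unfolding norm_mult by (intro mult_left_mono mult_right_mono norm_dzbar_cutoff_le) auto
    also have "\<dots> = cmod (f w) * (indicator (ball 0 (real (Suc n))) w * (2 * exp 1 / (real (Suc n))\<^sup>2)) * (cmod w * cmod (?k w))"
      by (simp add: field_simps del: of_nat_Suc)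
    also have "\<dots> \<le> cmod (f w) * (indicator (ball 0 (real (Suc n))) w * (2 * exp 1 / (real (Suc n))\<^sup>2)) * C"
      by (intro mult_left_mono wk) auto
    finally show ?thesis by (simp add: mult_ac del: of_nat_Suc)
  qed
  have i1: "integrable lborel (\<lambda>w. f w * (dzbar (cutoff n) w * ?k w))" for n
    by (rule Bochner_Integration.integrable_bound[OF integrable_mult_right[OF fb[of n], of "2 * exp 1 * C / (real (Suc n))\<^sup>2"]])
      (use bd[of _ n] C0 in \<open>auto simp: abs_mult abs_of_nonneg simp del: of_nat_Suc\<close>)
  have l1: "(\<lambda>n. LINT w|lborel. f w * (dzbar (cutoff n) w * ?k w)) \<longlonglongrightarrow> 0"
  proof (rule Lim_null_comparison)
    show "\<forall>\<^sub>F n in sequentially. norm (LINT w|lborel. f w * (dzbar (cutoff n) w * ?k w))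
      \<le> 2 * exp 1 * C * ((LINT w|lborel. indicator (ball 0 (real (Suc n))) w * cmod (f w)) / (real (Suc n))\<^sup>2)"
    proof (rule always_eventually, rule allI)
      fix n
      have "norm (LINT w|lborel. f w * (dzbar (cutoff n) w * ?k w)) \<le> (LINT w|lborel. norm (f w * (dzbar (cutoff n) w * ?k w)))"
        by (rule integral_norm_bound)
      also have "\<dots> \<le> (LINT w|lborel. 2 * exp 1 * C / (real (Suc n))\<^sup>2 * (indicator (ball 0 (real (Suc n))) w * cmod (f w)))"
        by (intro integral_mono integrable_norm i1 bd integrable_mult_right fb)
      also have "\<dots> = 2 * exp 1 * C / (real (Suc n))\<^sup>2 * (LINT w|lborel. indicator (ball 0 (real (Suc n))) w * cmod (f w))"
        by (rule integral_mult_right_zero)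
      finally show "norm (LINT w|lborel. f w * (dzbar (cutoff n) w * ?k w))
        \<le> 2 * exp 1 * C * ((LINT w|lborel. indicator (ball 0 (real (Suc n))) w * cmod (f w)) / (real (Suc n))\<^sup>2)"
        by (simp add: field_simps del: of_nat_Suc)
    qed
    show "(\<lambda>n. 2 * exp 1 * C * ((LINT w|lborel. indicator (ball 0 (real (Suc n))) w * cmod (f w)) / (real (Suc n))\<^sup>2)) \<longlonglongrightarrow> 0"
      using tendsto_mult[OF tendsto_const Lq_ball_average_tendsto_0[OF f int q], of "2 * exp 1 * C"] by simp
  qed
  have cut_le: "cmod (f w * ?r w * cutoff n w) \<le> cmod (f w * ?r w)" for n w
    using mult_left_mono[OF cutoff_nonneg_le_1[of n w], of "cmod (f w * ?r w)"] by (simp add: norm_mult)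
  have i2: "integrable lborel (\<lambda>w. f w * ?r w * cutoff n w)" for n
    by (rule Bochner_Integration.integrable_bound[OF fr]) (use cut_le[of _ n] in auto)
  have l2: "(\<lambda>n. LINT w|lborel. f w * ?r w * cutoff n w) \<longlonglongrightarrow> (LINT w|lborel. f w * ?r w)"
  proof (rule integral_dominated_convergence[OF _ _ integrable_norm[OF fr]])
    show "AE w in lborel. (\<lambda>n. f w * ?r w * cutoff n w) \<longlonglongrightarrow> f w * ?r w"
      using tendsto_mult[OF tendsto_const cutoff_tendsto] by (auto intro!: AE_I2)
    show "AE w in lborel. norm (f w * ?r w * cutoff n w) \<le> cmod (f w * ?r w)" for n using cut_le by auto
  qed auto
  have l3: "(\<lambda>n. LINT w|lborel. g w * (cutoff n w * ?k w)) \<longlonglongrightarrow> (LINT w|lborel. g w * ?k w)"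
  proof (rule integral_dominated_convergence[OF _ _ integrable_norm[OF admissible_integrable(1)[OF g, of z]]])
    show "AE w in lborel. (\<lambda>n. g w * (cutoff n w * ?k w)) \<longlonglongrightarrow> g w * ?k w"
    proof (rule AE_I2)
      fix w show "(\<lambda>n. g w * (cutoff n w * ?k w)) \<longlonglongrightarrow> g w * ?k w"
        using tendsto_mult[OF tendsto_const tendsto_mult[OF cutoff_tendsto tendsto_const], of "g w" w "?k w"] by simp
    qed
    show "AE w in lborel. norm (g w * (cutoff n w * ?k w)) \<le> cmod (g w / (z - w))" for n
    proof (rule AE_I2)
      fix w
      have "cmod (cutoff n w) * cmod (?k w) \<le> 1 * (1 / cmod (z - w))"
        by (intro mult_mono cutoff_nonneg_le_1 norm_kern_le) auto
      from mult_left_mono[OF this, of "cmod (g w)"]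
      show "norm (g w * (cutoff n w * ?k w)) \<le> cmod (g w / (z - w))" by (simp add: norm_mult norm_divide)
    qed
  qed auto
  have eq: "(LINT w|lborel. f w * (dzbar (cutoff n) w * ?k w)) - (LINT w|lborel. f w * ?r w * cutoff n w) = - (LINT w|lborel. g w * (cutoff n w * ?k w))" for n
  proof -
    have t: "test_function UNIV (\<lambda>w. cutoff n w * ?k w)" by (intro test_function_cutoff_mult kern_elem d)
    have "dzbar (\<lambda>w. cutoff n w * ?k w) w = dzbar (cutoff n) w * ?k w + cutoff n w * (- ?r w)" for w
      using wirtinger_mult(2)[OF elem_smooth_differentiable[OF cutoff_elem] elem_smooth_differentiable[OF kern_elem[OF d]]]
      unfolding dzbar_kern[OF d] .
    then have "f w * dzbar (\<lambda>w. cutoff n w * ?k w) w = f w * (dzbar (cutoff n) w * ?k w) - f w * ?r w * cutoff n w" for w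
      by (simp only:) (simp add: algebra_simps)
    then have "(LINT w|lborel. f w * dzbar (\<lambda>w. cutoff n w * ?k w) w) = (LINT w|lborel. f w * (dzbar (cutoff n) w * ?k w) - f w * ?r w * cutoff n w)"
      by (simp only:)
    also have "\<dots> = (LINT w|lborel. f w * (dzbar (cutoff n) w * ?k w)) - (LINT w|lborel. f w * ?r w * cutoff n w)"
      by (rule Bochner_Integration.integral_diff[OF i1 i2])
    finally show ?thesis using weak[OF t] by simp
  qed
  have "(\<lambda>n. (LINT w|lborel. f w * (dzbar (cutoff n) w * ?k w)) - (LINT w|lborel. f w * ?r w * cutoff n w)) \<longlonglongrightarrow> 0 - (LINT w|lborel. f w * ?r w)"
    by (intro tendsto_diff l1 l2)
  moreover have "(\<lambda>n. (LINT w|lborel. f w * (dzbar (cutoff n) w * ?k w)) - (LINT w|lborel. f w * ?r w * cutoff n w)) \<longlonglongrightarrow> - (LINT w|lborel. g w * ?k w)"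
    unfolding eq by (intro tendsto_minus l3)
  ultimately show ?thesis using LIMSEQ_unique by fastforce
qed

lemma integral_rho:
  fixes \<phi> :: "complex \<Rightarrow> complex"
  assumes d: "d > 0" and [measurable]: "\<phi> \<in> borel_measurable borel"
  shows "(LINT z|lborel. \<phi> z * of_real (rho d (z - w))) = (LINT x|lborel. \<phi> (w + d *\<^sub>R x) * of_real (1 / (1 + (cmod x)\<^sup>2)\<^sup>2))"
proof -
  have "(LINT z|lborel. \<phi> z * of_real (rho d (z - w))) = \<bar>d\<bar> ^ DIM(complex) *\<^sub>R (LINT x|lborel. \<phi> (w + d *\<^sub>R x) * of_real (rho d (w + d *\<^sub>R x - w)))"
    by (rule lborel_integral_affine) (use d in auto)
  also have "\<dots> = (LINT x|lborel. d\<^sup>2 *\<^sub>R (\<phi> (w + d *\<^sub>R x) * of_real (rho d (d *\<^sub>R x))))"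
    by simp
  also have "\<dots> = (LINT x|lborel. \<phi> (w + d *\<^sub>R x) * of_real (d\<^sup>2 * rho d (d *\<^sub>R x)))"
    by (simp add: scaleR_conv_of_real mult_ac)
  finally show ?thesis unfolding rho_scale[OF d] .
qed

lemma rho_commute: "rho d (z - w) = rho d (w - z)"
  by (simp add: rho_def norm_minus_commute)

text \<open>The substitution z = w + d x moves all dependence on d into the argument of \<phi>,
  leaving one integrable profile of mass \<open>bubble_mass\<close>.\<close>

lemma integral_rho_tendsto:
  fixes \<phi> :: "complex \<Rightarrow> complex"
  assumes cont: "continuous_on UNIV \<phi>" and B: "\<And>z. cmod (\<phi> z) \<le> B"
    and h: "h \<longlonglongrightarrow> 0" "\<And>n::nat. 0 < h n"
  shows "(\<lambda>n. LINT z|lborel. \<phi> z * of_real (rho (h n) (z - w))) \<longlonglongrightarrow> of_real bubble_mass * \<phi> w"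
proof -
  have [measurable]: "\<phi> \<in> borel_measurable borel" using cont by (rule borel_measurable_continuous_onI)
  let ?D = "\<lambda>x. 1 / (1 + (cmod x)\<^sup>2)\<^sup>2"
  have "(\<lambda>n. LINT x|lborel. \<phi> (w + h n *\<^sub>R x) * of_real (?D x)) \<longlonglongrightarrow> (LINT x|lborel. \<phi> w * of_real (?D x))"
  proof (rule integral_dominated_convergence[where w="\<lambda>x. B * ?D x"])
    show "integrable lborel (\<lambda>x. B * ?D x)" by (intro integrable_mult_right integrable_decay)
    show "AE x in lborel. (\<lambda>n. \<phi> (w + h n *\<^sub>R x) * of_real (?D x)) \<longlonglongrightarrow> \<phi> w * of_real (?D x)"
    proof (rule AE_I2)
      fix x
      have "(\<lambda>n. w + h n *\<^sub>R x) \<longlonglongrightarrow> w + 0 *\<^sub>R x" by (intro tendsto_intros h)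
      then have "(\<lambda>n. \<phi> (w + h n *\<^sub>R x)) \<longlonglongrightarrow> \<phi> w"
        using cont by (intro continuous_on_tendsto_compose[OF cont]) auto
      then show "(\<lambda>n. \<phi> (w + h n *\<^sub>R x) * of_real (?D x)) \<longlonglongrightarrow> \<phi> w * of_real (?D x)"
        by (intro tendsto_mult tendsto_const)
    qed
    show "AE x in lborel. norm (\<phi> (w + h n *\<^sub>R x) * of_real (?D x)) \<le> B * ?D x" for n
    proof (rule AE_I2)
      fix x
      have "norm (\<phi> (w + h n *\<^sub>R x) * of_real (?D x)) = cmod (\<phi> (w + h n *\<^sub>R x)) * ?D x"
        unfolding norm_mult norm_of_real by simp
      also have "\<dots> \<le> B * ?D x" by (intro mult_right_mono B) simp
      finally show "norm (\<phi> (w + h n *\<^sub>R x) * of_real (?D x)) \<le> B * ?D x" .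
    qed
  qed measurable
  moreover have "(LINT x|lborel. \<phi> w * of_real (?D x)) = \<phi> w * of_real bubble_mass"
    unfolding bubble_mass_def by (simp only: integral_mult_right_zero integral_complex_of_real)
  ultimately show ?thesis
    using h(2) by (simp add: integral_rho mult.commute[of "of_real bubble_mass"])
qed

text \<open>Smoothing destroys the compact support of \<phi>, and f is merely in L^q, so the limit d
  to 0 asks for a majorant that is both bounded and integrable. Near the support it comes from the
  mass of \<open>rho d\<close>, far away from its decay.\<close>

lemma integral_rho_decay:
  fixes \<phi> :: "complex \<Rightarrow> complex"
  assumes cont: "continuous_on UNIV \<phi>" and K: "compact K" "\<And>z. z \<notin> K \<Longrightarrow> \<phi> z = 0"
  obtains C where "0 \<le> C"
    "\<And>w d. 0 < d \<Longrightarrow> d \<le> 1 \<Longrightarrow> (LINT z|lborel. cmod (\<phi> z) * rho d (z - w)) \<le> C * (1 / (1 + (cmod w)\<^sup>2)\<^sup>2)"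
proof -
  have [measurable]: "\<phi> \<in> borel_measurable borel" using cont by (rule borel_measurable_continuous_onI)
  obtain B where B: "0 \<le> B" "\<And>z. cmod (\<phi> z) \<le> B" using compact_support_bounded[OF cont K] by blast
  obtain r0 where "K \<subseteq> ball 0 r0" using K(1) compact_imp_bounded bounded_subset_ballD by blast
  then obtain r where r: "K \<subseteq> ball 0 r" "1 \<le> r" using subset_ball[of r0 "max r0 1" 0] by (metis max.cobounded1 max.cobounded2 subset_trans)
  define I where "I = (LINT z|lborel. cmod (\<phi> z))"
  have int: "integrable lborel (\<lambda>z. cmod (\<phi> z))" by (intro integrable_norm integrable_compact_support[OF cont K])
  have I0: "0 \<le> I" unfolding I_def by (rule Bochner_Integration.integral_nonneg) auto
  define C where "C = B * bubble_mass * (1 + 4 * r\<^sup>2)\<^sup>2 + 64 * I"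
  have ri: "integrable lborel (\<lambda>z. rho d (z - w))" if "0 < d" for d w
    using integrable_rho[OF that, of w] by (simp add: rho_commute)
  have ii: "integrable lborel (\<lambda>z. cmod (\<phi> z) * rho d (z - w))" if d: "0 < d" for d w
    by (rule Bochner_Integration.integrable_bound[OF integrable_mult_right[OF ri[OF d], of B]])
      (use B rho_nonneg[of d] in \<open>auto intro!: AE_I2 mult_right_mono simp: abs_mult abs_of_nonneg\<close>)
  show ?thesis
  proof (rule that)
    show "0 \<le> C" using B I0 bubble_mass_pos by (simp add: C_def)
    fix w :: complex and d :: real assume d: "0 < d" "d \<le> 1"
    have "0 < 1 + (cmod w)\<^sup>2" by (simp add: add_pos_nonneg)
    then have pos: "0 < (1 + (cmod w)\<^sup>2)\<^sup>2" by (rule zero_less_power)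
    have "(LINT z|lborel. cmod (\<phi> z) * rho d (z - w)) * (1 + (cmod w)\<^sup>2)\<^sup>2 \<le> C"
    proof (cases "cmod w \<le> 2 * r")
      case True
      have "(LINT z|lborel. cmod (\<phi> z) * rho d (z - w)) \<le> (LINT z|lborel. B * rho d (z - w))"
        by (intro integral_mono ii d integrable_mult_right ri mult_right_mono B rho_nonneg)
      also have "\<dots> = B * (LINT z|lborel. rho d (z - w))" by (rule integral_mult_right_zero)
      also have "(LINT z|lborel. rho d (z - w)) = bubble_mass"
      proof -
        have "complex_of_real (LINT z|lborel. rho d (z - w)) = of_real bubble_mass"
          using integral_rho[OF d(1), of "\<lambda>_. 1" w] unfolding bubble_mass_def by (simp only: mult_1 borel_measurable_const integral_complex_of_real simp_thms)
        then show ?thesis by simp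
      qed
      finally have "(LINT z|lborel. cmod (\<phi> z) * rho d (z - w)) \<le> B * bubble_mass" .
      moreover have "(1 + (cmod w)\<^sup>2)\<^sup>2 \<le> (1 + 4 * r\<^sup>2)\<^sup>2"
        using power_mono[OF True, of 2] by (intro power_mono) (auto simp: power_mult_distrib)
      ultimately have "(LINT z|lborel. cmod (\<phi> z) * rho d (z - w)) * (1 + (cmod w)\<^sup>2)\<^sup>2 \<le> B * bubble_mass * (1 + 4 * r\<^sup>2)\<^sup>2"
        using B bubble_mass_pos by (intro mult_mono) auto
      then show ?thesis using I0 by (simp add: C_def)
    next
      case False
      let ?q = "64 / (1 + (cmod w)\<^sup>2)\<^sup>2"
      have "(LINT z|lborel. cmod (\<phi> z) * rho d (z - w)) \<le> (LINT z|lborel. cmod (\<phi> z) * ?q)"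
      proof (intro integral_mono ii d integrable_mult_left int)
        fix z
        show "cmod (\<phi> z) * rho d (z - w) \<le> cmod (\<phi> z) * ?q"
        proof (cases "z \<in> K")
          case True
          then have "cmod z < r" using r by auto
          moreover have "cmod w \<le> cmod z + cmod (z - w)" using norm_triangle_ineq4[of z "z - w"] by simp
          \<comment> \<open>Here |w| > 2 r and |z| < r make |w| comparable to |z - w|. The constant
            64 is the square of the 8 in 1 + |w|^2 \<le> 8 (|z - w|^2 + d^2).\<close>
          ultimately have zw: "cmod w \<le> 2 * cmod (z - w)" using False by linarith
          have "1 \<le> cmod w" using False r by linarith
          then have "1 \<le> (cmod w)\<^sup>2" by simp
          then have "1 + (cmod w)\<^sup>2 \<le> 2 * (cmod w)\<^sup>2" by simp
          also have "\<dots> \<le> 2 * (2 * cmod (z - w))\<^sup>2" by (intro mult_left_mono power_mono zw) auto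
          also have "\<dots> \<le> 8 * ((cmod (z - w))\<^sup>2 + d\<^sup>2)" by (simp add: power_mult_distrib)
          finally have "(1 + (cmod w)\<^sup>2)\<^sup>2 \<le> (8 * ((cmod (z - w))\<^sup>2 + d\<^sup>2))\<^sup>2" by (intro power_mono) auto
          moreover have "(8 * x)\<^sup>2 = 64 * x\<^sup>2" for x :: real by (simp add: power2_eq_square)
          ultimately have 1: "(1 + (cmod w)\<^sup>2)\<^sup>2 \<le> 64 * ((cmod (z - w))\<^sup>2 + d\<^sup>2)\<^sup>2" by (simp only:)
          have dpos: "0 < ((cmod (z - w))\<^sup>2 + d\<^sup>2)\<^sup>2" by (rule zero_less_power[OF kern_den_pos[OF d(1)]])
          have "d\<^sup>2 \<le> 1" using d by (simp add: power_le_one)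
          then have "rho d (z - w) \<le> 1 / ((cmod (z - w))\<^sup>2 + d\<^sup>2)\<^sup>2"
            unfolding rho_def by (intro divide_right_mono) auto
          also have "\<dots> \<le> ?q" using 1 dpos pos by (simp add: divide_simps)
          finally show ?thesis by (intro mult_left_mono) auto
        qed (simp add: K(2))
      qed
      also have "\<dots> = I * ?q" unfolding I_def by (rule integral_mult_left_zero)
      finally have "(LINT z|lborel. cmod (\<phi> z) * rho d (z - w)) * (1 + (cmod w)\<^sup>2)\<^sup>2 \<le> I * ?q * (1 + (cmod w)\<^sup>2)\<^sup>2"
        by (rule mult_right_mono) simp
      also have "\<dots> = 64 * I" using pos by (simp only: mult.assoc nonzero_divide_eq_eq) (simp add: field_simps)
      finally have "(LINT z|lborel. cmod (\<phi> z) * rho d (z - w)) * (1 + (cmod w)\<^sup>2)\<^sup>2 \<le> 64 * I" .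
      moreover have "0 \<le> B * bubble_mass * (1 + 4 * r\<^sup>2)\<^sup>2" using B bubble_mass_pos by (intro mult_nonneg_nonneg) auto
      ultimately show ?thesis unfolding C_def by linarith
    qed
    then show "(LINT z|lborel. cmod (\<phi> z) * rho d (z - w)) \<le> C * (1 / (1 + (cmod w)\<^sup>2)\<^sup>2)"
      using pos by (simp add: pos_le_divide_eq)
  qed
qed

lemma test_function_support:
  assumes "test_function U \<phi>"
  obtains K where "compact K" "K \<subseteq> U" "\<And>z. z \<notin> K \<Longrightarrow> \<phi> z = 0" "\<And>z. z \<notin> K \<Longrightarrow> frechet_derivative \<phi> (at z) = (\<lambda>_. 0)"
proof
  let ?K = "closure {z. \<phi> z \<noteq> 0}"
  show "compact ?K" "?K \<subseteq> U" using assms by (auto simp: test_function_def)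
  show z: "\<phi> z = 0" if "z \<notin> ?K" for z
    using that closure_subset[of "{z. \<phi> z \<noteq> 0}"] by auto
  show "frechet_derivative \<phi> (at z) = (\<lambda>_. 0)" if "z \<notin> ?K" for z
    by (rule has_derivative_eq_0_outside[OF test_function_props(5)[OF assms] closed_closure that z])
qed

lemma integrable_mult_compact_support:
  fixes f \<phi> :: "complex \<Rightarrow> complex"
  assumes loc: "\<And>r. integrable lborel (\<lambda>z. f z * of_real (indicator (ball 0 r) z))" and [measurable]: "f \<in> borel_measurable borel"
    and cont: "continuous_on UNIV \<phi>" and K: "compact K" "\<And>z. z \<notin> K \<Longrightarrow> \<phi> z = 0"
  shows "integrable lborel (\<lambda>z. f z * \<phi> z)"
proof -
  have [measurable]: "\<phi> \<in> borel_measurable borel" using cont by (rule borel_measurable_continuous_onI)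
  obtain B where B: "0 \<le> B" "\<And>z. cmod (\<phi> z) \<le> B" using compact_support_bounded[OF cont K] by blast
  obtain r where r: "K \<subseteq> ball 0 r" using K(1) compact_imp_bounded bounded_subset_ballD by blast
  show ?thesis
  proof (rule Bochner_Integration.integrable_bound[OF integrable_mult_right[OF loc[of r], of "of_real B"]])
    show "AE z in lborel. norm (f z * \<phi> z) \<le> norm (of_real B * (f z * of_real (indicator (ball 0 r) z)))"
    proof (rule AE_I2)
      fix z
      show "norm (f z * \<phi> z) \<le> norm (of_real B * (f z * of_real (indicator (ball 0 r) z)))"
      proof (cases "z \<in> K")
        case True
        then have "z \<in> ball 0 r" using r by auto
        then show ?thesis using B mult_left_mono[OF B(2)[of z], of "cmod (f z)"] by (simp add: norm_mult mult.commute)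
      qed (simp add: K(2))
    qed
  qed simp
qed

text \<open>Pair the mollified equation with \<phi> and let d tend to 0: the two sides tend to
  \<open>bubble_mass\<close> times the pairings of f and of C g with \<phi>. Membership of f in L^q
  takes the place of Liouville's theorem for the difference f - C g.\<close>

lemma cauchy_representation:
  fixes f g :: "complex \<Rightarrow> complex"
  assumes f[measurable]: "f \<in> borel_measurable borel" and int: "integrable lborel (\<lambda>z. cmod (f z) powr q)" and q: "1 < q"
    and g: "admissible g N"
    and weak: "\<And>\<phi>. test_function UNIV \<phi> \<Longrightarrow> (LINT z|lborel. f z * dzbar \<phi> z) = - (LINT z|lborel. g z * \<phi> z)"
  shows "AE z in lborel. f z = cauchy g z"
proof -
  have gm[measurable]: "g \<in> borel_measurable borel" using g by (rule admissible_measurable)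
  let ?m = "of_real bubble_mass :: complex"
  have m: "?m \<noteq> 0" using bubble_mass_pos by simp
  have f_loc: "integrable lborel (\<lambda>z. f z * of_real (indicator (ball 0 r) z))" for r
    by (rule Lq_locally_integrable[OF f int q integrable_indicator_ball, where B=1]) (auto simp: indicator_def)
  have c_loc: "integrable lborel (\<lambda>z. cauchy g z * of_real (indicator (ball 0 r) z))" for r
  proof (rule Bochner_Integration.integrable_bound[OF integrable_mult_right[OF integrable_indicator_ball[of 0 r], of "N / bubble_mass"]])
    show "(\<lambda>z. cauchy g z * of_real (indicator (ball 0 r) z)) \<in> borel_measurable lborel" by measurable
    show "AE z in lborel. norm (cauchy g z * of_real (indicator (ball 0 r) z)) \<le> norm (N / bubble_mass * indicator (ball 0 r) z :: real)"
    proof (rule AE_I2)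
      fix z show "norm (cauchy g z * of_real (indicator (ball 0 r) z)) \<le> norm (N / bubble_mass * indicator (ball 0 r) z :: real)"
        using order_trans[OF cauchy_bound[OF g, of z] abs_ge_self] by (simp add: norm_mult indicator_def)
    qed
  qed
  define h where "h n = 1 / real (Suc n)" for n
  have h: "h \<longlonglongrightarrow> 0" "\<And>n. 0 < h n" "\<And>n. h n \<le> 1"
    unfolding h_def by (rule LIMSEQ_Suc[OF lim_1_over_n]) auto
  have main: "(LINT z|lborel. (f z - cauchy g z) * \<phi> z) = 0" if test: "test_function UNIV \<phi>" for \<phi>
  proof -
    have cont: "continuous_on UNIV \<phi>" using test_function_props(2)[OF test] .
    obtain K where K: "compact K" "\<And>z. z \<notin> K \<Longrightarrow> \<phi> z = 0" using test_function_support[OF test] by metis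
    have [measurable]: "\<phi> \<in> borel_measurable borel" using cont by (rule borel_measurable_continuous_onI)
    obtain B where B: "0 \<le> B" "\<And>z. cmod (\<phi> z) \<le> B" using compact_support_bounded[OF cont K] by blast
    obtain C where C: "0 \<le> C" "\<And>w d. 0 < d \<Longrightarrow> d \<le> 1 \<Longrightarrow> (LINT z|lborel. cmod (\<phi> z) * rho d (z - w)) \<le> C * (1 / (1 + (cmod w)\<^sup>2)\<^sup>2)"
      using integral_rho_decay[OF cont K] by metis
    let ?H = "\<lambda>w. C * (1 / (1 + (cmod w)\<^sup>2)\<^sup>2)"
    have fH: "integrable lborel (\<lambda>w. f w * of_real (?H w))"
    proof (rule Lq_locally_integrable[OF f int q, of _ C])
      show "integrable lborel ?H" by (intro integrable_mult_right integrable_decay)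
      fix w :: complex
      have "1 \<le> (1 + (cmod w)\<^sup>2)\<^sup>2" by (intro one_le_power) simp
      then have "1 / (1 + (cmod w)\<^sup>2)\<^sup>2 \<le> 1" using frac_le[of 1 1 1 "(1 + (cmod w)\<^sup>2)\<^sup>2"] by simp
      then show "\<bar>?H w\<bar> \<le> C" using C(1) mult_left_mono[of "1 / (1 + (cmod w)\<^sup>2)\<^sup>2" 1 C] by (simp add: abs_mult)
    qed
    have phi_int: "integrable lborel \<phi>" by (rule integrable_compact_support[OF cont K])
    let ?I = "\<lambda>n w. LINT z|lborel. \<phi> z * of_real (rho (h n) (z - w))"
    have I_le: "cmod (?I n w) \<le> ?H w" for n w
    proof -
      have "cmod (?I n w) \<le> (LINT z|lborel. cmod (\<phi> z * of_real (rho (h n) (z - w))))" by (rule integral_norm_bound)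
      also have "\<dots> = (LINT z|lborel. cmod (\<phi> z) * rho (h n) (z - w))"
        unfolding norm_mult norm_of_real abs_of_nonneg[OF rho_nonneg] ..
      also have "\<dots> \<le> ?H w" by (rule C(2)[OF h(2,3)])
      finally show ?thesis .
    qed
    have lhs: "(\<lambda>n. LINT w|lborel. f w * ?I n w) \<longlonglongrightarrow> (LINT w|lborel. f w * (?m * \<phi> w))"
    proof (rule integral_dominated_convergence[OF _ _ integrable_norm[OF fH]])
      show "AE w in lborel. (\<lambda>n. f w * ?I n w) \<longlonglongrightarrow> f w * (?m * \<phi> w)"
        by (intro AE_I2 tendsto_mult tendsto_const integral_rho_tendsto[OF cont B(2) h(1,2)])
      show "AE w in lborel. norm (f w * ?I n w) \<le> norm (f w * of_real (?H w))" for n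
        using I_le C(1) by (intro AE_I2) (simp only: norm_mult norm_of_real, intro mult_left_mono order_trans[OF I_le abs_ge_self], simp)
    qed measurable
    let ?J = "\<lambda>n z. LINT w|lborel. g w * kern (h n) z w"
    \<comment> \<open>Before the exchange the smoothing acts on \<phi>, afterwards on f, where the
      mollified equation replaces f by g.\<close>
    have fub: "(LINT w|lborel. f w * ?I n w) = (LINT z|lborel. \<phi> z * ?J n z)" for n
    proof -
      have pi: "integrable (lborel \<Otimes>\<^sub>M lborel) (\<lambda>(w, z). f w * (\<phi> z * of_real (rho (h n) (z - w))))"
      proof (rule lborel_pair.Fubini_integrable)
        show "(\<lambda>(w, z). f w * (\<phi> z * of_real (rho (h n) (z - w)))) \<in> borel_measurable (lborel \<Otimes>\<^sub>M lborel)" by measurable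
        have e: "(LINT z|lborel. norm (f w * (\<phi> z * of_real (rho (h n) (z - w))))) = cmod (f w) * (LINT z|lborel. cmod (\<phi> z) * rho (h n) (z - w))" for w
          unfolding norm_mult norm_of_real abs_of_nonneg[OF rho_nonneg] by (rule integral_mult_right_zero)
        have "integrable lborel (\<lambda>w. cmod (f w) * (LINT z|lborel. cmod (\<phi> z) * rho (h n) (z - w)))"
        proof (rule Bochner_Integration.integrable_bound[OF fH])
          show "AE w in lborel. norm (cmod (f w) * (LINT z|lborel. cmod (\<phi> z) * rho (h n) (z - w))) \<le> norm (f w * of_real (?H w))"
          proof (rule AE_I2)
            fix w
            have "0 \<le> (LINT z|lborel. cmod (\<phi> z) * rho (h n) (z - w))"
              by (intro Bochner_Integration.integral_nonneg mult_nonneg_nonneg rho_nonneg) auto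
            then have "\<bar>LINT z|lborel. cmod (\<phi> z) * rho (h n) (z - w)\<bar> \<le> \<bar>?H w\<bar>" using C(2)[OF h(2,3), of n w] by linarith
            then show "norm (cmod (f w) * (LINT z|lborel. cmod (\<phi> z) * rho (h n) (z - w))) \<le> norm (f w * of_real (?H w))"
              unfolding norm_mult norm_of_real real_norm_def abs_mult abs_norm_cancel by (rule mult_left_mono) simp
          qed
        qed measurable
        then show "integrable lborel (\<lambda>w. LINT z|lborel. norm (case (w, z) of (w, z) \<Rightarrow> f w * (\<phi> z * of_real (rho (h n) (z - w)))))"
          unfolding prod.case e .
        have "integrable lborel (\<lambda>z. \<phi> z * of_real (rho (h n) (z - w)))" for w
        proof (rule Bochner_Integration.integrable_bound[OF integrable_mult_right[OF phi_int, of "of_real (1 / (h n)\<^sup>2)"]])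
          show "AE z in lborel. norm (\<phi> z * of_real (rho (h n) (z - w))) \<le> norm (of_real (1 / (h n)\<^sup>2) * \<phi> z)"
          proof (rule AE_I2)
            fix z show "norm (\<phi> z * of_real (rho (h n) (z - w))) \<le> norm (of_real (1 / (h n)\<^sup>2) * \<phi> z)"
              using mult_left_mono[OF rho_le[OF h(2), of n "z - w"], of "cmod (\<phi> z)"]
              unfolding norm_mult norm_of_real abs_of_nonneg[OF rho_nonneg] by (simp add: mult.commute)
          qed
        qed measurable
        then show "AE w in lborel. integrable lborel (\<lambda>z. case (w, z) of (w, z) \<Rightarrow> f w * (\<phi> z * of_real (rho (h n) (z - w))))"
          unfolding prod.case by (intro AE_I2 integrable_mult_right)
      qed
      have "(LINT w|lborel. f w * ?I n w) = (LINT w|lborel. LINT z|lborel. f w * (\<phi> z * of_real (rho (h n) (z - w))))"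
        by (simp only: integral_mult_right_zero)
      also have "\<dots> = (LINT z|lborel. LINT w|lborel. f w * (\<phi> z * of_real (rho (h n) (z - w))))"
        using lborel_pair.Fubini_integral[OF pi] by simp
      also have "\<dots> = (LINT z|lborel. LINT w|lborel. \<phi> z * (f w * of_real (rho (h n) (z - w))))"
        by (simp only: mult.left_commute)
      also have "\<dots> = (LINT z|lborel. \<phi> z * (LINT w|lborel. f w * of_real (rho (h n) (z - w))))"
        by (simp only: integral_mult_right_zero)
      also have "\<dots> = (LINT z|lborel. \<phi> z * ?J n z)"
        by (simp only: weak_dzbar_mollified[OF f int q g weak h(2)])
      finally show ?thesis .
    qed
    \<comment> \<open>All regularised kernels are dominated by 1/|z - w|, so admissibility bounds
      their transforms uniformly in n and z.\<close>
    have J_le: "cmod (?J n z) \<le> N" for n z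
    proof -
      have ab: "cmod (g w * kern (h n) z w) \<le> cmod (g w) / cmod (z - w)" for w
        using mult_left_mono[OF norm_kern_le[of "h n" z w], of "cmod (g w)"] by (simp add: norm_mult)
      have ig: "integrable lborel (\<lambda>w. cmod (g w) / cmod (z - w))"
        using integrable_norm[OF admissible_integrable(1)[OF g, of z]] by (simp only: norm_divide)
      have ik: "integrable lborel (\<lambda>w. g w * kern (h n) z w)"
        by (rule Bochner_Integration.integrable_bound[OF ig]) (use ab in \<open>auto simp: abs_of_nonneg\<close>)
      have "cmod (?J n z) \<le> (LINT w|lborel. cmod (g w * kern (h n) z w))" by (rule integral_norm_bound)
      also have "\<dots> \<le> (LINT w|lborel. cmod (g w) / cmod (z - w))"
        by (rule integral_mono[OF integrable_norm[OF ik] ig ab])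
      also have "\<dots> \<le> N" by (rule admissible_integrable(2)[OF g])
      finally show ?thesis .
    qed
    have J_lim: "(\<lambda>n. ?J n z) \<longlonglongrightarrow> ?m * cauchy g z" for z
    proof -
      have "(\<lambda>n. ?J n z) \<longlonglongrightarrow> (LINT w|lborel. g w * (1 / (z - w)))"
      proof (rule integral_dominated_convergence[OF _ _ integrable_norm[OF admissible_integrable(1)[OF g, of z]]])
        show "AE w in lborel. (\<lambda>n. g w * kern (h n) z w) \<longlonglongrightarrow> g w * (1 / (z - w))"
          by (intro AE_I2 tendsto_mult tendsto_const kern_tendsto h)
        show "AE w in lborel. norm (g w * kern (h n) z w) \<le> norm (g w / (z - w))" for n
        proof (rule AE_I2)
          fix w show "norm (g w * kern (h n) z w) \<le> norm (g w / (z - w))"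
            using mult_left_mono[OF norm_kern_le[of "h n" z w], of "cmod (g w)"] by (simp add: norm_mult norm_divide)
        qed
      qed measurable
      then show ?thesis using m by (simp add: cauchy_def)
    qed
    have kmeas: "(\<lambda>z. ?J n z) \<in> borel_measurable borel" for n
    proof -
      have "(\<lambda>(z, w). kern (h n) z w) \<in> borel_measurable (borel \<Otimes>\<^sub>M lborel)"
        using kern_measurable(2)[of "h n"] by (simp cong: measurable_cong_sets sets_pair_measure_cong)
      then show ?thesis by measurable
    qed
    have rhs: "(\<lambda>n. LINT z|lborel. \<phi> z * ?J n z) \<longlonglongrightarrow> (LINT z|lborel. \<phi> z * (?m * cauchy g z))"
    proof (rule integral_dominated_convergence[OF _ _ integrable_mult_left[OF integrable_norm[OF phi_int], of N]])
      show "AE z in lborel. (\<lambda>n. \<phi> z * ?J n z) \<longlonglongrightarrow> \<phi> z * (?m * cauchy g z)"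
        by (intro AE_I2 tendsto_mult tendsto_const J_lim)
      show "AE z in lborel. norm (\<phi> z * ?J n z) \<le> cmod (\<phi> z) * N" for n
        unfolding norm_mult by (intro AE_I2 mult_left_mono J_le) simp
      show "(\<lambda>z. \<phi> z * ?J n z) \<in> borel_measurable lborel" for n using kmeas[of n] by measurable
    qed measurable
    have "(LINT w|lborel. f w * (?m * \<phi> w)) = (LINT z|lborel. \<phi> z * (?m * cauchy g z))"
      using LIMSEQ_unique[OF lhs] rhs unfolding fub by blast
    then have "?m * (LINT w|lborel. f w * \<phi> w) = ?m * (LINT z|lborel. cauchy g z * \<phi> z)"
      unfolding integral_mult_right_zero[symmetric] by (simp add: mult_ac)
    then have "(LINT w|lborel. f w * \<phi> w) = (LINT z|lborel. cauchy g z * \<phi> z)" using m by simp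
    moreover have "integrable lborel (\<lambda>w. f w * \<phi> w)"
      by (rule integrable_mult_compact_support[OF f_loc f cont K])
    moreover have "integrable lborel (\<lambda>w. cauchy g w * \<phi> w)"
      by (rule integrable_mult_compact_support[OF c_loc cauchy_measurable[OF gm] cont K])
    ultimately show ?thesis by (simp add: left_diff_distrib)
  qed
  have "AE z in lborel. z \<in> UNIV \<longrightarrow> f z - cauchy g z = 0"
  proof (rule AE_eq_0_if_test_function[OF open_UNIV _ _ main])
    fix K :: "complex set" assume K: "compact K"
    obtain r where r: "K \<subseteq> ball 0 r" using K compact_imp_bounded bounded_subset_ballD by blast
    have "integrable lborel (\<lambda>z. f z * of_real (indicator (ball 0 r) z) - cauchy g z * of_real (indicator (ball 0 r) z))"
      by (intro Bochner_Integration.integrable_diff f_loc c_loc)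
    moreover have "(\<lambda>z. f z * of_real (indicator (ball 0 r) z) - cauchy g z * of_real (indicator (ball 0 r) z))
        = (\<lambda>z. indicator (ball 0 r) z *\<^sub>R (f z - cauchy g z))"
      by (auto simp: fun_eq_iff indicator_def)
    ultimately have "set_integrable lborel (ball 0 r) (\<lambda>z. f z - cauchy g z)"
      by (simp add: set_integrable_def)
    then show "set_integrable lborel K (\<lambda>z. f z - cauchy g z)"
      by (rule set_integrable_subset) (use r borel_closed[OF compact_imp_closed[OF K]] in auto)
  qed auto
  then show ?thesis by eventually_elim simp
qed

section \<open>Weak derivatives of Borel functions\<close>

text \<open>\<open>K\<close> depends on the ball alone, and the bound is linear in \<open>A\<close>;
  this is what keeps later estimates uniform in the coefficients. The added 1 makes the constant
  positive.\<close>

lemma bounded_admissible: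
  obtains K where "0 < K"
    "\<And>g A. g \<in> borel_measurable borel \<Longrightarrow> 0 \<le> A \<Longrightarrow>
      (\<And>w. cmod (g w) \<le> A * indicator (ball c R) w) \<Longrightarrow> admissible g (A * K)"
proof -
  obtain K where K: "0 \<le> K"
    "\<And>z. (\<integral>\<^sup>+w. indicator (ball c R) w * norm (z - w) powr - 1 \<partial>lborel) \<le> ennreal K"
    using nn_integral_norm_powr_diff[of 1 c R] by auto
  show ?thesis
  proof (rule that[of "K + 1"])
    show "0 < K + 1" using K by simp
    fix g A assume [measurable]: "g \<in> borel_measurable borel" and A: "0 \<le> A"
      and le: "\<And>w. cmod (g w) \<le> A * indicator (ball c R) w"
    have "(\<integral>\<^sup>+w. ennreal (cmod (g w) / cmod (z - w)) \<partial>lborel) \<le> ennreal (A * (K + 1))" for z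
    proof -
      have "(\<integral>\<^sup>+w. ennreal (cmod (g w) / cmod (z - w)) \<partial>lborel) \<le> (\<integral>\<^sup>+w. ennreal A * ennreal (indicator (ball c R) w * norm (z - w) powr - 1) \<partial>lborel)"
      proof (intro nn_integral_mono)
        fix w
        have "cmod (g w) / cmod (z - w) \<le> A * indicator (ball c R) w / cmod (z - w)"
          by (intro divide_right_mono le) simp
        also have "\<dots> = A * (indicator (ball c R) w * norm (z - w) powr - 1)"
          by (cases "z = w") (simp_all add: powr_minus divide_inverse)
        finally show "ennreal (cmod (g w) / cmod (z - w)) \<le> ennreal A * ennreal (indicator (ball c R) w * norm (z - w) powr - 1)"
          using A by (simp only: ennreal_mult'[symmetric] ennreal_leI)
      qed
      also have "\<dots> = ennreal A * (\<integral>\<^sup>+w. ennreal (indicator (ball c R) w * norm (z - w) powr - 1) \<partial>lborel)"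
        by (intro nn_integral_cmult) measurable
      also have "\<dots> \<le> ennreal A * ennreal K" by (intro mult_left_mono K) simp
      also have "\<dots> \<le> ennreal (A * (K + 1))" using A K by (simp only: ennreal_mult'[symmetric]) (intro ennreal_leI mult_left_mono, auto)
      finally show ?thesis .
    qed
    then show "admissible g (A * (K + 1))" using A K by (simp add: admissible_def)
  qed
qed

text \<open>Young's inequality separates g from the kernel. For q > 2 the dual exponent q / (q - 1)
  is less than 2, the range in which the kernel power is locally integrable in the plane.\<close>

lemma Lq_admissible:
  assumes g[measurable]: "g \<in> borel_measurable borel" and int: "integrable lborel (\<lambda>z. cmod (g z) powr q)" and q: "2 < q"
    and supp: "\<And>w. w \<notin> ball c R \<Longrightarrow> g w = 0"
  shows "\<exists>N. admissible g N"
proof -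
  define p where "p = q / (q - 1)"
  have p: "0 \<le> p" "p < 2" "1 < p" "1 / q + 1 / p = 1" using q by (auto simp: p_def field_simps)
  obtain K where K: "0 \<le> K"
    "\<And>z. (\<integral>\<^sup>+w. indicator (ball c R) w * norm (z - w) powr - p \<partial>lborel) \<le> ennreal K"
    using nn_integral_norm_powr_diff[OF p(1,2), of c R] by auto
  define J where "J = (LINT z|lborel. cmod (g z) powr q)"
  have J0: "0 \<le> J" unfolding J_def by (rule Bochner_Integration.integral_nonneg) auto
  have "(\<integral>\<^sup>+w. ennreal (cmod (g w) / cmod (z - w)) \<partial>lborel) \<le> ennreal (J + K)" for z
  proof -
    have "(\<integral>\<^sup>+w. ennreal (cmod (g w) / cmod (z - w)) \<partial>lborel)
      \<le> (\<integral>\<^sup>+w. ennreal (cmod (g w) powr q) + ennreal (indicator (ball c R) w * norm (z - w) powr - p) \<partial>lborel)"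
    proof (intro nn_integral_mono)
      fix w
      have "cmod (g w) / cmod (z - w) \<le> cmod (g w) powr q + indicator (ball c R) w * norm (z - w) powr - p"
      proof (cases "w \<in> ball c R")
        case True
        have "cmod (g w) * (1 / cmod (z - w)) \<le> cmod (g w) powr q / q + (1 / cmod (z - w)) powr p / p"
          by (rule Youngs_inequality) (use q p in auto)
        also have "\<dots> \<le> cmod (g w) powr q + (1 / cmod (z - w)) powr p"
          using p q by (intro add_mono) (auto simp: divide_le_eq mult_left_le_one_le mult_le_cancel_left1)
        also have "(1 / cmod (z - w)) powr p = norm (z - w) powr - p"
          by (simp add: powr_minus powr_divide inverse_eq_divide)
        finally show ?thesis using True by simp
      qed (simp add: supp)
      then show "ennreal (cmod (g w) / cmod (z - w)) \<le> ennreal (cmod (g w) powr q) + ennreal (indicator (ball c R) w * norm (z - w) powr - p)"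
        by (subst ennreal_plus[symmetric]) (auto simp del: ennreal_plus intro: ennreal_leI)
    qed
    also have "\<dots> = (\<integral>\<^sup>+w. ennreal (cmod (g w) powr q) \<partial>lborel) + (\<integral>\<^sup>+w. ennreal (indicator (ball c R) w * norm (z - w) powr - p) \<partial>lborel)"
      by (intro nn_integral_add) measurable
    also have "(\<integral>\<^sup>+w. ennreal (cmod (g w) powr q) \<partial>lborel) = ennreal J"
      unfolding J_def by (rule nn_integral_eq_integral[OF int]) simp
    also have "ennreal J + (\<integral>\<^sup>+w. ennreal (indicator (ball c R) w * norm (z - w) powr - p) \<partial>lborel) \<le> ennreal J + ennreal K"
      by (intro add_left_mono K)
    finally show ?thesis using J0 K(1) by simp
  qed
  then show ?thesis using g J0 K(1) by (intro exI[of _ "J + K"]) (simp add: admissible_def)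
qed

text \<open>Fubini's theorem; the sign reflects the antisymmetry of the kernel 1/(z - w).\<close>

lemma cauchy_duality:
  assumes g: "admissible g N" and \<psi>: "integrable lborel \<psi>"
  shows "(LINT z|lborel. cauchy g z * \<psi> z) = - (LINT w|lborel. g w * cauchy \<psi> w)"
proof -
  have [measurable]: "g \<in> borel_measurable borel" "\<psi> \<in> borel_measurable borel"
    using admissible_measurable[OF g] borel_measurable_integrable[OF \<psi>] by auto
  let ?m = "of_real bubble_mass :: complex"
  have m: "?m \<noteq> 0" using bubble_mass_pos by simp
  have pi: "integrable (lborel \<Otimes>\<^sub>M lborel) (\<lambda>(z, w). \<psi> z * (g w / (z - w)))"
  proof (rule lborel_pair.Fubini_integrable)
    show "(\<lambda>(z, w). \<psi> z * (g w / (z - w))) \<in> borel_measurable (lborel \<Otimes>\<^sub>M lborel)" by measurable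
    have e: "(LINT w|lborel. norm (\<psi> z * (g w / (z - w)))) = cmod (\<psi> z) * (LINT w|lborel. cmod (g w) / cmod (z - w))" for z
      unfolding norm_mult norm_divide by (rule integral_mult_right_zero)
    have "integrable lborel (\<lambda>z. cmod (\<psi> z) * (LINT w|lborel. cmod (g w) / cmod (z - w)))"
    proof (rule Bochner_Integration.integrable_bound[OF integrable_mult_left[OF integrable_norm[OF \<psi>], of N]])
      show "AE z in lborel. norm (cmod (\<psi> z) * (LINT w|lborel. cmod (g w) / cmod (z - w))) \<le> norm (cmod (\<psi> z) * N)"
      proof (rule AE_I2)
        fix z
        have "0 \<le> (LINT w|lborel. cmod (g w) / cmod (z - w))" by (rule Bochner_Integration.integral_nonneg) auto
        then have "\<bar>LINT w|lborel. cmod (g w) / cmod (z - w)\<bar> \<le> \<bar>N\<bar>" using admissible_integrable(2)[OF g, of z] by linarith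
        then show "norm (cmod (\<psi> z) * (LINT w|lborel. cmod (g w) / cmod (z - w))) \<le> norm (cmod (\<psi> z) * N)"
          unfolding real_norm_def abs_mult by (rule mult_left_mono) simp
      qed
    qed measurable
    then show "integrable lborel (\<lambda>z. LINT w|lborel. norm (case (z, w) of (z, w) \<Rightarrow> \<psi> z * (g w / (z - w))))"
      unfolding prod.case e .
    show "AE z in lborel. integrable lborel (\<lambda>w. case (z, w) of (z, w) \<Rightarrow> \<psi> z * (g w / (z - w)))"
      unfolding prod.case by (intro AE_I2 integrable_mult_right admissible_integrable(1)[OF g])
  qed
  have "?m * (LINT z|lborel. cauchy g z * \<psi> z) = (LINT z|lborel. \<psi> z * (?m * cauchy g z))"
    unfolding integral_mult_right_zero[symmetric] by (simp add: mult_ac)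
  also have "\<dots> = (LINT z|lborel. \<psi> z * (LINT w|lborel. g w / (z - w)))" using m by (simp add: cauchy_def)
  also have "\<dots> = (LINT z|lborel. LINT w|lborel. \<psi> z * (g w / (z - w)))" by (simp only: integral_mult_right_zero)
  also have "\<dots> = (LINT w|lborel. LINT z|lborel. \<psi> z * (g w / (z - w)))"
    using lborel_pair.Fubini_integral[OF pi] by simp
  also have "\<dots> = (LINT w|lborel. LINT z|lborel. - g w * (\<psi> z / (w - z)))"
  proof (intro Bochner_Integration.integral_cong refl)
    fix w z :: complex
    have "\<psi> z * (g w / (z - w)) = \<psi> z * g w / (- (w - z))" by simp
    also have "\<dots> = - g w * (\<psi> z / (w - z))" unfolding divide_minus_right by simp
    finally show "\<psi> z * (g w / (z - w)) = - g w * (\<psi> z / (w - z))" .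
  qed
  also have "\<dots> = (LINT w|lborel. - g w * (LINT z|lborel. \<psi> z / (w - z)))" by (simp only: integral_mult_right_zero)
  also have "\<dots> = (LINT w|lborel. - ?m * (g w * cauchy \<psi> w))" using m by (simp add: cauchy_def)
  also have "\<dots> = - ?m * (LINT w|lborel. g w * cauchy \<psi> w)" by (rule integral_mult_right_zero)
  finally have "?m * (LINT z|lborel. cauchy g z * \<psi> z) = ?m * (- (LINT w|lborel. g w * cauchy \<psi> w))" by simp
  then show ?thesis using m by (simp only: mult_cancel_left) simp
qed

section \<open>Weak derivatives of Borel functions on the plane\<close>

definition borel_locint :: "(complex \<Rightarrow> complex) \<Rightarrow> bool" where
  "borel_locint f \<longleftrightarrow> f \<in> borel_measurable borel \<and>
     (\<forall>r. integrable lborel (\<lambda>z. f z * of_real (indicator (ball 0 r) z)))"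

text \<open>The counterpart of \<open>has_weak_deriv\<close> on the whole plane for Borel functions
  and \<open>lborel\<close>, where Fubini's theorem and measurability of Cauchy transforms are
  directly available.\<close>

definition borel_weak_deriv ::
    "((complex \<Rightarrow> complex) \<Rightarrow> complex \<Rightarrow> complex) \<Rightarrow> (complex \<Rightarrow> complex) \<Rightarrow> (complex \<Rightarrow> complex) \<Rightarrow> bool" where
  "borel_weak_deriv P f g \<longleftrightarrow> borel_locint f \<and> borel_locint g \<and>
     (\<forall>\<phi>. test_function UNIV \<phi> \<longrightarrow> (LINT z|lborel. f z * P \<phi> z) = - (LINT z|lborel. g z * \<phi> z))"

lemma borel_locintD:
  assumes "borel_locint f"
  shows "f \<in> borel_measurable borel" "\<And>r. integrable lborel (\<lambda>z. f z * of_real (indicator (ball 0 r) z))"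
  using assms by (auto simp: borel_locint_def)

lemma borel_locint_mult:
  assumes "borel_locint f" "continuous_on UNIV \<phi>" "compact K" "\<And>z. z \<notin> K \<Longrightarrow> \<phi> z = 0"
  shows "integrable lborel (\<lambda>z. f z * \<phi> z)"
  using integrable_mult_compact_support[OF borel_locintD(2)[OF assms(1)] borel_locintD(1)[OF assms(1)] assms(2,3)] assms(4) by blast

lemma borel_locint_set_integrable:
  assumes "borel_locint f" "compact K"
  shows "set_integrable lborel K f"
proof -
  obtain r where r: "K \<subseteq> ball 0 r" using assms(2) compact_imp_bounded bounded_subset_ballD by blast
  have "(\<lambda>z. f z * of_real (indicator (ball 0 r) z)) = (\<lambda>z. indicator (ball 0 r) z *\<^sub>R f z)"
    by (auto simp: fun_eq_iff indicator_def)
  then have "set_integrable lborel (ball 0 r) f"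
    using borel_locintD(2)[OF assms(1), of r] by (simp add: set_integrable_def)
  then show ?thesis
    by (rule set_integrable_subset) (use r borel_closed[OF compact_imp_closed[OF assms(2)]] in auto)
qed

lemma borel_locint_if_bounded:
  assumes [measurable]: "f \<in> borel_measurable borel" and B: "\<And>z. cmod (f z) \<le> B"
  shows "borel_locint f"
proof -
  have "integrable lborel (\<lambda>z. f z * of_real (indicator (ball 0 r) z))" for r
  proof -
    from integrable_mult_right[OF integrable_indicator_ball[of 0 r], of B] show ?thesis
    proof (rule Bochner_Integration.integrable_bound)
      show "AE z in lborel. norm (f z * of_real (indicator (ball 0 r) z)) \<le> norm (B * indicator (ball 0 r) z :: real)"
      proof (rule AE_I2)
        fix z show "norm (f z * of_real (indicator (ball 0 r) z)) \<le> norm (B * indicator (ball 0 r) z :: real)"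
          using order_trans[OF B[of z] abs_ge_self] by (simp add: norm_mult indicator_def)
      qed
    qed measurable
  qed
  then show ?thesis by (simp add: borel_locint_def)
qed

lemma borel_locint_add: "borel_locint f \<Longrightarrow> borel_locint g \<Longrightarrow> borel_locint (\<lambda>z. f z + g z)"
  by (auto simp: borel_locint_def distrib_right)

lemma borel_locint_cmult: "borel_locint f \<Longrightarrow> borel_locint (\<lambda>z. k * f z)"
  by (auto simp: borel_locint_def mult.assoc)

lemma cnj_measurable [measurable]: "cnj \<in> borel_measurable borel"
  by (intro borel_measurable_continuous_onI continuous_intros)

lemma borel_locint_cnj: "borel_locint f \<Longrightarrow> borel_locint (\<lambda>z. cnj (f z))"
proof -
  assume f: "borel_locint f"
  have [measurable]: "f \<in> borel_measurable borel" using f by (rule borel_locintD)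
  have "integrable lborel (\<lambda>z. cnj (f z * of_real (indicator (ball 0 r) z)))" for r
    using borel_locintD(2)[OF f, of r] by (simp only: integrable_cnj)
  then show ?thesis by (simp add: borel_locint_def)
qed

lemma test_function_dz_props:
  assumes "test_function U \<phi>"
  shows "continuous_on UNIV (dz \<phi>)" "continuous_on UNIV (dzbar \<phi>)"
  using test_function_props(3,4)[OF assms] unfolding dz_def[abs_def] dzbar_def[abs_def]
  by (auto intro!: continuous_intros)

lemma test_function_deriv_support:
  assumes "test_function U \<phi>"
  obtains K where "compact K" "K \<subseteq> U" "\<And>z. z \<notin> K \<Longrightarrow> \<phi> z = 0" "\<And>z. z \<notin> K \<Longrightarrow> dx \<phi> z = 0" "\<And>z. z \<notin> K \<Longrightarrow> dy \<phi> z = 0"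
    "\<And>z. z \<notin> K \<Longrightarrow> dz \<phi> z = 0" "\<And>z. z \<notin> K \<Longrightarrow> dzbar \<phi> z = 0"
proof (rule test_function_support[OF assms])
  fix K assume K: "compact K" "K \<subseteq> U" "\<And>z. z \<notin> K \<Longrightarrow> \<phi> z = 0" "\<And>z. z \<notin> K \<Longrightarrow> frechet_derivative \<phi> (at z) = (\<lambda>_. 0)"
  have d: "dx \<phi> z = 0" "dy \<phi> z = 0" if "z \<notin> K" for z using K(4)[OF that] by (simp_all add: dx_def dy_def)
  show thesis by (rule that[OF K(1-3)]) (use d in \<open>simp_all add: dz_def dzbar_def\<close>)
qed

lemma integral_test_function_deriv:
  assumes "test_function U \<phi>"
  shows "(LINT z|lborel. dx \<phi> z) = 0" "(LINT z|lborel. dy \<phi> z) = 0" "(LINT z|lborel. dzbar \<phi> z) = 0"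
    "integrable lborel (dx \<phi>)" "integrable lborel (dy \<phi>)"
proof -
  obtain K where K: "compact K" "\<And>z. z \<notin> K \<Longrightarrow> \<phi> z = 0" using test_function_support[OF assms] by metis
  have D: "(\<phi> has_derivative frechet_derivative \<phi> (at z)) (at z)" for z using test_function_props(5)[OF assms] .
  have c: "continuous_on UNIV (\<lambda>z. frechet_derivative \<phi> (at z) 1)" "continuous_on UNIV (\<lambda>z. frechet_derivative \<phi> (at z) \<i>)"
    using test_function_props(3,4)[OF assms] by (simp_all add: dx_def[abs_def] dy_def[abs_def])
  show x: "(LINT z|lborel. dx \<phi> z) = 0" "(LINT z|lborel. dy \<phi> z) = 0" "integrable lborel (dx \<phi>)" "integrable lborel (dy \<phi>)"
    using integral_directional_derivative_eq_0[OF D c(1) K] integral_directional_derivative_eq_0[OF D c(2) K]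
    by (simp_all add: dx_def[abs_def] dy_def[abs_def])
  then show "(LINT z|lborel. dzbar \<phi> z) = 0" unfolding dzbar_def by simp
qed

text \<open>Integration by parts: a product of two test functions has compact support, so its
  directional derivatives have integral 0.\<close>

lemma borel_weak_deriv_test_function:
  assumes \<phi>: "test_function U \<phi>"
  shows "borel_weak_deriv dx \<phi> (dx \<phi>)" "borel_weak_deriv dy \<phi> (dy \<phi>)"
proof -
  obtain K where K: "compact K" "\<And>z. z \<notin> K \<Longrightarrow> \<phi> z = 0" "\<And>z. z \<notin> K \<Longrightarrow> dx \<phi> z = 0" "\<And>z. z \<notin> K \<Longrightarrow> dy \<phi> z = 0"
    using test_function_deriv_support[OF \<phi>] by metis
  note c = test_function_props(2-4)[OF \<phi>]
  have li: "borel_locint f" if "continuous_on UNIV f" "\<And>z. z \<notin> K \<Longrightarrow> f z = 0" for f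
  proof -
    obtain B where "\<And>z. cmod (f z) \<le> B" using compact_support_bounded[OF \<open>continuous_on UNIV f\<close> K(1) \<open>\<And>z. z \<notin> K \<Longrightarrow> f z = 0\<close>] by blast
    then show ?thesis using borel_measurable_continuous_onI[OF \<open>continuous_on UNIV f\<close>] by (intro borel_locint_if_bounded)
  qed
  have L: "borel_locint \<phi>" "borel_locint (dx \<phi>)" "borel_locint (dy \<phi>)" using li c K by blast+
  have "(LINT z|lborel. \<phi> z * frechet_derivative \<psi> (at z) v) = - (LINT z|lborel. frechet_derivative \<phi> (at z) v * \<psi> z)"
    if \<psi>: "test_function UNIV \<psi>" and v: "continuous_on UNIV (\<lambda>z. frechet_derivative \<phi> (at z) v)" "continuous_on UNIV (\<lambda>z. frechet_derivative \<psi> (at z) v)"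
      and Lv: "borel_locint (\<lambda>z. frechet_derivative \<phi> (at z) v)" for \<psi> v
  proof -
    obtain K' where K': "compact K'" "\<And>z. z \<notin> K' \<Longrightarrow> \<psi> z = 0" "\<And>z. z \<notin> K' \<Longrightarrow> frechet_derivative \<psi> (at z) = (\<lambda>_. 0)"
      using test_function_support[OF \<psi>] by metis
    have "((\<lambda>z. \<phi> z * \<psi> z) has_derivative (\<lambda>v. \<phi> z * frechet_derivative \<psi> (at z) v + frechet_derivative \<phi> (at z) v * \<psi> z)) (at z)" for z
      by (intro has_derivative_mult test_function_props(5)[OF \<phi>] test_function_props(5)[OF \<psi>])
    moreover have "continuous_on UNIV (\<lambda>z. \<phi> z * frechet_derivative \<psi> (at z) v + frechet_derivative \<phi> (at z) v * \<psi> z)"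
      by (intro continuous_intros v c test_function_props(2)[OF \<psi>])
    ultimately have "(LINT z|lborel. \<phi> z * frechet_derivative \<psi> (at z) v + frechet_derivative \<phi> (at z) v * \<psi> z) = 0"
      using K' by (intro integral_directional_derivative_eq_0(2)[where K=K' and \<Phi>="\<lambda>z. \<phi> z * \<psi> z"]) auto
    moreover have "integrable lborel (\<lambda>z. \<phi> z * frechet_derivative \<psi> (at z) v)"
      using K' by (intro borel_locint_mult[OF L(1) v(2) K'(1)]) simp
    moreover have "integrable lborel (\<lambda>z. frechet_derivative \<phi> (at z) v * \<psi> z)"
      by (rule borel_locint_mult[OF Lv test_function_props(2)[OF \<psi>] K'(1,2)])
    ultimately show ?thesis by (simp add: add_eq_0_iff2)
  qed
  then have *: "(LINT z|lborel. \<phi> z * frechet_derivative \<psi> (at z) v) = - (LINT z|lborel. frechet_derivative \<phi> (at z) v * \<psi> z)"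
    if "test_function UNIV \<psi>" "v = 1 \<or> v = \<i>" for \<psi> v
    using that L c test_function_props(3,4)[OF that(1)] unfolding dx_def[abs_def] dy_def[abs_def] by blast
  show "borel_weak_deriv dx \<phi> (dx \<phi>)" "borel_weak_deriv dy \<phi> (dy \<phi>)"
    using L * unfolding borel_weak_deriv_def by (auto simp: dx_def dy_def)
qed

lemma borel_weak_deriv_dz_dzbar:
  assumes x: "borel_weak_deriv dx f g1" and y: "borel_weak_deriv dy f g2"
  shows "borel_weak_deriv dz f (\<lambda>z. (g1 z - \<i> * g2 z) / 2)" "borel_weak_deriv dzbar f (\<lambda>z. (g1 z + \<i> * g2 z) / 2)"
proof -
  have L: "borel_locint f" "borel_locint g1" "borel_locint g2" using x y by (auto simp: borel_weak_deriv_def)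
  have comb: "borel_locint (\<lambda>z. (g1 z + k * g2 z) / 2) \<and> (\<forall>\<phi>. test_function UNIV \<phi> \<longrightarrow>
     (LINT z|lborel. f z * ((dx \<phi> z + k * dy \<phi> z) / 2)) = - (LINT z|lborel. (g1 z + k * g2 z) / 2 * \<phi> z))" for k
  proof (intro conjI allI impI)
    have "borel_locint (\<lambda>z. (1/2) * (g1 z + k * g2 z))" by (intro borel_locint_cmult borel_locint_add L)
    then show "borel_locint (\<lambda>z. (g1 z + k * g2 z) / 2)" by simp
    fix \<phi> assume \<phi>: "test_function UNIV \<phi>"
    obtain K where K: "compact K" "\<And>z. z \<notin> K \<Longrightarrow> \<phi> z = 0" "\<And>z. z \<notin> K \<Longrightarrow> dx \<phi> z = 0" "\<And>z. z \<notin> K \<Longrightarrow> dy \<phi> z = 0"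
      using test_function_deriv_support[OF \<phi>] by metis
    note c = test_function_props(2-4)[OF \<phi>]
    have i: "integrable lborel (\<lambda>z. f z * dx \<phi> z)" "integrable lborel (\<lambda>z. f z * dy \<phi> z)"
      "integrable lborel (\<lambda>z. g1 z * \<phi> z)" "integrable lborel (\<lambda>z. g2 z * \<phi> z)"
      using borel_locint_mult[OF L(1) c(2) K(1,3)] borel_locint_mult[OF L(1) c(3) K(1,4)]
        borel_locint_mult[OF L(2) c(1) K(1,2)] borel_locint_mult[OF L(3) c(1) K(1,2)] by auto
    have "(LINT z|lborel. f z * ((dx \<phi> z + k * dy \<phi> z) / 2)) = (LINT z|lborel. (1/2) * (f z * dx \<phi> z) + (k/2) * (f z * dy \<phi> z))"
      by (intro Bochner_Integration.integral_cong refl) (simp add: field_simps)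
    also have "\<dots> = (1/2) * (LINT z|lborel. f z * dx \<phi> z) + (k/2) * (LINT z|lborel. f z * dy \<phi> z)"
      using i by (subst Bochner_Integration.integral_add) auto
    also have "\<dots> = - ((1/2) * (LINT z|lborel. g1 z * \<phi> z) + (k/2) * (LINT z|lborel. g2 z * \<phi> z))"
      using x y \<phi> by (simp add: borel_weak_deriv_def)
    also have "\<dots> = - (LINT z|lborel. (1/2) * (g1 z * \<phi> z) + (k/2) * (g2 z * \<phi> z))"
      using i by (subst Bochner_Integration.integral_add) auto
    also have "\<dots> = - (LINT z|lborel. (g1 z + k * g2 z) / 2 * \<phi> z)"
      by (intro arg_cong[where f=uminus] Bochner_Integration.integral_cong refl) (simp add: field_simps)
    finally show "(LINT z|lborel. f z * ((dx \<phi> z + k * dy \<phi> z) / 2)) = - (LINT z|lborel. (g1 z + k * g2 z) / 2 * \<phi> z)" .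
  qed
  show "borel_weak_deriv dz f (\<lambda>z. (g1 z - \<i> * g2 z) / 2)"
    using comb[of "- \<i>"] L unfolding borel_weak_deriv_def dz_def by simp
  show "borel_weak_deriv dzbar f (\<lambda>z. (g1 z + \<i> * g2 z) / 2)"
    using comb[of \<i>] L unfolding borel_weak_deriv_def dzbar_def by simp
qed

text \<open>The Cauchy-Pompeiu formula, as an instance of the representation of L^q functions: a
  bounded function of compact support is in L^2, and its classical derivative is a weak one.\<close>

lemma test_function_eq_cauchy:
  assumes \<phi>: "test_function U \<phi>"
  shows "AE z in lborel. \<phi> z = cauchy (dzbar \<phi>) z" "integrable lborel (dzbar \<phi>)"
proof -
  obtain K where K: "compact K" "\<And>z. z \<notin> K \<Longrightarrow> \<phi> z = 0" "\<And>z. z \<notin> K \<Longrightarrow> dzbar \<phi> z = 0"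
    using test_function_deriv_support[OF \<phi>] by metis
  have c: "continuous_on UNIV \<phi>" "continuous_on UNIV (dzbar \<phi>)"
    using test_function_props(2)[OF \<phi>] test_function_dz_props(2)[OF \<phi>] .
  have [measurable]: "\<phi> \<in> borel_measurable borel" "dzbar \<phi> \<in> borel_measurable borel" using c borel_measurable_continuous_onI by auto
  obtain B where B: "0 \<le> B" "\<And>z. cmod (dzbar \<phi> z) \<le> B" using compact_support_bounded[OF c(2) K(1,3)] by blast
  obtain B' where B': "0 \<le> B'" "\<And>z. cmod (\<phi> z) \<le> B'" using compact_support_bounded[OF c(1) K(1,2)] by blast
  obtain r where r: "K \<subseteq> ball 0 r" using K(1) compact_imp_bounded bounded_subset_ballD by blast
  obtain k where k: "\<And>g A. g \<in> borel_measurable borel \<Longrightarrow> 0 \<le> A \<Longrightarrow> (\<And>w. cmod (g w) \<le> A * indicator (ball 0 r) w) \<Longrightarrow> admissible g (A * k)"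
    using bounded_admissible[of 0 r] by metis
  have "cmod (dzbar \<phi> w) \<le> B * indicator (ball 0 r) w" for w
    using B K(3)[of w] r by (cases "w \<in> K") (auto simp: indicator_def)
  then have adm: "admissible (dzbar \<phi>) (B * k)" by (intro k B) auto
  show "AE z in lborel. \<phi> z = cauchy (dzbar \<phi>) z"
  proof (rule cauchy_representation[OF _ _ _ adm, where q=2])
    show "integrable lborel (\<lambda>z. cmod (\<phi> z) powr 2)"
    proof (rule Bochner_Integration.integrable_bound[OF integrable_mult_right[OF integrable_norm[OF integrable_compact_support[OF c(1) K(1,2)]], of B']])
      show "AE z in lborel. norm (cmod (\<phi> z) powr 2) \<le> norm (B' * cmod (\<phi> z))"
        using B' by (intro AE_I2) (simp add: power2_eq_square abs_mult mult_right_mono)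
    qed measurable
    fix \<psi> assume "test_function UNIV \<psi>"
    then show "(LINT z|lborel. \<phi> z * dzbar \<psi> z) = - (LINT z|lborel. dzbar \<phi> z * \<psi> z)"
      using borel_weak_deriv_dz_dzbar(2)[OF borel_weak_deriv_test_function[OF \<phi>]] by (simp add: borel_weak_deriv_def dzbar_def)
  qed auto
  show "integrable lborel (dzbar \<phi>)" by (rule integrable_compact_support[OF c(2) K(1,3)])
qed

text \<open>Duality moves C onto \<partial>-bar \<phi>, and the Cauchy-Pompeiu formula returns
  \<phi>.\<close>

lemma borel_weak_deriv_cauchy:
  assumes g: "admissible g N" and L: "borel_locint g"
  shows "borel_weak_deriv dzbar (cauchy g) g"
proof -
  have [measurable]: "g \<in> borel_measurable borel" using g by (rule admissible_measurable)
  have "borel_locint (cauchy g)" by (rule borel_locint_if_bounded[OF _ cauchy_bound[OF g]]) measurable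
  moreover have "(LINT z|lborel. cauchy g z * dzbar \<phi> z) = - (LINT z|lborel. g z * \<phi> z)" if \<phi>: "test_function UNIV \<phi>" for \<phi>
  proof -
    note t = test_function_eq_cauchy[OF \<phi>]
    have [measurable]: "\<phi> \<in> borel_measurable borel" "dzbar \<phi> \<in> borel_measurable borel"
      using test_function_props(2)[OF \<phi>] test_function_dz_props(2)[OF \<phi>] borel_measurable_continuous_onI by auto
    have "(LINT z|lborel. g z * cauchy (dzbar \<phi>) z) = (LINT z|lborel. g z * \<phi> z)"
      by (rule integral_cong_AE) (use t(1) in auto)
    then show ?thesis using cauchy_duality[OF g t(2)] by simp
  qed
  ultimately show ?thesis using L by (simp add: borel_weak_deriv_def)
qed

text \<open>The open set U serves two uses: uniqueness on the plane, and the exterior of a ball,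
  where the derivative of the admittivity is compared with 0.\<close>

lemma borel_weak_deriv_unique_on:
  assumes "open U" "borel_weak_deriv P f g" "borel_weak_deriv P f' g'"
    and eq: "\<And>\<phi>. test_function U \<phi> \<Longrightarrow> (LINT z|lborel. f z * P \<phi> z) = (LINT z|lborel. f' z * P \<phi> z)"
  shows "AE z in lborel. z \<in> U \<longrightarrow> g z = g' z"
proof -
  have L: "borel_locint g" "borel_locint g'" using assms by (auto simp: borel_weak_deriv_def)
  have [measurable]: "g \<in> borel_measurable borel" "g' \<in> borel_measurable borel" using L borel_locintD by auto
  have "AE z in lborel. z \<in> U \<longrightarrow> g z - g' z = 0"
  proof (rule AE_eq_0_if_test_function[OF \<open>open U\<close>])
    show "set_integrable lborel K (\<lambda>z. g z - g' z)" if "compact K" for K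
      by (intro set_integral_diff borel_locint_set_integrable L that)
    fix \<phi> assume \<phi>: "test_function U \<phi>"
    then have \<phi>': "test_function UNIV \<phi>" by (simp add: test_function_def)
    obtain K where K: "compact K" "\<And>z. z \<notin> K \<Longrightarrow> \<phi> z = 0" using test_function_support[OF \<phi>] by metis
    note c = test_function_props(2)[OF \<phi>]
    have "(LINT z|lborel. g z * \<phi> z) = (LINT z|lborel. g' z * \<phi> z)"
      using assms(2,3) eq[OF \<phi>] \<phi>' by (simp add: borel_weak_deriv_def)
    then show "(LINT z|lborel. (g z - g' z) * \<phi> z) = 0"
      using borel_locint_mult[OF L(1) c K] borel_locint_mult[OF L(2) c K] by (simp add: left_diff_distrib)
  qed measurable
  then show ?thesis by eventually_elim simp
qed

lemma borel_weak_deriv_unique: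
  assumes "borel_weak_deriv P f g" "borel_weak_deriv P f g'"
  shows "AE z in lborel. g z = g' z"
  using borel_weak_deriv_unique_on[OF open_UNIV assms] by simp

section \<open>Logarithms and weak derivatives\<close>

lemma loc_integrable_measurable:
  assumes "loc_integrable UNIV F"
  shows "F \<in> borel_measurable lebesgue"
proof (rule borel_measurable_LIMSEQ_metric)
  fix n :: nat
  have "F absolutely_integrable_on (cball 0 (real n))" using assms by (simp add: loc_integrable_def)
  then show "(\<lambda>z. indicator (cball 0 (real n)) z *\<^sub>R F z) \<in> borel_measurable lebesgue"
    unfolding set_integrable_def by (rule borel_measurable_integrable)
next
  fix z
  obtain N where N: "cmod z \<le> real N" using real_arch_simple by blast
  have "\<forall>\<^sub>F n in sequentially. indicator (cball 0 (real n)) z *\<^sub>R F z = F z"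
    using eventually_ge_at_top[of N] by eventually_elim (use N in \<open>auto simp: indicator_def\<close>)
  then show "(\<lambda>n. indicator (cball 0 (real n)) z *\<^sub>R F z) \<longlonglongrightarrow> F z"
    by (rule tendsto_eventually)
qed

lemma borel_representative:
  fixes F :: "complex \<Rightarrow> complex"
  assumes "F \<in> borel_measurable lebesgue"
  obtains f where "f \<in> borel_measurable borel" "AE z in lborel. F z = f z"
proof -
  have "(\<lambda>z. Re (F z)) \<in> borel_measurable lebesgue" "(\<lambda>z. Im (F z)) \<in> borel_measurable lebesgue"
    by (rule measurable_compose[OF assms]; measurable)+
  then obtain r i where ri: "r \<in> borel_measurable lborel" "AE z in lborel. Re (F z) = r z"
    "i \<in> borel_measurable lborel" "AE z in lborel. Im (F z) = i z"
    using completion_ex_borel_measurable_real by metis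
  then have [measurable]: "r \<in> borel_measurable borel" "i \<in> borel_measurable borel" by simp_all
  show ?thesis
  proof (rule that)
    show "(\<lambda>z. of_real (r z) + \<i> * of_real (i z)) \<in> borel_measurable borel" by measurable
    show "AE z in lborel. F z = of_real (r z) + \<i> * of_real (i z)"
      using ri(2,4) by eventually_elim (simp add: complex_eq_iff)
  qed
qed

lemma borel_imp_lebesgue: "f \<in> borel_measurable borel \<Longrightarrow> f \<in> borel_measurable lebesgue"
  by (rule measurable_completion) simp

lemma AE_eq_measurable_lebesgue:
  fixes f F :: "complex \<Rightarrow> complex"
  assumes "f \<in> borel_measurable borel" "AE z in lborel. F z = f z"
  shows "F \<in> borel_measurable lebesgue"
proof (rule borel_measurable_AE[OF borel_imp_lebesgue[OF assms(1)]])
  have "AE z in lborel. f z = F z" using assms(2) by eventually_elim simp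
  then show "AE z in lebesgue. f z = F z" by (rule AE_completion)
qed

lemma loc_integrable_iff_borel:
  assumes f[measurable]: "f \<in> borel_measurable borel" and eq: "AE z in lborel. F z = f z"
  shows "loc_integrable UNIV F \<longleftrightarrow> borel_locint f"
proof -
  have F: "F \<in> borel_measurable lebesgue" by (rule AE_eq_measurable_lebesgue[OF assms])
  have fl: "f \<in> borel_measurable lebesgue" by (rule borel_imp_lebesgue[OF f])
  have si: "set_integrable lebesgue K F \<longleftrightarrow> set_integrable lborel K f" if K: "K \<in> sets borel" for K
  proof -
    have [measurable]: "K \<in> sets borel" "K \<in> sets lebesgue" using K by auto
    have "integrable lebesgue (\<lambda>z. indicator K z *\<^sub>R F z) \<longleftrightarrow> integrable lebesgue (\<lambda>z. indicator K z *\<^sub>R f z)"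
    proof (rule integrable_cong_AE)
      show "AE z in lebesgue. indicator K z *\<^sub>R F z = indicator K z *\<^sub>R f z"
        using AE_completion[OF eq] by eventually_elim simp
    qed (use F fl in measurable)
    also have "\<dots> \<longleftrightarrow> integrable lborel (\<lambda>z. indicator K z *\<^sub>R f z)"
      by (rule integrable_completion) measurable
    finally show ?thesis by (simp add: set_integrable_def)
  qed
  have ind: "(\<lambda>z. f z * of_real (indicator (ball 0 r) z)) = (\<lambda>z. indicator (ball 0 r) z *\<^sub>R f z)" for r
    by (auto simp: fun_eq_iff indicator_def)
  show ?thesis
  proof
    assume L: "loc_integrable UNIV F"
    have "set_integrable lborel (ball 0 r) f" for r
    proof -
      have "set_integrable lebesgue (cball 0 r) F" using L by (simp add: loc_integrable_def)
      then have "set_integrable lborel (cball 0 r) f" using si[of "cball 0 r"] by simp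
      then show ?thesis by (rule set_integrable_subset) auto
    qed
    then show "borel_locint f" using f by (simp add: borel_locint_def ind set_integrable_def)
  next
    assume L: "borel_locint f"
    show "loc_integrable UNIV F"
      unfolding loc_integrable_def
    proof (intro allI impI, elim conjE)
      fix K :: "complex set" assume K: "compact K"
      have "K \<in> sets borel" by (rule borel_closed[OF compact_imp_closed[OF K]])
      then show "F absolutely_integrable_on K" using si borel_locint_set_integrable[OF L K] by simp
    qed
  qed
qed

lemma lebesgue_integral_eq_borel:
  fixes f \<psi> F :: "complex \<Rightarrow> complex"
  assumes f: "f \<in> borel_measurable borel" and \<psi>: "\<psi> \<in> borel_measurable borel" and eq: "AE z in lborel. F z = f z"
  shows "(LINT z:UNIV|lebesgue. F z * \<psi> z) = (LINT z|lborel. f z * \<psi> z)"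
proof -
  have "(LINT z:UNIV|lebesgue. F z * \<psi> z) = (LINT z|lebesgue. F z * \<psi> z)" by (simp add: set_lebesgue_integral_def)
  also have "\<dots> = (LINT z|lebesgue. f z * \<psi> z)"
  proof (rule integral_cong_AE)
    show "AE z in lebesgue. F z * \<psi> z = f z * \<psi> z"
      using AE_completion[OF eq] by eventually_elim simp
  qed (intro borel_measurable_times AE_eq_measurable_lebesgue[OF f eq] borel_imp_lebesgue f \<psi>)+
  also have "\<dots> = (LINT z|lborel. f z * \<psi> z)"
    using f \<psi> by (intro integral_completion) simp
  finally show ?thesis .
qed

text \<open>Every condition is an integral and thus blind to null sets; continuity makes the
  derivatives of test functions Borel measurable.\<close>

lemma has_weak_deriv_iff_borel:
  assumes P: "\<And>\<phi>. test_function UNIV \<phi> \<Longrightarrow> continuous_on UNIV (P \<phi>)"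
    and f: "f \<in> borel_measurable borel" "AE z in lborel. F z = f z"
    and g: "g \<in> borel_measurable borel" "AE z in lborel. G z = g z"
  shows "has_weak_deriv P UNIV F G \<longleftrightarrow> borel_weak_deriv P f g"
proof -
  have "(LINT z:UNIV|lebesgue. F z * P \<phi> z) = (LINT z|lborel. f z * P \<phi> z)"
    "(LINT z:UNIV|lebesgue. G z * \<phi> z) = (LINT z|lborel. g z * \<phi> z)" if "test_function UNIV \<phi>" for \<phi>
    using lebesgue_integral_eq_borel[OF f(1) borel_measurable_continuous_onI[OF P[OF that]] f(2)]
      lebesgue_integral_eq_borel[OF g(1) borel_measurable_continuous_onI[OF test_function_props(2)[OF that]] g(2)] by auto
  then show ?thesis
    unfolding has_weak_deriv_def borel_weak_deriv_def loc_integrable_iff_borel[OF f] loc_integrable_iff_borel[OF g] by auto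
qed

lemma has_weak_deriv_borelE:
  assumes P: "\<And>\<phi>. test_function UNIV \<phi> \<Longrightarrow> continuous_on UNIV (P \<phi>)" and w: "has_weak_deriv P UNIV F G"
    and f: "f \<in> borel_measurable borel" "AE z in lborel. F z = f z"
  obtains g where "borel_weak_deriv P f g" "AE z in lborel. G z = g z"
proof -
  obtain g where g: "g \<in> borel_measurable borel" "AE z in lborel. G z = g z"
    using borel_representative[OF loc_integrable_measurable[of G]] w by (auto simp: has_weak_deriv_def)
  then show ?thesis using that has_weak_deriv_iff_borel[of P, OF P f g] w by blast
qed

text \<open>\<open>weak_deriv\<close> is an arbitrary choice, but by uniqueness any explicit Borel
  derivative computes it almost everywhere.\<close>

lemma weak_deriv_AE_eq:
  assumes P: "\<And>\<phi>. test_function UNIV \<phi> \<Longrightarrow> continuous_on UNIV (P \<phi>)"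
    and f: "AE z in lborel. F z = f z" and w: "borel_weak_deriv P f g"
  shows "weakly_diff P UNIV F" "AE z in lborel. weak_deriv P UNIV F z = g z"
proof -
  have m: "f \<in> borel_measurable borel" "g \<in> borel_measurable borel" using w by (auto simp: borel_weak_deriv_def borel_locint_def)
  have "has_weak_deriv P UNIV F g"
    using has_weak_deriv_iff_borel[of P, OF P m(1) f m(2)] w by simp
  then show wd: "weakly_diff P UNIV F" by (auto simp: weakly_diff_def)
  then have "has_weak_deriv P UNIV F (weak_deriv P UNIV F)"
    unfolding weakly_diff_def weak_deriv_def by (rule someI_ex)
  then obtain g' where g': "borel_weak_deriv P f g'" "AE z in lborel. weak_deriv P UNIV F z = g' z"
    using has_weak_deriv_borelE[of P, OF P _ m(1) f] by metis
  from borel_weak_deriv_unique[OF g'(1) w] g'(2)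
  show "AE z in lborel. weak_deriv P UNIV F z = g z" by eventually_elim simp
qed

lemma test_function_cnj:
  assumes "test_function U \<phi>"
  shows "test_function U (\<lambda>z. cnj (\<phi> z))" "dzbar (\<lambda>z. cnj (\<phi> z)) z = cnj (dz \<phi> z)" "dz (\<lambda>z. cnj (\<phi> z)) z = cnj (dzbar \<phi> z)"
    "dx (\<lambda>z. cnj (\<phi> z)) z = cnj (dx \<phi> z)" "dy (\<lambda>z. cnj (\<phi> z)) z = cnj (dy \<phi> z)"
proof -
  show "test_function U (\<lambda>z. cnj (\<phi> z))" using assms smooth_cnj by (simp add: test_function_def)
  have "((\<lambda>z. cnj (\<phi> z)) has_derivative (\<lambda>v. cnj (frechet_derivative \<phi> (at z) v))) (at z)" for z
    by (rule bounded_linear.has_derivative[OF bounded_linear_cnj test_function_props(5)[OF assms]])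
  from frechet_derivative_at[OF this]
  have D: "frechet_derivative (\<lambda>z. cnj (\<phi> z)) (at z) = (\<lambda>v. cnj (frechet_derivative \<phi> (at z) v))" for z
    by simp
  then show d: "dx (\<lambda>z. cnj (\<phi> z)) z = cnj (dx \<phi> z)" "dy (\<lambda>z. cnj (\<phi> z)) z = cnj (dy \<phi> z)" for z
    by (simp_all add: dx_def dy_def)
  show "dzbar (\<lambda>z. cnj (\<phi> z)) z = cnj (dz \<phi> z)" "dz (\<lambda>z. cnj (\<phi> z)) z = cnj (dzbar \<phi> z)"
    by (simp_all add: dz_def dzbar_def d)
qed

text \<open>Conjugation of test functions exchanges \<open>dz\<close> and \<open>dzbar\<close> and
  preserves \<open>dx\<close> and \<open>dy\<close>. The first case transfers equations for
  \<partial>, the second shows that derivatives of real functions are real.\<close>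

lemma borel_weak_deriv_cnj:
  assumes w: "borel_weak_deriv P f g"
    and P: "\<And>\<phi> z. test_function UNIV \<phi> \<Longrightarrow> P (\<lambda>z. cnj (\<phi> z)) z = cnj (P' \<phi> z)"
  shows "borel_weak_deriv P' (\<lambda>z. cnj (f z)) (\<lambda>z. cnj (g z))"
proof -
  have "(LINT z|lborel. cnj (f z) * P' \<phi> z) = - (LINT z|lborel. cnj (g z) * \<phi> z)" if \<phi>: "test_function UNIV \<phi>" for \<phi>
  proof -
    have "(LINT z|lborel. cnj (f z) * P' \<phi> z) = (LINT z|lborel. cnj (f z * P (\<lambda>z. cnj (\<phi> z)) z))"
      by (simp add: P[OF \<phi>])
    also have "\<dots> = cnj (LINT z|lborel. f z * P (\<lambda>z. cnj (\<phi> z)) z)" by (rule Bochner_Integration.integral_cnj)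
    also have "\<dots> = cnj (- (LINT z|lborel. g z * cnj (\<phi> z)))"
      using w test_function_cnj(1)[OF \<phi>] by (simp add: borel_weak_deriv_def)
    also have "\<dots> = - cnj (LINT z|lborel. g z * cnj (\<phi> z))" by simp
    also have "cnj (LINT z|lborel. g z * cnj (\<phi> z)) = (LINT z|lborel. cnj (g z * cnj (\<phi> z)))" by (rule Bochner_Integration.integral_cnj[symmetric])
    finally show ?thesis by simp
  qed
  then show ?thesis using w borel_locint_cnj by (auto simp: borel_weak_deriv_def)
qed

lemma test_function_ops:
  assumes \<phi>: "test_function U \<phi>" and P: "P \<in> {dx, dy, dz, dzbar}"
  shows "continuous_on UNIV (P \<phi>)" "\<exists>K. compact K \<and> (\<forall>z. z \<notin> K \<longrightarrow> \<phi> z = 0 \<and> P \<phi> z = 0)"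
proof -
  show "continuous_on UNIV (P \<phi>)"
    using P test_function_props(3,4)[OF \<phi>] test_function_dz_props[OF \<phi>] by auto
  show "\<exists>K. compact K \<and> (\<forall>z. z \<notin> K \<longrightarrow> \<phi> z = 0 \<and> P \<phi> z = 0)"
  proof (rule test_function_deriv_support[OF \<phi>])
    fix K assume K: "compact K" "\<And>z. z \<notin> K \<Longrightarrow> \<phi> z = 0" "\<And>z. z \<notin> K \<Longrightarrow> dx \<phi> z = 0"
      "\<And>z. z \<notin> K \<Longrightarrow> dy \<phi> z = 0" "\<And>z. z \<notin> K \<Longrightarrow> dz \<phi> z = 0" "\<And>z. z \<notin> K \<Longrightarrow> dzbar \<phi> z = 0"
    have "P = dx \<or> P = dy \<or> P = dz \<or> P = dzbar" using P by blast
    then show ?thesis using K by (intro exI[of _ K]) (elim disjE; simp)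
  qed
qed

lemma borel_weak_deriv_add:
  assumes f: "borel_weak_deriv P f g" and f': "borel_weak_deriv P f' g'" and P: "P \<in> {dx, dy, dz, dzbar}"
  shows "borel_weak_deriv P (\<lambda>z. f z + k * f' z) (\<lambda>z. g z + k * g' z)"
proof -
  have L: "borel_locint f" "borel_locint f'" "borel_locint g" "borel_locint g'" using assms by (auto simp: borel_weak_deriv_def)
  have "(LINT z|lborel. (f z + k * f' z) * P \<phi> z) = - (LINT z|lborel. (g z + k * g' z) * \<phi> z)" if \<phi>: "test_function UNIV \<phi>" for \<phi>
  proof -
    obtain K where K: "compact K" "\<And>z. z \<notin> K \<Longrightarrow> \<phi> z = 0" "\<And>z. z \<notin> K \<Longrightarrow> P \<phi> z = 0"
      using test_function_ops(2)[OF \<phi> P] by blast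
    note c = test_function_props(2)[OF \<phi>] and cP = test_function_ops(1)[OF \<phi> P]
    note i = borel_locint_mult[OF L(1) cP K(1,3)] borel_locint_mult[OF L(2) cP K(1,3)]
      borel_locint_mult[OF L(3) c K(1,2)] borel_locint_mult[OF L(4) c K(1,2)]
    have "(LINT z|lborel. (f z + k * f' z) * P \<phi> z) = (LINT z|lborel. f z * P \<phi> z) + k * (LINT z|lborel. f' z * P \<phi> z)"
      using i by (simp add: distrib_right mult.assoc)
    also have "\<dots> = - ((LINT z|lborel. g z * \<phi> z) + k * (LINT z|lborel. g' z * \<phi> z))"
      using f f' \<phi> by (simp add: borel_weak_deriv_def)
    also have "\<dots> = - (LINT z|lborel. (g z + k * g' z) * \<phi> z)"
      using i by (simp add: distrib_right mult.assoc)
    finally show ?thesis .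
  qed
  then show ?thesis using L by (auto simp: borel_weak_deriv_def intro!: borel_locint_add borel_locint_cmult)
qed

lemma borel_locint_times_bounded:
  assumes g: "borel_locint g" and [measurable]: "b \<in> borel_measurable borel" and B: "\<And>z. cmod (b z) \<le> B"
  shows "borel_locint (\<lambda>z. g z * b z)"
proof -
  have [measurable]: "g \<in> borel_measurable borel" using g by (rule borel_locintD)
  have "integrable lborel (\<lambda>z. g z * b z * of_real (indicator (ball 0 r) z))" for r
  proof (rule Bochner_Integration.integrable_bound[OF integrable_mult_right[OF borel_locintD(2)[OF g, of r], of "of_real B"]])
    show "(\<lambda>z. g z * b z * of_real (indicator (ball 0 r) z)) \<in> borel_measurable lborel" by measurable
    show "AE z in lborel. norm (g z * b z * of_real (indicator (ball 0 r) z)) \<le> norm (of_real B * (g z * of_real (indicator (ball 0 r) z)))"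
    proof (rule AE_I2)
      fix z
      have "cmod (b z) \<le> \<bar>B\<bar>" using B[of z] by linarith
      then show "norm (g z * b z * of_real (indicator (ball 0 r) z)) \<le> norm (of_real B * (g z * of_real (indicator (ball 0 r) z)))"
        by (simp add: norm_mult indicator_def mult.commute mult_right_mono)
    qed
  qed
  then show ?thesis by (simp add: borel_locint_def)
qed

text \<open>The branch of the logarithm is fixed by the homotopy \<open>1 + t g\<close>, \<open>0 \<le> t \<le> 1\<close>, along
  which the real part stays positive.\<close>

lemma Ln_one_plus_cauchy:
  assumes g: "admissible g N" and L: "borel_locint g"
    and s: "0 < s" "AE z in lborel. s \<le> Re (1 + cauchy g z)"
  obtains \<alpha> M where "admissible \<alpha> M" "borel_locint \<alpha>" "AE z in lborel. \<alpha> z = g z / (1 + cauchy g z)"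
    "AE z in lborel. Ln (1 + cauchy g z) = cauchy \<alpha> z"
proof -
  have [measurable]: "g \<in> borel_measurable borel" using g by (rule admissible_measurable)
  \<comment> \<open>A lower bound along the whole homotopy: the real part of 1 + t C g is a convex
    combination of 1 and a number that is at least s.\<close>
  define s' where "s' = min 1 s"
  have s': "0 < s'" "s' \<le> 1" "s' \<le> s" using s by (auto simp: s'_def)
  \<comment> \<open>g times this factor is the logarithmic \<partial>-bar derivative of 1 + t C g.
    The value 0 on the exceptional null set makes the factor bounded at every point, as
    \<open>admissible_times\<close> demands.\<close>
  define b where "b t w = (if s \<le> Re (1 + cauchy g w) then of_real t / (1 + of_real t * cauchy g w) else 0)" for t :: real and w
  have re: "s' \<le> Re (1 + of_real t * cauchy g w)" if "s \<le> Re (1 + cauchy g w)" "0 \<le> t" "t \<le> 1" for t w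
  proof -
    have "Re (1 + of_real t * cauchy g w) = (1 - t) * 1 + t * Re (1 + cauchy g w)" by (simp add: algebra_simps)
    moreover have "(1 - t) * 1 \<ge> (1 - t) * s'" using that s' by (intro mult_left_mono) auto
    moreover have "t * Re (1 + cauchy g w) \<ge> t * s'" using that s' by (intro mult_left_mono) auto
    ultimately show ?thesis by (simp add: algebra_simps)
  qed
  have b_meas[measurable]: "b t \<in> borel_measurable borel" for t unfolding b_def[abs_def] by measurable
  have b_le: "cmod (b t w) \<le> 1 / s'" if "0 \<le> t" "t \<le> 1" for t w
  proof (cases "s \<le> Re (1 + cauchy g w)")
    case True
    have "s' \<le> cmod (1 + of_real t * cauchy g w)" using re[OF True that] complex_Re_le_cmod order_trans by blast
    then have "t / cmod (1 + of_real t * cauchy g w) \<le> 1 / s'" using that s' by (intro frac_le) auto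
    then show ?thesis using True that by (simp add: b_def norm_divide)
  qed (use s' in \<open>simp add: b_def\<close>)
  have adm: "admissible (\<lambda>w. g w * b t w) (1 / s' * N)" if "0 \<le> t" "t \<le> 1" for t
    by (intro admissible_times(1)[OF g] b_le that) simp
  \<comment> \<open>The density cancels the correction in \<open>cauchy_similarity\<close> almost
    everywhere under the integral; the resulting identity holds at every z, including points outside
    the control on the real part.\<close>
  have exp_eq: "exp (cauchy (\<lambda>w. g w * b t w) z) = 1 + of_real t * cauchy g z" if t: "0 \<le> t" "t \<le> 1" for t z
  proof -
    have gt: "admissible (\<lambda>w. of_real t * g w) (\<bar>t\<bar> * N)" by (rule admissible_times(2)[OF g]) auto
    have f: "1 + of_real t * cauchy g w = 1 + cauchy (\<lambda>w. of_real t * g w) w" for w by (simp add: cauchy_cmult)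
    have "(1 + of_real t * cauchy g z) * exp (- cauchy (\<lambda>w. g w * b t w) z)
      = 1 + cauchy (\<lambda>w. (of_real t * g w - g w * b t w * (1 + of_real t * cauchy g w)) * exp (- cauchy (\<lambda>w. g w * b t w) w)) z"
      by (rule cauchy_similarity[OF adm[OF t] gt f])
    also have "cauchy (\<lambda>w. (of_real t * g w - g w * b t w * (1 + of_real t * cauchy g w)) * exp (- cauchy (\<lambda>w. g w * b t w) w)) z
      = cauchy (\<lambda>w. 0) z"
    proof (rule cauchy_cong_AE)
      show "AE w in lborel. (of_real t * g w - g w * b t w * (1 + of_real t * cauchy g w)) * exp (- cauchy (\<lambda>w. g w * b t w) w) = 0"
        using s(2)
      proof eventually_elim
        fix w assume w: "s \<le> Re (1 + cauchy g w)"
        have "1 + of_real t * cauchy g w \<noteq> 0" using re[OF w t] s' by (metis not_less zero_complex.sel(1))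
        then show "(of_real t * g w - g w * b t w * (1 + of_real t * cauchy g w)) * exp (- cauchy (\<lambda>w. g w * b t w) w) = 0"
          using w by (simp add: b_def)
      qed
    qed measurable
    also have "cauchy (\<lambda>w. 0) z = 0" by (simp add: cauchy_def)
    finally have e1: "(1 + of_real t * cauchy g z) * exp (- cauchy (\<lambda>w. g w * b t w) z) = 1" by simp
    have "exp (cauchy (\<lambda>w. g w * b t w) z) = ((1 + of_real t * cauchy g z) * exp (- cauchy (\<lambda>w. g w * b t w) z)) * exp (cauchy (\<lambda>w. g w * b t w) z)"
      unfolding e1 by simp
    also have "\<dots> = 1 + of_real t * cauchy g z" by (simp only: mult.assoc exp_add[symmetric]) simp
    finally show ?thesis .
  qed
  have cont: "continuous_on {0..1} (\<lambda>t. cauchy (\<lambda>w. g w * b t w) z)" for z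
    unfolding continuous_on_sequentially
  proof (intro allI ballI impI)
    fix x :: "nat \<Rightarrow> real" and t assume t: "t \<in> {0..1}" and x: "(\<forall>n. x n \<in> {0..1}) \<and> x \<longlonglongrightarrow> t"
    have "(\<lambda>n. LINT w|lborel. g w * b (x n) w / (z - w)) \<longlonglongrightarrow> (LINT w|lborel. g w * b t w / (z - w))"
    proof (rule integral_dominated_convergence[OF _ _ integrable_mult_right[OF integrable_norm[OF admissible_integrable(1)[OF g, of z]], of "1 / s'"]])
      show "AE w in lborel. (\<lambda>n. g w * b (x n) w / (z - w)) \<longlonglongrightarrow> g w * b t w / (z - w)"
      proof (rule AE_I2)
        fix w
        have "(\<lambda>n. b (x n) w) \<longlonglongrightarrow> b t w"
        proof (cases "s \<le> Re (1 + cauchy g w)")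
          case True
          have "1 + of_real t * cauchy g w \<noteq> 0" using re[OF True, of t] t s' by (metis atLeastAtMost_iff not_less zero_complex.sel(1))
          then show ?thesis using True x unfolding b_def by (auto intro!: tendsto_intros)
        qed (simp add: b_def)
        then show "(\<lambda>n. g w * b (x n) w / (z - w)) \<longlonglongrightarrow> g w * b t w / (z - w)"
          unfolding divide_inverse by (intro tendsto_intros)
      qed
      show "AE w in lborel. norm (g w * b (x n) w / (z - w)) \<le> 1 / s' * norm (g w / (z - w))" for n
      proof (rule AE_I2)
        fix w
        have "cmod (b (x n) w) \<le> 1 / s'" using b_le x by auto
        from mult_right_mono[OF this, of "norm (g w / (z - w))"]
        show "norm (g w * b (x n) w / (z - w)) \<le> 1 / s' * norm (g w / (z - w))" by (simp add: norm_mult norm_divide mult_ac)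
      qed
    qed measurable
    then show "((\<lambda>t. cauchy (\<lambda>w. g w * b t w) z) \<circ> x) \<longlonglongrightarrow> cauchy (\<lambda>w. g w * b t w) z"
      unfolding cauchy_def o_def divide_inverse by (intro tendsto_intros)
  qed
  show ?thesis
  proof (rule that)
    show "admissible (\<lambda>w. g w * b 1 w) (1 / s' * N)" by (rule adm) auto
    show "borel_locint (\<lambda>w. g w * b 1 w)" by (rule borel_locint_times_bounded[OF L b_meas b_le]) auto
    show "AE z in lborel. g z * b 1 z = g z / (1 + cauchy g z)"
      using s(2) by eventually_elim (simp add: b_def)
    show "AE z in lborel. Ln (1 + cauchy g z) = cauchy (\<lambda>w. g w * b 1 w) z"
      using s(2)
    proof eventually_elim
      fix z assume z: "s \<le> Re (1 + cauchy g z)"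
      let ?L = "\<lambda>t. cauchy (\<lambda>w. g w * b t w) z"
      \<comment> \<open>At t = 0 the imaginary part is 0. If its modulus reached pi/2 along the way,
        the exponential would be purely imaginary there, against the positive real part.\<close>
      have "\<bar>Im (?L 1)\<bar> < pi / 2"
      proof (rule ccontr)
        assume "\<not> \<bar>Im (?L 1)\<bar> < pi / 2"
        moreover have "b 0 = (\<lambda>w. 0)" by (simp add: b_def fun_eq_iff)
        then have "?L 0 = 0" by (simp add: cauchy_def)
        moreover have "continuous_on {0..1} (\<lambda>t. \<bar>Im (?L t)\<bar>)" by (intro continuous_intros cont)
        ultimately obtain t where t: "0 \<le> t" "t \<le> 1" "\<bar>Im (?L t)\<bar> = pi / 2"
          using IVT'[of "\<lambda>t. \<bar>Im (?L t)\<bar>" 0 "pi / 2" 1] by auto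
        have "cos (Im (?L t)) = cos \<bar>Im (?L t)\<bar>" by (simp add: abs_if)
        then have "Re (exp (?L t)) = 0" unfolding t(3) by (simp add: Re_exp)
        then show False using exp_eq[OF t(1,2), of z] re[OF z t(1,2)] s' by simp
      qed
      then have "Ln (exp (?L 1)) = ?L 1" by (intro Ln_exp) (use pi_gt_zero in \<open>auto simp: abs_less_iff\<close>)
      then show "Ln (1 + cauchy g z) = ?L 1" using exp_eq[of 1 z] by simp
    qed
  qed
qed

section \<open>Zeros of perturbed pseudoanalytic functions\<close>

lemma norm_exp_le: "cmod x \<le> E \<Longrightarrow> cmod (exp x) \<le> exp E" for x :: complex
  unfolding norm_exp_eq_Re exp_le_cancel_iff by (rule order_trans[OF complex_Re_le_cmod])

text \<open>If g equals \<alpha> f up to an error of size B, then f exp (- C \<alpha>) differs from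
  k by the transform of that error times an exponential. As |C \<alpha>| \<le> E, each exponential
  costs a factor exp E in either direction.\<close>

lemma similarity_bounds:
  assumes K: "\<And>g A. g \<in> borel_measurable borel \<Longrightarrow> 0 \<le> A \<Longrightarrow>
      (\<And>w. cmod (g w) \<le> A * indicator (ball c R) w) \<Longrightarrow> admissible g (A * K)"
    and f: "\<And>z. f z = k + cauchy g z" and g: "admissible g N"
    and \<alpha>: "\<alpha> \<in> borel_measurable borel" "0 \<le> A" "\<And>w. cmod (\<alpha> w) \<le> A * indicator (ball c R) w"
    and h: "0 \<le> B" "\<And>w. cmod (g w - \<alpha> w * f w) \<le> B * indicator (ball c R) w"
    and E: "E = A * K / bubble_mass"
  shows "cmod (f z) \<le> exp E * (cmod k + B * exp E * K / bubble_mass)"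
    "exp (- E) * (cmod k - B * exp E * K / bubble_mass) \<le> cmod (f z)"
proof -
  have [measurable]: "g \<in> borel_measurable borel" "\<alpha> \<in> borel_measurable borel" using admissible_measurable[OF g] \<alpha> by auto
  have "f = (\<lambda>z. k + cauchy g z)" using f by auto
  then have [measurable]: "f \<in> borel_measurable borel" by simp
  have a: "admissible \<alpha> (A * K)" by (rule K[OF \<alpha>])
  have ca: "cmod (cauchy \<alpha> z) \<le> E" for z using cauchy_bound[OF a] E by simp
  let ?H = "\<lambda>w. (g w - \<alpha> w * f w) * exp (- cauchy \<alpha> w)"
  have H: "admissible ?H (B * exp E * K)"
  proof (rule K)
    show "?H \<in> borel_measurable borel" by measurable
    show "0 \<le> B * exp E" using h(1) by simp
    fix w
    have "cmod (?H w) \<le> (B * indicator (ball c R) w) * exp E"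
      unfolding norm_mult using h ca by (intro mult_mono norm_exp_le) auto
    then show "cmod (?H w) \<le> B * exp E * indicator (ball c R) w" by (simp add: mult_ac)
  qed
  let ?F = "f z * exp (- cauchy \<alpha> z)"
  have F: "?F = k + cauchy ?H z" by (rule cauchy_similarity[OF a g f])
  have cH: "cmod (cauchy ?H z) \<le> B * exp E * K / bubble_mass" by (rule cauchy_bound[OF H])
  have up: "cmod ?F \<le> cmod k + B * exp E * K / bubble_mass"
    unfolding F using norm_triangle_ineq[of k "cauchy ?H z"] cH by linarith
  have lo: "cmod k - B * exp E * K / bubble_mass \<le> cmod ?F"
    unfolding F using norm_diff_ineq[of k "cauchy ?H z"] cH by linarith
  have e1: "f z = ?F * exp (cauchy \<alpha> z)" by (simp only: mult.assoc exp_add[symmetric]) simp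
  have "cmod (f z) = cmod ?F * cmod (exp (cauchy \<alpha> z))" by (subst e1) (rule norm_mult)
  also have "\<dots> \<le> (cmod k + B * exp E * K / bubble_mass) * exp E"
    using up by (intro mult_mono norm_exp_le ca) (auto intro: order_trans[OF norm_ge_zero up])
  finally show "cmod (f z) \<le> exp E * (cmod k + B * exp E * K / bubble_mass)" by (simp add: mult.commute)
  have "exp (- E) * (cmod k - B * exp E * K / bubble_mass) \<le> exp (- E) * cmod ?F" by (intro mult_left_mono lo) simp
  also have "\<dots> = exp (- E) * (cmod (f z) * cmod (exp (- cauchy \<alpha> z)))" by (simp only: norm_mult)
  also have "\<dots> \<le> exp (- E) * (cmod (f z) * exp E)"
    using ca by (intro mult_left_mono norm_exp_le) auto
  also have "\<dots> = cmod (f z)" by (simp add: exp_minus)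
  finally show "exp (- E) * (cmod k - B * exp E * K / bubble_mass) \<le> cmod (f z)" .
qed

text \<open>With \<open>d = u - a\<close> and \<open>s = u + a\<close> the system decouples up to terms of size \<open>\<delta>\<close>: \<open>d\<close> solves a
  pseudoanalytic equation and vanishes at infinity, hence is small, while \<open>s\<close> solves one and tends
  to 2, hence is bounded below. So \<open>2 u = s + d\<close> and \<open>2 a = s - d\<close> have no zeros.\<close>

lemma perturbed_pseudoanalytic_nonzero:
  assumes K: "\<And>g A. g \<in> borel_measurable borel \<Longrightarrow> 0 \<le> A \<Longrightarrow>
      (\<And>w. cmod (g w) \<le> A * indicator (ball c R) w) \<Longrightarrow> admissible g (A * K)"
    and K0: "0 < K"
    and P: "P \<in> borel_measurable borel" "\<And>w. cmod (P w) \<le> A * indicator (ball c R) w"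
    and P': "P' \<in> borel_measurable borel" "\<And>w. cmod (P' w) \<le> A * indicator (ball c R) w"
    and PP': "\<And>w. cmod (P' w - P w) \<le> \<delta> * indicator (ball c R) w"
    and A: "0 \<le> A" and \<delta>: "0 \<le> \<delta>" and E: "E = A * K / bubble_mass"
    and small: "\<delta> * exp (4 * E) * K / bubble_mass \<le> 1 / 4"
    and u: "\<And>z. u z = 1 + cauchy (\<lambda>w. P w * cnj (a w)) z"
    and a: "\<And>z. a z = 1 + cauchy (\<lambda>w. P' w * cnj (u w)) z"
    and adm: "admissible (\<lambda>w. P w * cnj (a w)) N1" "admissible (\<lambda>w. P' w * cnj (u w)) N2"
  shows "u z \<noteq> 0" "a z \<noteq> 0"
proof -
  let ?m = bubble_mass
  have m: "0 < ?m" by (rule bubble_mass_pos)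
  have ue: "u = (\<lambda>z. 1 + cauchy (\<lambda>w. P w * cnj (a w)) z)" and ae: "a = (\<lambda>z. 1 + cauchy (\<lambda>w. P' w * cnj (u w)) z)"
    by (rule ext, rule u, rule ext, rule a)
  have [measurable]: "(\<lambda>w. P w * cnj (a w)) \<in> borel_measurable borel" "(\<lambda>w. P' w * cnj (u w)) \<in> borel_measurable borel"
    using adm admissible_measurable by auto
  have "(\<lambda>z. 1 + cauchy (\<lambda>w. P w * cnj (a w)) z) \<in> borel_measurable borel"
    "(\<lambda>z. 1 + cauchy (\<lambda>w. P' w * cnj (u w)) z) \<in> borel_measurable borel" by measurable
  then have um[measurable]: "u \<in> borel_measurable borel" and am[measurable]: "a \<in> borel_measurable borel"
    by (simp_all only: ue[symmetric] ae[symmetric])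
  have [measurable]: "P \<in> borel_measurable borel" "P' \<in> borel_measurable borel" using P P' by auto
  have E0: "0 \<le> E" using A K0 m E by simp
  \<comment> \<open>The supremum is finite by admissibility, with a bound \<open>N1\<close> that may
    depend on the solution; a uniform bound follows by absorption below.\<close>
  define N where "N = (SUP z. cmod (u z))"
  have bdd: "bdd_above (range (\<lambda>z. cmod (u z)))"
  proof (rule bdd_aboveI2)
    fix z show "cmod (u z) \<le> 1 + N1 / ?m"
      using norm_triangle_ineq[of 1 "cauchy (\<lambda>w. P w * cnj (a w)) z"] cauchy_bound[OF adm(1), of z] unfolding u[of z] by simp
  qed
  have uN: "cmod (u z) \<le> N" for z unfolding N_def by (rule cSUP_upper[OF _ bdd]) simp
  have N0: "0 \<le> N" using uN[of 0] norm_ge_zero order_trans by blast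
  define d where "d z = u z - a z" for z
  define s where "s z = u z + a z" for z
  define gd where "gd w = P w * cnj (a w) + (-1) * (P' w * cnj (u w))" for w
  define gs where "gs w = P w * cnj (a w) + P' w * cnj (u w)" for w
  have [measurable]: "d \<in> borel_measurable borel" "s \<in> borel_measurable borel"
    unfolding d_def[abs_def] s_def[abs_def] by measurable
  have adm2: "admissible (\<lambda>w. (-1) * (P' w * cnj (u w))) (1 * N2)" by (rule admissible_times(2)[OF adm(2)]) auto
  have gd: "admissible gd (N1 + 1 * N2)" unfolding gd_def[abs_def] by (rule admissible_add[OF adm(1) adm2])
  have gs: "admissible gs (N1 + N2)" unfolding gs_def[abs_def] by (rule admissible_add[OF adm])
  have d: "d z = 0 + cauchy gd z" for z
    unfolding d_def u[of z] a[of z] gd_def[abs_def] cauchy_add[OF adm(1) adm2] cauchy_cmult by simp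
  have s: "s z = 2 + cauchy gs z" for z
    unfolding s_def u[of z] a[of z] gs_def[abs_def] cauchy_add[OF adm] by simp
  \<comment> \<open>Bers' coefficient rewrites P cnj f as a multiple of f whose factor is at most
    |P|. Where f = 0 the quotient is 0 by convention, and P cnj f vanishes as well.\<close>
  let ?q = "\<lambda>f w. P w * (cnj (f w) / f w)"
  have q_le: "cmod (?q f w) \<le> A * indicator (ball c R) w" for f w
  proof -
    have "cmod (cnj (f w) / f w) \<le> 1" by (simp add: norm_divide)
    then have "cmod (?q f w) \<le> cmod (P w) * 1" unfolding norm_mult by (intro mult_left_mono) auto
    then show ?thesis using P(2)[of w] by simp
  qed
  have err: "cmod ((P' w - P w) * cnj (u w)) \<le> \<delta> * N * indicator (ball c R) w" for w
  proof -
    have "cmod ((P' w - P w) * cnj (u w)) \<le> (\<delta> * indicator (ball c R) w) * N"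
      unfolding norm_mult complex_mod_cnj using PP' \<delta> uN by (intro mult_mono) auto
    then show ?thesis by (simp add: mult_ac)
  qed
  have hd: "cmod (gd w - (- ?q d w) * d w) \<le> \<delta> * N * indicator (ball c R) w" for w
  proof -
    have "gd w - (- ?q d w) * d w = - ((P' w - P w) * cnj (u w))"
    proof (cases "d w = 0")
      case True
      then have "a w = u w" by (simp add: d_def)
      then show ?thesis using True by (simp add: gd_def algebra_simps)
    next
      case False
      then have "?q d w * d w = P w * cnj (d w)" by simp
      then show ?thesis by (simp add: gd_def d_def algebra_simps)
    qed
    then show ?thesis using err[of w] by (simp only: norm_minus_cancel)
  qed
  have hs: "cmod (gs w - ?q s w * s w) \<le> \<delta> * N * indicator (ball c R) w" for w
  proof -
    have "gs w - ?q s w * s w = (P' w - P w) * cnj (u w)"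
    proof (cases "s w = 0")
      case True
      then have "a w = - u w" by (simp add: s_def add_eq_0_iff)
      then show ?thesis using True by (simp add: gs_def algebra_simps)
    next
      case False
      then have "?q s w * s w = P w * cnj (s w)" by simp
      then show ?thesis by (simp add: gs_def s_def algebra_simps)
    qed
    then show ?thesis using err[of w] by (simp only:)
  qed
  \<comment> \<open>The error term of \<open>similarity_bounds\<close> for B = \<delta> N, which
    still contains the unknown supremum.\<close>
  define \<theta> where "\<theta> = \<delta> * N * exp E * K / ?m"
  have \<theta>0: "0 \<le> \<theta>" using \<delta> N0 K0 m by (simp add: \<theta>_def)
  have dN: "0 \<le> \<delta> * N" using \<delta> N0 by simp
  have dq: "(\<lambda>w. - ?q d w) \<in> borel_measurable borel" "?q s \<in> borel_measurable borel" by measurable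
  have dq_le: "cmod (- ?q d w) \<le> A * indicator (ball c R) w" for w using q_le[where f=d and w=w] by (simp only: norm_minus_cancel)
  have dle: "cmod (d z) \<le> exp E * \<theta>" for z
  proof -
    have "cmod (d z) \<le> exp E * (cmod 0 + \<delta> * N * exp E * K / ?m)"
      by (rule similarity_bounds(1)[OF K d gd dq(1) A dq_le dN hd E])
    then show ?thesis by (simp add: \<theta>_def)
  qed
  have sle: "cmod (s z) \<le> exp E * (2 + \<theta>)" for z
  proof -
    have "cmod (s z) \<le> exp E * (cmod 2 + \<delta> * N * exp E * K / ?m)"
      by (rule similarity_bounds(1)[OF K s gs dq(2) A q_le[where f=s] dN hs E])
    then show ?thesis by (simp add: \<theta>_def)
  qed
  have sge: "exp (- E) * (2 - \<theta>) \<le> cmod (s z)" for z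
  proof -
    have "exp (- E) * (cmod 2 - \<delta> * N * exp E * K / ?m) \<le> cmod (s z)"
      by (rule similarity_bounds(2)[OF K s gs dq(2) A q_le[where f=s] dN hs E])
    then show ?thesis by (simp add: \<theta>_def)
  qed
  have us: "2 * u z = s z + d z" and as: "2 * a z = s z - d z" for z by (simp_all add: s_def d_def)
  \<comment> \<open>2 u = s + d bounds N in terms of itself. As exp E \<theta> \<le> N / 4, the last
    term is absorbed and N \<le> (4/3) exp E remains.\<close>
  have Nle: "N \<le> exp E + exp E * \<theta>"
    unfolding N_def
  proof (rule cSUP_least)
    fix z
    have "2 * cmod (u z) = cmod (s z + d z)" unfolding us[symmetric] by (simp add: norm_mult)
    also have "\<dots> \<le> exp E * (2 + \<theta>) + exp E * \<theta>" using norm_triangle_ineq[of "s z" "d z"] dle[of z] sle[of z] by linarith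
    finally show "cmod (u z) \<le> exp E + exp E * \<theta>" by (simp add: algebra_simps)
  qed simp
  \<comment> \<open>Budget of the four factors: one belongs to \<eta>, one bounds N, and two compare
    |d| \<le> exp E \<theta> with |s| \<ge> exp (- E) (2 - \<theta>).\<close>
  have e4: "exp (4 * E) = exp E * exp E * (exp E * exp E)" by (simp add: exp_add[symmetric])
  define \<eta> where "\<eta> = \<delta> * exp E * K / ?m"
  have \<eta>: "\<eta> * (exp E * exp E * exp E) \<le> 1 / 4" using small unfolding e4 \<eta>_def by (simp add: mult_ac)
  have \<eta>0: "0 \<le> \<eta>" using \<delta> K0 m by (simp add: \<eta>_def)
  have \<theta>\<eta>: "\<theta> = \<eta> * N" by (simp add: \<theta>_def \<eta>_def)
  have ge1: "1 \<le> exp E" using E0 by simp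
  have "\<eta> * exp E \<le> \<eta> * (exp E * exp E * exp E)"
    using \<eta>0 ge1 mult_mono[of 1 "exp E" 1 "exp E"] by (intro mult_left_mono) (auto intro: order_trans[OF _ mult_right_mono[of 1 "exp E * exp E" "exp E"]])
  then have "\<eta> * exp E \<le> 1 / 4" using \<eta> by linarith
  from mult_right_mono[OF this N0] have "exp E * \<theta> \<le> N / 4" unfolding \<theta>\<eta> by (simp add: mult_ac)
  then have N2: "N \<le> 4 / 3 * exp E" using Nle by linarith
  have "exp E * (exp E * \<theta>) \<le> (\<eta> * (exp E * exp E * exp E)) * (4 / 3)"
    using mult_left_mono[OF N2, of "\<eta> * (exp E * exp E)"] \<eta>0 unfolding \<theta>\<eta> by (simp add: mult_ac)
  also have "\<dots> \<le> 1 / 4 * (4 / 3)" using \<eta> by (intro mult_right_mono) auto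
  finally have t1: "exp E * (exp E * \<theta>) \<le> 1 / 3" by simp
  have "\<theta> \<le> exp E * (exp E * \<theta>)"
    using mult_mono[of 1 "exp E" \<theta> "exp E * \<theta>"] mult_right_mono[OF ge1 \<theta>0] ge1 \<theta>0 by simp
  then have t2: "\<theta> \<le> 1 / 3" using t1 by linarith
  have lt: "cmod (d z) < cmod (s z)" for z
  proof -
    have "exp E * cmod (d z) \<le> 1 / 3" using order_trans[OF mult_left_mono[OF dle[of z], of "exp E"] t1] by simp
    also have "1 / 3 < 2 - \<theta>" using t2 by simp
    also have "2 - \<theta> = exp E * (exp (- E) * (2 - \<theta>))" by (simp add: exp_minus)
    also have "\<dots> \<le> exp E * cmod (s z)" by (intro mult_left_mono sge) simp
    finally show ?thesis by simp
  qed
  show "u z \<noteq> 0"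
  proof
    assume "u z = 0"
    then have "s z = - d z" using us[of z] by (simp add: add_eq_0_iff2)
    then show False using lt[of z] by simp
  qed
  show "a z \<noteq> 0"
  proof
    assume "a z = 0"
    then have "s z = d z" using as[of z] by simp
    then show False using lt[of z] by simp
  qed
qed

text \<open>At this stage a is known only to be 1 plus an L^q function. The bounded, compactly
  supported factor P puts the product into L^q, from which admissibility and then a sup bound
  follow.\<close>

lemma Lq_potential_product:
  assumes P: "P \<in> borel_measurable borel" "\<And>w. cmod (P w) \<le> A * indicator (ball c R) w" and A: "0 \<le> A"
    and a[measurable]: "a \<in> borel_measurable borel" and q: "1 < q"
    and int: "integrable lborel (\<lambda>z. cmod (a z - 1) powr q)"
  shows "integrable lborel (\<lambda>z. cmod (P z * cnj (a z)) powr q)"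
proof -
  have [measurable]: "P \<in> borel_measurable borel" using P by auto
  have "integrable lborel (\<lambda>z. A powr q * (2 powr q * (indicator (ball c R) z + cmod (a z - 1) powr q)))"
    by (intro integrable_mult_right Bochner_Integration.integrable_add integrable_indicator_ball int)
  then show ?thesis
  proof (rule Bochner_Integration.integrable_bound)
    show "AE z in lborel. norm (cmod (P z * cnj (a z)) powr q) \<le> norm (A powr q * (2 powr q * (indicator (ball c R) z + cmod (a z - 1) powr q)))"
    proof (rule AE_I2)
      fix z
      show "norm (cmod (P z * cnj (a z)) powr q) \<le> norm (A powr q * (2 powr q * (indicator (ball c R) z + cmod (a z - 1) powr q)))"
      proof (cases "z \<in> ball c R")
        case True
        let ?x = "cmod (a z - 1)"
        have "cmod (a z) \<le> 1 + ?x" using norm_triangle_ineq[of 1 "a z - 1"] by simp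
        also have "\<dots> \<le> 2 * max 1 ?x" by simp
        finally have "cmod (a z) powr q \<le> (2 * max 1 ?x) powr q" using q by (intro powr_mono2) auto
        also have "\<dots> = 2 powr q * max 1 ?x powr q" by (rule powr_mult)
        also have "max 1 ?x powr q \<le> 1 + ?x powr q" by (auto simp: max_def)
        finally have 1: "cmod (a z) powr q \<le> 2 powr q * (1 + ?x powr q)" by simp
        have 2: "cmod (P z) powr q \<le> A powr q" using P(2)[of z] True q by (intro powr_mono2) auto
        have "cmod (P z * cnj (a z)) powr q = cmod (P z) powr q * cmod (a z) powr q"
          by (simp add: norm_mult powr_mult)
        also have "\<dots> \<le> A powr q * (2 powr q * (1 + ?x powr q))" by (intro mult_mono 1 2) auto
        finally show ?thesis using True by simp
      next
        case False
        then have "P z = 0" using P(2)[of z] by simp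
        then show ?thesis by simp
      qed
    qed
  qed measurable
qed

text \<open>Integrals of \<partial>-bar \<phi> vanish, so u - 1 satisfies the same weak equation
  and, being in L^q, is represented by C.\<close>

lemma borel_weak_dzbar_system:
  assumes q: "2 < q" and u[measurable]: "u \<in> borel_measurable borel" and int: "integrable lborel (\<lambda>z. cmod (u z - 1) powr q)"
    and w: "borel_weak_deriv dzbar u g"
    and g: "integrable lborel (\<lambda>z. cmod (g z) powr q)" "\<And>w. w \<notin> ball c R \<Longrightarrow> g w = 0"
  shows "\<exists>N. admissible g N" "AE z in lborel. u z = 1 + cauchy g z"
proof -
  have L: "borel_locint u" "borel_locint g" using w by (auto simp: borel_weak_deriv_def)
  show "\<exists>N. admissible g N" by (rule Lq_admissible[OF borel_locintD(1)[OF L(2)] g(1) q g(2)])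
  then obtain N where N: "admissible g N" by blast
  have "AE z in lborel. u z - 1 = cauchy g z"
  proof (rule cauchy_representation[OF _ int _ N])
    fix \<phi> assume \<phi>: "test_function UNIV \<phi>"
    obtain K where K: "compact K" "\<And>z. z \<notin> K \<Longrightarrow> dzbar \<phi> z = 0" using test_function_deriv_support[OF \<phi>] by metis
    have "integrable lborel (\<lambda>z. u z * dzbar \<phi> z)"
      by (rule borel_locint_mult[OF L(1) test_function_dz_props(2)[OF \<phi>] K])
    then have "(LINT z|lborel. (u z - 1) * dzbar \<phi> z) = (LINT z|lborel. u z * dzbar \<phi> z) - (LINT z|lborel. dzbar \<phi> z)"
      using test_function_eq_cauchy(2)[OF \<phi>] by (simp add: left_diff_distrib)
    also have "\<dots> = - (LINT z|lborel. g z * \<phi> z)"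
      using w \<phi> integral_test_function_deriv(3)[OF \<phi>] by (simp add: borel_weak_deriv_def)
    finally show "(LINT z|lborel. (u z - 1) * dzbar \<phi> z) = - (LINT z|lborel. g z * \<phi> z)" .
  qed (use q in auto)
  then show "AE z in lborel. u z = 1 + cauchy g z" by eventually_elim (simp add: algebra_simps)
qed

section \<open>Reconstruction of the potentials\<close>

lemma borel_weak_deriv_cong_AE:
  assumes P: "\<And>\<phi>. test_function UNIV \<phi> \<Longrightarrow> continuous_on UNIV (P \<phi>)" and w: "borel_weak_deriv P f g"
    and f': "f' \<in> borel_measurable borel" "AE z in lborel. f z = f' z"
    and g': "g' \<in> borel_measurable borel" "AE z in lborel. g z = g' z"
  shows "borel_weak_deriv P f' g'"
proof -
  have m: "f \<in> borel_measurable borel" "g \<in> borel_measurable borel" using w by (auto simp: borel_weak_deriv_def borel_locint_def)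
  have "has_weak_deriv P UNIV f g"
    using w has_weak_deriv_iff_borel[of P, OF P m(1) _ m(2), of f g] by simp
  then show ?thesis using has_weak_deriv_iff_borel[of P, OF P f' g'] by simp
qed

lemma Linf_norm_AE:
  assumes "Linf_norm UNIV f \<le> ereal B"
  shows "AE z in lebesgue. cmod (f z) \<le> B"
proof -
  have "AE z in restrict_space lebesgue UNIV. ereal (cmod (f z)) \<le> Linf_norm UNIV f"
    unfolding Linf_norm_def by (rule esssup_AE)
  then have "AE z in lebesgue. ereal (cmod (f z)) \<le> Linf_norm UNIV f"
    by (subst (asm) AE_restrict_space_iff) auto
  then show ?thesis
  proof eventually_elim
    fix z assume "ereal (cmod (f z)) \<le> Linf_norm UNIV f"
    also note assms
    finally show "cmod (f z) \<le> B" by simp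
  qed
qed

lemma weak_deriv_has_weak_deriv:
  assumes "weakly_diff P U f"
  shows "has_weak_deriv P U f (weak_deriv P U f)"
  using assms unfolding weakly_diff_def weak_deriv_def by (rule someI_ex)

lemma AE_lebesgue_iff: "(AE z in lebesgue. Q z) \<longleftrightarrow> (AE z::complex in lborel. Q z)"
  by (rule AE_completion_iff)

text \<open>The conjugate of a weak derivative of a real function is again one, so uniqueness makes
  the derivative real almost everywhere.\<close>

lemma real_weak_deriv:
  assumes P: "P = dx \<or> P = dy" and S[measurable]: "S \<in> borel_measurable borel" and FS: "AE z in lborel. F z = S z"
    and wd: "weakly_diff P UNIV (\<lambda>z. of_real (F z))" and bd: "Linf_norm UNIV (weak_deriv P UNIV (\<lambda>z. of_real (F z))) \<le> ereal \<beta>"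
  obtains X :: "complex \<Rightarrow> real" where "X \<in> borel_measurable borel" "borel_weak_deriv P (\<lambda>z. of_real (S z)) (\<lambda>z. of_real (X z))"
    "AE z in lborel. \<bar>X z\<bar> \<le> \<beta>"
proof -
  have cont: "continuous_on UNIV (P \<phi>)" if "test_function UNIV \<phi>" for \<phi>
    using P test_function_props(3,4)[OF that] by auto
  have cS: "(\<lambda>z. complex_of_real (S z)) \<in> borel_measurable borel" by measurable
  have FS': "AE z in lborel. complex_of_real (F z) = of_real (S z)" using FS by eventually_elim simp
  obtain X0 where X0: "borel_weak_deriv P (\<lambda>z. of_real (S z)) X0"
    and X0eq: "AE z in lborel. weak_deriv P UNIV (\<lambda>z. of_real (F z)) z = X0 z"
    by (rule has_weak_deriv_borelE[of P, OF cont weak_deriv_has_weak_deriv[OF wd] cS FS'])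
  have X0m[measurable]: "X0 \<in> borel_measurable borel" using X0 by (simp add: borel_weak_deriv_def borel_locint_def)
  have "borel_weak_deriv P (\<lambda>z. cnj (of_real (S z))) (\<lambda>z. cnj (X0 z))"
    by (rule borel_weak_deriv_cnj[OF X0]) (use P test_function_cnj(4,5) in auto)
  then have "AE z in lborel. X0 z = cnj (X0 z)"
    by (intro borel_weak_deriv_unique[OF X0]) simp
  then have real: "AE z in lborel. X0 z = of_real (Re (X0 z))"
    by eventually_elim (simp add: complex_eq_iff)
  have bd': "AE z in lborel. cmod (weak_deriv P UNIV (\<lambda>z. of_real (F z)) z) \<le> \<beta>"
    using Linf_norm_AE[OF bd] by (simp only: AE_lebesgue_iff)
  show ?thesis
  proof (rule that)
    show "(\<lambda>z. Re (X0 z)) \<in> borel_measurable borel" by measurable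
    show "borel_weak_deriv P (\<lambda>z. of_real (S z)) (\<lambda>z. of_real (Re (X0 z)))"
      by (rule borel_weak_deriv_cong_AE[OF cont X0 cS _ _ real]) (auto intro: measurable_compose[OF X0m])
    show "AE z in lborel. \<bar>Re (X0 z)\<bar> \<le> \<beta>"
      using bd' X0eq by eventually_elim (metis abs_Re_le_cmod order_trans)
  qed
qed

lemma W1inf_norm_borelE:
  assumes W: "W1inf_norm UNIV (\<lambda>z. of_real (F z)) \<le> ereal \<beta>"
  obtains S X Y :: "complex \<Rightarrow> real" where
    "S \<in> borel_measurable borel" "X \<in> borel_measurable borel" "Y \<in> borel_measurable borel"
    "AE z in lborel. F z = S z"
    "borel_weak_deriv dx (\<lambda>z. of_real (S z)) (\<lambda>z. of_real (X z))"
    "borel_weak_deriv dy (\<lambda>z. of_real (S z)) (\<lambda>z. of_real (Y z))"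
    "AE z in lborel. \<bar>S z\<bar> \<le> \<beta> \<and> \<bar>X z\<bar> \<le> \<beta> \<and> \<bar>Y z\<bar> \<le> \<beta>"
proof -
  let ?F = "\<lambda>z. complex_of_real (F z)"
  have wd: "weakly_diff dx UNIV ?F" "weakly_diff dy UNIV ?F"
    and L: "Linf_norm UNIV ?F \<le> ereal \<beta>" "Linf_norm UNIV (weak_deriv dx UNIV ?F) \<le> ereal \<beta>"
      "Linf_norm UNIV (weak_deriv dy UNIV ?F) \<le> ereal \<beta>"
    using W by (auto simp: W1inf_norm_def split: if_splits)
  have "loc_integrable UNIV ?F" using wd(1) by (auto simp: weakly_diff_def has_weak_deriv_def)
  then obtain S0 where S0[measurable]: "S0 \<in> borel_measurable borel" and S0eq: "AE z in lborel. ?F z = S0 z"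
    using borel_representative[OF loc_integrable_measurable] by blast
  define S where "S z = Re (S0 z)" for z
  have Sm: "S \<in> borel_measurable borel" unfolding S_def[abs_def] by measurable
  have FS: "AE z in lborel. F z = S z" using S0eq by eventually_elim (auto simp: S_def dest: arg_cong[where f=Re])
  obtain X where X: "X \<in> borel_measurable borel" "borel_weak_deriv dx (\<lambda>z. of_real (S z)) (\<lambda>z. of_real (X z))" "AE z in lborel. \<bar>X z\<bar> \<le> \<beta>"
    by (rule real_weak_deriv[OF _ Sm FS wd(1) L(2)]) auto
  obtain Y where Y: "Y \<in> borel_measurable borel" "borel_weak_deriv dy (\<lambda>z. of_real (S z)) (\<lambda>z. of_real (Y z))" "AE z in lborel. \<bar>Y z\<bar> \<le> \<beta>"
    by (rule real_weak_deriv[OF _ Sm FS wd(2) L(3)]) auto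
  have "AE z in lborel. cmod (?F z) \<le> \<beta>" using Linf_norm_AE[OF L(1)] by (simp only: AE_lebesgue_iff)
  then have "AE z in lborel. \<bar>S z\<bar> \<le> \<beta>" using FS by eventually_elim simp
  then have "AE z in lborel. \<bar>S z\<bar> \<le> \<beta> \<and> \<bar>X z\<bar> \<le> \<beta> \<and> \<bar>Y z\<bar> \<le> \<beta>"
    using X(3) Y(3) by eventually_elim simp
  then show ?thesis using that Sm X(1,2) Y(1,2) FS by blast
qed

text \<open>The function \<gamma> - 1 is bounded with bounded support, hence \<gamma> is 1 plus a
  Cauchy transform, and \<open>Ln_one_plus_cauchy\<close> exhibits its logarithm as a Cauchy
  transform with known density.\<close>

lemma borel_weak_deriv_Ln:
  assumes \<gamma>[measurable]: "\<gamma> \<in> borel_measurable borel" and w: "borel_weak_deriv dzbar \<gamma> g"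
    and bd: "AE z in lborel. cmod (\<gamma> z) \<le> B" "AE z in lborel. cmod (g z) \<le> B'"
    and out: "AE z in lborel. z \<notin> ball c R \<longrightarrow> \<gamma> z = 1"
    and s: "0 < s" "AE z in lborel. s \<le> Re (\<gamma> z)"
  shows "AE z in lborel. z \<notin> ball c (R + 1) \<longrightarrow> g z = 0"
    "\<exists>L \<alpha>. borel_weak_deriv dzbar L \<alpha> \<and> (AE z in lborel. Ln (\<gamma> z) = L z) \<and> (AE z in lborel. \<alpha> z = g z / \<gamma> z)"
proof -
  have gm[measurable]: "g \<in> borel_measurable borel" using w by (simp add: borel_weak_deriv_def borel_locint_def)
  have zero: "borel_weak_deriv dzbar (\<lambda>z. 0) (\<lambda>z. 0)"
    by (simp add: borel_weak_deriv_def borel_locint_def)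
  \<comment> \<open>Tests supported outside the closed ball only see the constant 1. The radius R +
    1 in the conclusion turns this closed ball into an open one containing it.\<close>
  have "AE z in lborel. z \<in> - cball c R \<longrightarrow> g z = 0"
  proof (rule borel_weak_deriv_unique_on[OF _ w zero])
    show "open (- cball c R)" by (intro open_Compl closed_cball)
    fix \<phi> assume \<phi>: "test_function (- cball c R) \<phi>"
    obtain K where K: "K \<subseteq> - cball c R" "\<And>z. z \<notin> K \<Longrightarrow> dzbar \<phi> z = 0" using test_function_deriv_support[OF \<phi>] by metis
    have [measurable]: "dzbar \<phi> \<in> borel_measurable borel" using test_function_dz_props(2)[OF \<phi>] by (rule borel_measurable_continuous_onI)
    have "(LINT z|lborel. \<gamma> z * dzbar \<phi> z) = (LINT z|lborel. dzbar \<phi> z)"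
    proof (rule integral_cong_AE)
      show "AE z in lborel. \<gamma> z * dzbar \<phi> z = dzbar \<phi> z"
        using out
      proof eventually_elim
        fix z assume z: "z \<notin> ball c R \<longrightarrow> \<gamma> z = 1"
        show "\<gamma> z * dzbar \<phi> z = dzbar \<phi> z"
        proof (cases "z \<in> K")
          case True
          then have "z \<notin> ball c R" using K(1) ball_subset_cball by blast
          then show ?thesis using z by simp
        qed (simp add: K(2))
      qed
    qed measurable
    then show "(LINT z|lborel. \<gamma> z * dzbar \<phi> z) = (LINT z|lborel. 0 * dzbar \<phi> z)"
      using integral_test_function_deriv(3)[OF \<phi>] by simp
  qed
  then show out_g: "AE z in lborel. z \<notin> ball c (R + 1) \<longrightarrow> g z = 0"
  proof eventually_elim
    fix z assume "z \<in> - cball c R \<longrightarrow> g z = 0"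
    then show "z \<notin> ball c (R + 1) \<longrightarrow> g z = 0" by (auto simp: not_less)
  qed
  \<comment> \<open>A representative of g that is bounded at every point, since
    \<open>bounded_admissible\<close> takes pointwise bounds.\<close>
  define h where "h w = (if w \<in> ball c (R + 1) \<and> cmod (g w) \<le> B' then g w else 0)" for w
  have [measurable]: "h \<in> borel_measurable borel" unfolding h_def[abs_def] by measurable
  have gh: "AE z in lborel. g z = h z" using out_g bd(2) by eventually_elim (auto simp: h_def)
  have B'0: "0 \<le> \<bar>B'\<bar>" by simp
  have h_le: "cmod (h w) \<le> \<bar>B'\<bar> * indicator (ball c (R + 1)) w" for w by (auto simp: h_def)
  obtain K where K: "\<And>g A. g \<in> borel_measurable borel \<Longrightarrow> 0 \<le> A \<Longrightarrow> (\<And>w. cmod (g w) \<le> A * indicator (ball c (R + 1)) w) \<Longrightarrow> admissible g (A * K)"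
    using bounded_admissible[of c "R + 1"] by metis
  have hadm: "admissible h (\<bar>B'\<bar> * K)" by (rule K[OF _ B'0 h_le]) measurable
  have hL: "borel_locint h"
  proof (rule borel_locint_if_bounded)
    show "cmod (h z) \<le> \<bar>B'\<bar>" for z using h_le[of z] by (cases "z \<in> ball c (R + 1)") auto
  qed measurable
  have cont: "continuous_on UNIV (dzbar \<phi>)" if "test_function UNIV \<phi>" for \<phi> using test_function_dz_props(2)[OF that] .
  have wh: "borel_weak_deriv dzbar \<gamma> h"
    by (rule borel_weak_deriv_cong_AE[OF cont w \<gamma> _ _ gh]) auto
  \<comment> \<open>The exponent 3 stands for any exponent above 2; bounded functions of bounded
    support have every such power integrable.\<close>
  have rep: "AE z in lborel. \<gamma> z = 1 + cauchy h z"
  proof (rule borel_weak_dzbar_system(2)[where q=3, OF _ \<gamma> _ wh])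
    have ball_int: "integrable lborel (\<lambda>z. C * indicator (ball c r) z :: real)" for C r
      by (intro integrable_mult_right integrable_indicator_ball)
    show "integrable lborel (\<lambda>z. cmod (\<gamma> z - 1) powr 3)"
    proof (rule Bochner_Integration.integrable_bound[OF ball_int[of "(B + 1) powr 3" R]])
      show "AE z in lborel. norm (cmod (\<gamma> z - 1) powr 3) \<le> norm ((B + 1) powr 3 * indicator (ball c R) z :: real)"
        using out bd(1)
      proof eventually_elim
        fix z assume z: "z \<notin> ball c R \<longrightarrow> \<gamma> z = 1" "cmod (\<gamma> z) \<le> B"
        have "cmod (\<gamma> z - 1) \<le> B + 1" using norm_triangle_ineq4[of "\<gamma> z" 1] z(2) by simp
        then have "cmod (\<gamma> z - 1) powr 3 \<le> (B + 1) powr 3" by (intro powr_mono2) auto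
        then show "norm (cmod (\<gamma> z - 1) powr 3) \<le> norm ((B + 1) powr 3 * indicator (ball c R) z :: real)"
          using z(1) by (cases "z \<in> ball c R") auto
      qed
    qed measurable
    show "integrable lborel (\<lambda>z. cmod (h z) powr 3)"
    proof (rule Bochner_Integration.integrable_bound[OF ball_int[of "\<bar>B'\<bar> powr 3" "R + 1"]])
      show "AE z in lborel. norm (cmod (h z) powr 3) \<le> norm (\<bar>B'\<bar> powr 3 * indicator (ball c (R + 1)) z :: real)"
      proof (rule AE_I2)
        fix z
        have "cmod (h z) powr 3 \<le> (\<bar>B'\<bar> * indicator (ball c (R + 1)) z) powr 3" by (intro powr_mono2 h_le) auto
        then show "norm (cmod (h z) powr 3) \<le> norm (\<bar>B'\<bar> powr 3 * indicator (ball c (R + 1)) z :: real)"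
          by (cases "z \<in> ball c (R + 1)") auto
      qed
    qed measurable
    show "h w = 0" if "w \<notin> ball c (R + 1)" for w using that by (auto simp: h_def)
  qed simp
  have "AE z in lborel. s \<le> Re (1 + cauchy h z)" using rep s(2) by eventually_elim simp
  then obtain \<alpha> M where \<alpha>: "admissible \<alpha> M" "borel_locint \<alpha>" "AE z in lborel. \<alpha> z = h z / (1 + cauchy h z)"
    "AE z in lborel. Ln (1 + cauchy h z) = cauchy \<alpha> z"
    by (rule Ln_one_plus_cauchy[OF hadm hL s(1)])
  have "borel_weak_deriv dzbar (cauchy \<alpha>) \<alpha>" by (rule borel_weak_deriv_cauchy[OF \<alpha>(1,2)])
  moreover have "AE z in lborel. Ln (\<gamma> z) = cauchy \<alpha> z" using \<alpha>(4) rep by eventually_elim simp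
  moreover have "AE z in lborel. \<alpha> z = g z / \<gamma> z" using \<alpha>(3) rep gh by eventually_elim simp
  ultimately show "\<exists>L \<alpha>. borel_weak_deriv dzbar L \<alpha> \<and> (AE z in lborel. Ln (\<gamma> z) = L z) \<and> (AE z in lborel. \<alpha> z = g z / \<gamma> z)"
    by blast
qed

lemma admissible_cong_AE:
  assumes "admissible g N" "h \<in> borel_measurable borel" "AE w in lborel. g w = h w"
  shows "admissible h N"
proof -
  have "(\<integral>\<^sup>+w. ennreal (cmod (h w) / cmod (z - w)) \<partial>lborel) = (\<integral>\<^sup>+w. ennreal (cmod (g w) / cmod (z - w)) \<partial>lborel)" for z
  proof (rule nn_integral_cong_AE)
    show "AE w in lborel. ennreal (cmod (h w) / cmod (z - w)) = ennreal (cmod (g w) / cmod (z - w))"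
      using assms(3) by eventually_elim simp
  qed
  then show ?thesis using assms by (simp add: admissible_def)
qed

text \<open>u and a are replaced by the right-hand sides U and V of their integral equations. This
  changes the densities only on null sets, so U and V satisfy the equations at every point and have
  no zeros at all.\<close>

lemma perturbed_pseudoanalytic_AE_nonzero:
  assumes K: "\<And>g A. g \<in> borel_measurable borel \<Longrightarrow> 0 \<le> A \<Longrightarrow>
      (\<And>w. cmod (g w) \<le> A * indicator (ball c R) w) \<Longrightarrow> admissible g (A * K)"
    and K0: "0 < K"
    and P[measurable]: "P \<in> borel_measurable borel" and Pb: "\<And>w. cmod (P w) \<le> A * indicator (ball c R) w"
    and P'[measurable]: "P' \<in> borel_measurable borel" and P'b: "\<And>w. cmod (P' w) \<le> A * indicator (ball c R) w"
    and PP': "\<And>w. cmod (P' w - P w) \<le> \<delta> * indicator (ball c R) w"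
    and A: "0 \<le> A" and \<delta>: "0 \<le> \<delta>" and E: "E = A * K / bubble_mass"
    and small: "\<delta> * exp (4 * E) * K / bubble_mass \<le> 1 / 4"
    and q: "2 < q" and u[measurable]: "u \<in> borel_measurable borel" and a[measurable]: "a \<in> borel_measurable borel"
    and ui: "integrable lborel (\<lambda>z. cmod (u z - 1) powr q)" and ai: "integrable lborel (\<lambda>z. cmod (a z - 1) powr q)"
    and wu: "borel_weak_deriv dzbar u (\<lambda>w. P w * cnj (a w))"
    and wa: "borel_weak_deriv dzbar a (\<lambda>w. P' w * cnj (u w))"
  shows "AE z in lborel. u z \<noteq> 0 \<and> a z \<noteq> 0"
proof -
  have q1: "1 < q" using q by simp
  have z: "P w * cnj (a w) = 0" "P' w * cnj (u w) = 0" if "w \<notin> ball c R" for w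
    using Pb[of w] P'b[of w] that by auto
  obtain N1 where N1: "admissible (\<lambda>w. P w * cnj (a w)) N1"
    using borel_weak_dzbar_system(1)[OF q u ui wu Lq_potential_product[OF P Pb A a q1 ai] z(1)] by blast
  obtain N2 where N2: "admissible (\<lambda>w. P' w * cnj (u w)) N2"
    using borel_weak_dzbar_system(1)[OF q a ai wa Lq_potential_product[OF P' P'b A u q1 ui] z(2)] by blast
  define U where "U z = 1 + cauchy (\<lambda>w. P w * cnj (a w)) z" for z
  define V where "V z = 1 + cauchy (\<lambda>w. P' w * cnj (u w)) z" for z
  have [measurable]: "U \<in> borel_measurable borel" "V \<in> borel_measurable borel"
    unfolding U_def[abs_def] V_def[abs_def] by measurable
  have uU: "AE z in lborel. u z = U z" unfolding U_def
    by (rule borel_weak_dzbar_system(2)[OF q u ui wu Lq_potential_product[OF P Pb A a q1 ai] z(1)])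
  have aV: "AE z in lborel. a z = V z" unfolding V_def
    by (rule borel_weak_dzbar_system(2)[OF q a ai wa Lq_potential_product[OF P' P'b A u q1 ui] z(2)])
  have e1: "AE w in lborel. P w * cnj (a w) = P w * cnj (V w)" using aV by eventually_elim simp
  have e2: "AE w in lborel. P' w * cnj (u w) = P' w * cnj (U w)" using uU by eventually_elim simp
  have U: "U z = 1 + cauchy (\<lambda>w. P w * cnj (V w)) z" for z
    unfolding U_def by (intro arg_cong[where f="\<lambda>x. 1 + x"] cauchy_cong_AE[OF e1]) measurable
  have V: "V z = 1 + cauchy (\<lambda>w. P' w * cnj (U w)) z" for z
    unfolding V_def by (intro arg_cong[where f="\<lambda>x. 1 + x"] cauchy_cong_AE[OF e2]) measurable
  have N1': "admissible (\<lambda>w. P w * cnj (V w)) N1" by (rule admissible_cong_AE[OF N1 _ e1]) measurable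
  have N2': "admissible (\<lambda>w. P' w * cnj (U w)) N2" by (rule admissible_cong_AE[OF N2 _ e2]) measurable
  have "U z \<noteq> 0 \<and> V z \<noteq> 0" for z
    using perturbed_pseudoanalytic_nonzero[OF K K0 P Pb P' P'b PP' A \<delta> E small U V N1' N2'] by blast
  then have UV: "U z \<noteq> 0" "V z \<noteq> 0" for z by auto
  show ?thesis using uU aV by eventually_elim (simp add: UV)
qed

lemma integrable_powr_add:
  fixes x y :: "complex \<Rightarrow> complex"
  assumes [measurable]: "x \<in> borel_measurable borel" "y \<in> borel_measurable borel" and q: "0 < q"
    and "integrable lborel (\<lambda>z. cmod (x z) powr q)" "integrable lborel (\<lambda>z. cmod (y z) powr q)"
  shows "integrable lborel (\<lambda>z. cmod (x z + y z) powr q)"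
proof (rule Bochner_Integration.integrable_bound)
  show "integrable lborel (\<lambda>z. 2 powr q * (cmod (x z) powr q + cmod (y z) powr q))"
    using assms by (intro integrable_mult_right Bochner_Integration.integrable_add)
  show "AE z in lborel. norm (cmod (x z + y z) powr q) \<le> norm (2 powr q * (cmod (x z) powr q + cmod (y z) powr q))"
  proof (rule AE_I2)
    fix z
    have "cmod (x z + y z) \<le> 2 * max (cmod (x z)) (cmod (y z))"
      using norm_triangle_ineq[of "x z" "y z"] by simp
    then have "cmod (x z + y z) powr q \<le> (2 * max (cmod (x z)) (cmod (y z))) powr q" using q by (intro powr_mono2) auto
    also have "\<dots> = 2 powr q * max (cmod (x z)) (cmod (y z)) powr q" by (rule powr_mult)
    also have "\<dots> \<le> 2 powr q * (cmod (x z) powr q + cmod (y z) powr q)" by (intro mult_left_mono) (auto simp: max_def)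
    finally show "norm (cmod (x z + y z) powr q) \<le> norm (2 powr q * (cmod (x z) powr q + cmod (y z) powr q))" by simp
  qed
qed measurable

lemma Lq_borel:
  assumes "Lq q F" "f \<in> borel_measurable borel" "AE z in lborel. F z = f z"
  shows "integrable lborel (\<lambda>z. cmod (f z) powr q)"
proof -
  have F: "F \<in> borel_measurable lebesgue" "integrable lebesgue (\<lambda>z. cmod (F z) powr q)" using assms by (auto simp: Lq_def)
  have f: "f \<in> borel_measurable lebesgue" by (rule borel_imp_lebesgue[OF assms(2)])
  have [measurable]: "F \<in> borel_measurable lebesgue" "f \<in> borel_measurable lebesgue" "f \<in> borel_measurable borel" using F f assms by auto
  have "integrable lebesgue (\<lambda>z. cmod (f z) powr q)"
  proof (rule integrable_cong_AE_imp[OF F(2)])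
    show "AE z in lebesgue. cmod (F z) powr q = cmod (f z) powr q"
      using AE_completion[OF assms(3)] by eventually_elim simp
  qed measurable
  then show ?thesis by (subst (asm) integrable_completion) auto
qed

text \<open>Used for the logarithmic derivatives belonging to \<omega> and - \<omega>, whose
  numerators and denominators both differ by terms of order \<omega>.\<close>

lemma norm_quotient_diff_le:
  fixes a b g h :: complex
  assumes s: "0 < s" "s \<le> cmod g" "s \<le> cmod h"
    and le: "cmod (a - b) \<le> A" "cmod b \<le> B" "cmod (h - g) \<le> D"
  shows "cmod (a / g - b / h) \<le> A / s + B * D / (s * s)"
proof -
  have nn: "0 \<le> A" "0 \<le> B" "0 \<le> D" using le norm_ge_zero order_trans by blast+
  have "g \<noteq> 0" "h \<noteq> 0" using s by auto
  then have eq: "a / g - b / h = (a - b) / g + b * (h - g) / (g * h)" by (simp add: field_simps)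
  have "cmod ((a - b) / g) \<le> A / s" unfolding norm_divide using nn by (intro frac_le s le) auto
  moreover have "cmod (b * (h - g) / (g * h)) \<le> B * D / (s * s)"
    unfolding norm_divide norm_mult using nn s by (intro frac_le mult_mono le) auto
  ultimately show ?thesis unfolding eq by (rule norm_triangle_mono)
qed

lemma e_0: "e z 0 = 1"
  by (simp add: e_def)

lemma borel_weak_deriv_sum_rep:
  assumes P: "P = dz \<or> P = dzbar"
    and wd: "weakly_diff P UNIV F" "weakly_diff P UNIV F'"
    and f: "f \<in> borel_measurable borel" "AE z in lborel. F z = f z"
    and f': "f' \<in> borel_measurable borel" "AE z in lborel. F' z = f' z"
    and g: "g \<in> borel_measurable borel" "AE z in lborel. weak_deriv P UNIV F z + weak_deriv P UNIV F' z = g z"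
  shows "borel_weak_deriv P (\<lambda>z. f z + f' z) g"
proof -
  have cont: "continuous_on UNIV (P \<phi>)" if "test_function UNIV \<phi>" for \<phi> using test_function_ops(1)[OF that] P by auto
  obtain h where h: "borel_weak_deriv P f h" "AE z in lborel. weak_deriv P UNIV F z = h z"
    by (rule has_weak_deriv_borelE[of P, OF cont weak_deriv_has_weak_deriv[OF wd(1)] f])
  obtain h' where h': "borel_weak_deriv P f' h'" "AE z in lborel. weak_deriv P UNIV F' z = h' z"
    by (rule has_weak_deriv_borelE[of P, OF cont weak_deriv_has_weak_deriv[OF wd(2)] f'])
  have "borel_weak_deriv P (\<lambda>z. f z + 1 * f' z) (\<lambda>z. h z + 1 * h' z)"
    by (rule borel_weak_deriv_add[OF h(1) h'(1)]) (use P in auto)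
  then have sum: "borel_weak_deriv P (\<lambda>z. f z + f' z) (\<lambda>z. h z + h' z)" by simp
  have [measurable]: "f \<in> borel_measurable borel" "f' \<in> borel_measurable borel" using f f' by auto
  have m: "(\<lambda>z. f z + f' z) \<in> borel_measurable borel" by measurable
  have eq: "AE z in lborel. h z + h' z = g z" using h(2) h'(2) g(2) by eventually_elim simp
  show ?thesis by (rule borel_weak_deriv_cong_AE[of P, OF cont sum m _ g(1) eq]) auto
qed

theorem theorem2p9:
  fixes \<Omega> :: "complex set" and c :: complex and R \<sigma>0 \<beta> :: real
  assumes "bounded_lipschitz_domain \<Omega>"
    and "\<Omega> \<subseteq> ball c R"
    and "\<sigma>0 > 0" and "\<beta> > 0"
  shows "\<exists>\<omega>0>0. \<forall>\<omega>::real. 0 \<le> \<omega> \<and> \<omega> < \<omega>0 \<longrightarrow>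
    (\<forall>(\<sigma> :: complex \<Rightarrow> real) (\<epsilon> :: complex \<Rightarrow> real) (M :: complex \<Rightarrow> complex \<Rightarrow> complex^2^2).
       (AE z in lebesgue. \<sigma> z > \<sigma>0) \<and>
       W1inf_norm \<Omega> (\<lambda>z. of_real (\<sigma> z)) \<le> ereal \<beta> \<and>
       W1inf_norm \<Omega> (\<lambda>z. of_real (\<epsilon> z)) \<le> ereal \<beta> \<and>
       W1inf_norm UNIV (\<lambda>z. of_real (\<sigma> z)) \<le> ereal \<beta> \<and>
       W1inf_norm UNIV (\<lambda>z. of_real (\<epsilon> z)) \<le> ereal \<beta> \<and>
       (AE z in lebesgue. z \<notin> ball c R \<longrightarrow> admittivity \<omega> \<sigma> \<epsilon> z = 1) \<and>
       (\<forall>k. cgo_matrix (admittivity \<omega> \<sigma> \<epsilon>) k (\<lambda>z. M z k))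
       \<longrightarrow>
       weakly_diff dz UNIV (\<lambda>z. Ln (admittivity \<omega> \<sigma> \<epsilon> z)) \<and>
       weakly_diff dzbar UNIV (\<lambda>z. Ln (admittivity \<omega> \<sigma> \<epsilon> z)) \<and>
       weakly_diff dzbar UNIV (\<lambda>z. M_plus M z 0) \<and>
       weakly_diff dz UNIV (\<lambda>z. M_minus M z 0) \<and>
       (AE z in lebesgue. M_minus M z 0 \<noteq> 0 \<and>
          Q12 (admittivity \<omega> \<sigma> \<epsilon>) z
            = weak_deriv dzbar UNIV (\<lambda>w. M_plus M w 0) z / M_minus M z 0) \<and>
       (AE z in lebesgue. M_plus M z 0 \<noteq> 0 \<and>
          Q21 (admittivity \<omega> \<sigma> \<epsilon>) z
            = weak_deriv dz UNIV (\<lambda>w. M_minus M w 0) z / M_plus M z 0))"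
proof -
  note \<sigma>0 = assms(3) and \<beta> = assms(4)
  obtain K where K0: "0 < K" and K: "\<And>g A. g \<in> borel_measurable borel \<Longrightarrow> 0 \<le> A \<Longrightarrow>
      (\<And>w. cmod (g w) \<le> A * indicator (ball c (R + 1)) w) \<Longrightarrow> admissible g (A * K)"
    using bounded_admissible[of c "R + 1"] by metis
  \<comment> \<open>The numerator \<partial>-bar \<gamma> is at most 2 \<beta> for \<omega> \<le> 1,
    the denominator at least \<sigma>0, and the potentials carry a factor 1/2.\<close>
  define A where "A = \<beta> / \<sigma>0"
  have A0: "0 \<le> A" using \<sigma>0 \<beta> by (simp add: A_def)
  define E where "E = A * K / bubble_mass"
  \<comment> \<open>Half of the bound in \<open>norm_quotient_diff_le\<close> for differences 2
    \<omega> \<beta> and a numerator of size 2 \<beta>, divided by \<omega>.\<close>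
  define \<kappa> where "\<kappa> = \<beta> / \<sigma>0 + 2 * \<beta>\<^sup>2 / \<sigma>0\<^sup>2"
  have \<kappa>0: "0 < \<kappa>" using \<sigma>0 \<beta> by (simp add: \<kappa>_def add_pos_pos)
  \<comment> \<open>The second entry is \<delta> exp (4 E) K / \<open>bubble_mass\<close> \<le> 1/4
    with \<delta> = \<omega> \<kappa>, solved for \<omega>; the entry 1 secures the bound
    \<open>A\<close>. Neither involves \<sigma>, \<epsilon> or M.\<close>
  define \<omega>0 where "\<omega>0 = min 1 (bubble_mass / (4 * \<kappa> * exp (4 * E) * K))"
  have \<omega>00: "0 < \<omega>0" using \<kappa>0 K0 bubble_mass_pos by (simp add: \<omega>0_def)
  show ?thesis
  proof (rule exI[of _ \<omega>0], intro conjI[OF \<omega>00] allI impI, elim conjE)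
    fix \<omega> :: real and \<sigma> \<epsilon> :: "complex \<Rightarrow> real" and M :: "complex \<Rightarrow> complex \<Rightarrow> complex^2^2"
    assume \<omega>: "0 \<le> \<omega>" "\<omega> < \<omega>0"
    assume \<sigma>ge: "AE z in lebesgue. \<sigma> z > \<sigma>0"
      and W\<sigma>: "W1inf_norm UNIV (\<lambda>z. of_real (\<sigma> z)) \<le> ereal \<beta>"
      and W\<epsilon>: "W1inf_norm UNIV (\<lambda>z. of_real (\<epsilon> z)) \<le> ereal \<beta>"
      and out: "AE z in lebesgue. z \<notin> ball c R \<longrightarrow> admittivity \<omega> \<sigma> \<epsilon> z = 1"
      and cgo: "\<forall>k. cgo_matrix (admittivity \<omega> \<sigma> \<epsilon>) k (\<lambda>z. M z k)"
    let ?\<gamma> = "admittivity \<omega> \<sigma> \<epsilon>"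
    define \<delta> where "\<delta> = \<omega> * \<kappa>"
    have \<delta>0: "0 \<le> \<delta>" using \<omega> \<kappa>0 by (simp add: \<delta>_def)
    have small: "\<delta> * exp (4 * E) * K / bubble_mass \<le> 1 / 4"
    proof -
      have p: "0 < 4 * \<kappa> * exp (4 * E) * K" using \<kappa>0 K0 by simp
      have "\<omega> \<le> bubble_mass / (4 * \<kappa> * exp (4 * E) * K)" using \<omega> by (simp add: \<omega>0_def)
      then have "\<omega> * (4 * \<kappa> * exp (4 * E) * K) \<le> bubble_mass" using p by (simp add: pos_le_divide_eq)
      then show ?thesis using bubble_mass_pos by (simp add: \<delta>_def divide_le_eq mult_ac)
    qed
    have \<omega>1: "\<omega> \<le> 1" using \<omega> by (simp add: \<omega>0_def)

    \<comment> \<open>The coefficients and the logarithm of the admittivity\<close>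
    obtain S X Y :: "complex \<Rightarrow> real" where S[measurable]: "S \<in> borel_measurable borel"
      and X[measurable]: "X \<in> borel_measurable borel" and Y[measurable]: "Y \<in> borel_measurable borel"
      and \<sigma>S: "AE z in lborel. \<sigma> z = S z"
      and SX: "borel_weak_deriv dx (\<lambda>z. of_real (S z)) (\<lambda>z. of_real (X z))"
      and SY: "borel_weak_deriv dy (\<lambda>z. of_real (S z)) (\<lambda>z. of_real (Y z))"
      and Sb: "AE z in lborel. \<bar>S z\<bar> \<le> \<beta> \<and> \<bar>X z\<bar> \<le> \<beta> \<and> \<bar>Y z\<bar> \<le> \<beta>"
      by (rule W1inf_norm_borelE[OF W\<sigma>])
    obtain T V W :: "complex \<Rightarrow> real" where T[measurable]: "T \<in> borel_measurable borel"
      and V[measurable]: "V \<in> borel_measurable borel" and W[measurable]: "W \<in> borel_measurable borel"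
      and \<epsilon>T: "AE z in lborel. \<epsilon> z = T z"
      and TV: "borel_weak_deriv dx (\<lambda>z. of_real (T z)) (\<lambda>z. of_real (V z))"
      and TW: "borel_weak_deriv dy (\<lambda>z. of_real (T z)) (\<lambda>z. of_real (W z))"
      and Tb: "AE z in lborel. \<bar>T z\<bar> \<le> \<beta> \<and> \<bar>V z\<bar> \<le> \<beta> \<and> \<bar>W z\<bar> \<le> \<beta>"
      by (rule W1inf_norm_borelE[OF W\<epsilon>])
    \<comment> \<open>The sign of t stays free because \<open>G (- \<omega>)\<close> is the
      conjugate of \<gamma>: the \<partial> derivative of Ln \<gamma> is the conjugate of the
      \<partial>-bar derivative of its logarithm.\<close>
    define G where "G t z = of_real (S z) + \<i> * of_real t * of_real (T z)" for t :: real and z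
    define DG where "DG t z = (of_real (X z) + \<i> * of_real (Y z)) / 2 + \<i> * of_real t * ((of_real (V z) + \<i> * of_real (W z)) / 2)" for t :: real and z
    have [measurable]: "G t \<in> borel_measurable borel" "DG t \<in> borel_measurable borel" for t
      unfolding G_def[abs_def] DG_def[abs_def] by measurable
    have cont: "continuous_on UNIV (dz \<phi>)" "continuous_on UNIV (dzbar \<phi>)" if "test_function UNIV \<phi>" for \<phi>
      using test_function_dz_props[OF that] by auto
    have wG: "borel_weak_deriv dzbar (G t) (DG t)" for t
      unfolding G_def[abs_def] DG_def[abs_def]
      by (rule borel_weak_deriv_add[OF borel_weak_deriv_dz_dzbar(2)[OF SX SY] borel_weak_deriv_dz_dzbar(2)[OF TV TW]]) simp
    have \<gamma>G: "AE z in lborel. ?\<gamma> z = G \<omega> z"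
      using \<sigma>S \<epsilon>T by eventually_elim (simp add: admittivity_def G_def)
    have Sge: "AE z in lborel. \<sigma>0 < S z" using \<sigma>ge \<sigma>S unfolding AE_lebesgue_iff by eventually_elim simp
    have ReG: "Re (G t z) = S z" for t z by (simp add: G_def)
    have Gge: "AE z in lborel. \<sigma>0 \<le> Re (G t z)" for t using Sge by eventually_elim (simp add: ReG)
    have Gout: "AE z in lborel. z \<notin> ball c R \<longrightarrow> G \<omega> z = 1"
      using out \<gamma>G unfolding AE_lebesgue_iff by eventually_elim simp
    have cnjG: "G (- t) z = cnj (G t z)" for t z by (simp add: G_def)
    have Gout': "AE z in lborel. z \<notin> ball c R \<longrightarrow> G (- \<omega>) z = 1"
      using Gout by eventually_elim (simp add: cnjG)
    have G_le: "AE z in lborel. cmod (G t z) \<le> \<beta> + \<bar>t\<bar> * \<beta>" for t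
      using Sb Tb
    proof eventually_elim
      fix z assume b: "\<bar>S z\<bar> \<le> \<beta> \<and> \<bar>X z\<bar> \<le> \<beta> \<and> \<bar>Y z\<bar> \<le> \<beta>" "\<bar>T z\<bar> \<le> \<beta> \<and> \<bar>V z\<bar> \<le> \<beta> \<and> \<bar>W z\<bar> \<le> \<beta>"
      have "cmod (G t z) \<le> \<bar>S z\<bar> + \<bar>t\<bar> * \<bar>T z\<bar>"
        unfolding G_def by (rule order_trans[OF norm_triangle_ineq]) (simp add: norm_mult)
      also have "\<dots> \<le> \<beta> + \<bar>t\<bar> * \<beta>" using b by (intro add_mono mult_left_mono) auto
      finally show "cmod (G t z) \<le> \<beta> + \<bar>t\<bar> * \<beta>" .
    qed
    have half: "cmod ((of_real x + \<i> * of_real y) / 2) \<le> \<beta>" if "\<bar>x\<bar> \<le> \<beta>" "\<bar>y\<bar> \<le> \<beta>" for x y :: real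
    proof -
      have "cmod (of_real x + \<i> * of_real y) \<le> \<bar>x\<bar> + \<bar>y\<bar>"
        by (rule order_trans[OF norm_triangle_ineq]) (simp add: norm_mult)
      then show ?thesis using that by (simp add: norm_divide)
    qed
    have DG_le: "AE z in lborel. cmod (DG t z) \<le> \<beta> + \<bar>t\<bar> * \<beta>" for t
      using Sb Tb
    proof eventually_elim
      fix z assume b: "\<bar>S z\<bar> \<le> \<beta> \<and> \<bar>X z\<bar> \<le> \<beta> \<and> \<bar>Y z\<bar> \<le> \<beta>" "\<bar>T z\<bar> \<le> \<beta> \<and> \<bar>V z\<bar> \<le> \<beta> \<and> \<bar>W z\<bar> \<le> \<beta>"
      have "cmod (DG t z) \<le> cmod ((of_real (X z) + \<i> * of_real (Y z)) / 2) + cmod (\<i> * of_real t * ((of_real (V z) + \<i> * of_real (W z)) / 2))"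
        unfolding DG_def by (rule norm_triangle_ineq)
      also have "cmod (\<i> * of_real t * ((of_real (V z) + \<i> * of_real (W z)) / 2)) = \<bar>t\<bar> * cmod ((of_real (V z) + \<i> * of_real (W z)) / 2)"
        by (simp add: norm_mult)
      also have "cmod ((of_real (X z) + \<i> * of_real (Y z)) / 2) + \<bar>t\<bar> * cmod ((of_real (V z) + \<i> * of_real (W z)) / 2) \<le> \<beta> + \<bar>t\<bar> * \<beta>"
        using b by (intro add_mono mult_left_mono half) auto
      finally show "cmod (DG t z) \<le> \<beta> + \<bar>t\<bar> * \<beta>" .
    qed
    have Gm: "G t \<in> borel_measurable borel" for t by measurable
    note Ln1 = borel_weak_deriv_Ln[OF Gm wG G_le DG_le Gout \<sigma>0 Gge]
    note Ln2 = borel_weak_deriv_Ln[OF Gm wG G_le DG_le Gout' \<sigma>0 Gge]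
    obtain L1 \<alpha>1 where L1: "borel_weak_deriv dzbar L1 \<alpha>1" "AE z in lborel. Ln (G \<omega> z) = L1 z" "AE z in lborel. \<alpha>1 z = DG \<omega> z / G \<omega> z"
      using Ln1(2) by blast
    obtain L2 \<alpha>2 where L2: "borel_weak_deriv dzbar L2 \<alpha>2" "AE z in lborel. Ln (G (- \<omega>) z) = L2 z" "AE z in lborel. \<alpha>2 z = DG (- \<omega>) z / G (- \<omega>) z"
      using Ln2(2) by blast
    have L2c: "borel_weak_deriv dz (\<lambda>z. cnj (L2 z)) (\<lambda>z. cnj (\<alpha>2 z))"
      by (rule borel_weak_deriv_cnj[OF L2(1) test_function_cnj(2)])
    have \<gamma>L1: "AE z in lborel. Ln (?\<gamma> z) = L1 z" using \<gamma>G L1(2) by eventually_elim simp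
    \<comment> \<open>The positive real part keeps \<open>G \<omega> z\<close> off the branch cut,
      so Ln commutes with conjugation there.\<close>
    have \<gamma>L2: "AE z in lborel. Ln (?\<gamma> z) = cnj (L2 z)"
      using \<gamma>G L2(2) Sge
    proof eventually_elim
      fix z assume z: "?\<gamma> z = G \<omega> z" "Ln (G (- \<omega>) z) = L2 z" "\<sigma>0 < S z"
      have "0 < Re (G \<omega> z)" using z(3) \<sigma>0 by (simp add: ReG)
      then have "G \<omega> z \<notin> \<real>\<^sub>\<le>\<^sub>0" by (auto simp: complex_nonpos_Reals_iff)
      then have "cnj (Ln (G \<omega> z)) = Ln (cnj (G \<omega> z))" by (rule cnj_Ln)
      then have "cnj (Ln (G \<omega> z)) = L2 z" using z(2) by (simp add: cnjG)
      then show "Ln (?\<gamma> z) = cnj (L2 z)" using z(1) by (metis complex_cnj_cnj)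
    qed
    have wd_bar: "weakly_diff dzbar UNIV (\<lambda>z. Ln (?\<gamma> z))" and d_bar: "AE z in lborel. weak_deriv dzbar UNIV (\<lambda>z. Ln (?\<gamma> z)) z = \<alpha>1 z"
      using weak_deriv_AE_eq[of dzbar, OF cont(2) \<gamma>L1 L1(1)] by auto
    have wd_z: "weakly_diff dz UNIV (\<lambda>z. Ln (?\<gamma> z))" and d_z: "AE z in lborel. weak_deriv dz UNIV (\<lambda>z. Ln (?\<gamma> z)) z = cnj (\<alpha>2 z)"
      using weak_deriv_AE_eq[of dz, OF cont(1) \<gamma>L2 L2c] by auto

    \<comment> \<open>Bounded representatives of the potentials\<close>
    define p where "p z = - (1/2) * cnj (\<alpha>2 z)" for z
    \<comment> \<open>Conjugating Q21 puts both potentials into \<partial>-bar equations of the same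
      form; for \<omega> = 0 the two agree almost everywhere.\<close>
    define p' where "p' z = - (1/2) * cnj (\<alpha>1 z)" for z
    have am[measurable]: "\<alpha>1 \<in> borel_measurable borel" "\<alpha>2 \<in> borel_measurable borel"
      using L1(1) L2(1) by (auto simp: borel_weak_deriv_def borel_locint_def)
    have [measurable]: "p \<in> borel_measurable borel" "p' \<in> borel_measurable borel" unfolding p_def[abs_def] p'_def[abs_def] by measurable
    have Q12p: "AE z in lborel. Q12 ?\<gamma> z = p z" using d_z by eventually_elim (simp add: Q12_def p_def)
    have Q21p: "AE z in lborel. Q21 ?\<gamma> z = cnj (p' z)" using d_bar by eventually_elim (simp add: Q21_def p'_def)
    \<comment> \<open>The same condition truncates p and p', so the bound on their difference also
      holds at every point. Only null sets are affected.\<close>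
    define P where "P z = (if z \<in> ball c (R + 1) \<and> cmod (p z) \<le> A \<and> cmod (p' z) \<le> A \<and> cmod (p' z - p z) \<le> \<delta> then p z else 0)" for z
    define P' where "P' z = (if z \<in> ball c (R + 1) \<and> cmod (p z) \<le> A \<and> cmod (p' z) \<le> A \<and> cmod (p' z - p z) \<le> \<delta> then p' z else 0)" for z
    have Pm[measurable]: "P \<in> borel_measurable borel" "P' \<in> borel_measurable borel" unfolding P_def[abs_def] P'_def[abs_def] by measurable
    have Pb: "cmod (P w) \<le> A * indicator (ball c (R + 1)) w" "cmod (P' w) \<le> A * indicator (ball c (R + 1)) w"
      "cmod (P' w - P w) \<le> \<delta> * indicator (ball c (R + 1)) w" for w
      using A0 \<delta>0 by (auto simp: P_def P'_def)
    have pP: "AE z in lborel. p z = P z \<and> p' z = P' z"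
      using L1(3) L2(3) Ln1(1) Ln2(1) Sge DG_le[of \<omega>] DG_le[of "- \<omega>"] Tb
    proof eventually_elim
      fix z assume a: "\<alpha>1 z = DG \<omega> z / G \<omega> z" "\<alpha>2 z = DG (- \<omega>) z / G (- \<omega>) z"
        and o: "z \<notin> ball c (R + 1) \<longrightarrow> DG \<omega> z = 0" "z \<notin> ball c (R + 1) \<longrightarrow> DG (- \<omega>) z = 0"
        and S: "\<sigma>0 < S z" and D: "cmod (DG \<omega> z) \<le> \<beta> + \<bar>\<omega>\<bar> * \<beta>" "cmod (DG (- \<omega>) z) \<le> \<beta> + \<bar>- \<omega>\<bar> * \<beta>"
        and Tb: "\<bar>T z\<bar> \<le> \<beta> \<and> \<bar>V z\<bar> \<le> \<beta> \<and> \<bar>W z\<bar> \<le> \<beta>"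
      show "p z = P z \<and> p' z = P' z"
      proof (cases "z \<in> ball c (R + 1)")
        case False
        then have "\<alpha>1 z = 0" "\<alpha>2 z = 0" using a o by simp_all
        then show ?thesis using False by (simp add: p_def p'_def P_def P'_def)
      next
        case True
        have G: "\<sigma>0 \<le> cmod (G t z)" for t using complex_Re_le_cmod[of "G t z"] S unfolding ReG by linarith
        have D2: "cmod (DG \<omega> z) \<le> 2 * \<beta>" "cmod (DG (- \<omega>) z) \<le> 2 * \<beta>"
        proof -
          have "\<omega> * \<beta> \<le> \<beta>" using mult_right_mono[OF \<omega>1, of \<beta>] \<beta> by simp
          then show "cmod (DG \<omega> z) \<le> 2 * \<beta>" "cmod (DG (- \<omega>) z) \<le> 2 * \<beta>"
            using D unfolding abs_minus_cancel abs_of_nonneg[OF \<omega>(1)] by linarith+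
        qed
        have al: "cmod (\<alpha>1 z) \<le> 2 * \<beta> / \<sigma>0" "cmod (\<alpha>2 z) \<le> 2 * \<beta> / \<sigma>0"
          unfolding a norm_divide by (intro frac_le G D2 \<sigma>0; use \<beta> in simp)+
        have d1: "cmod (DG \<omega> z - DG (- \<omega>) z) \<le> 2 * \<omega> * \<beta>"
        proof -
          have "DG \<omega> z - DG (- \<omega>) z = \<i> * of_real (2 * \<omega>) * ((of_real (V z) + \<i> * of_real (W z)) / 2)"
          proof -
            define v where "v = (complex_of_real (V z) + \<i> * of_real (W z)) / 2"
            have "DG t z = (of_real (X z) + \<i> * of_real (Y z)) / 2 + \<i> * of_real t * v" for t
              by (simp only: DG_def v_def)
            then show ?thesis unfolding v_def[symmetric] by (simp add: algebra_simps)
          qed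
          then have "cmod (DG \<omega> z - DG (- \<omega>) z) = 2 * \<omega> * cmod ((of_real (V z) + \<i> * of_real (W z)) / 2)"
            using \<omega> by (simp add: norm_mult)
          also have "\<dots> \<le> 2 * \<omega> * \<beta>" using Tb \<omega> by (intro mult_left_mono half) auto
          finally show ?thesis .
        qed
        have d2: "cmod (G (- \<omega>) z - G \<omega> z) \<le> 2 * \<omega> * \<beta>"
        proof -
          have "G (- \<omega>) z - G \<omega> z = - (\<i> * of_real (2 * \<omega>) * of_real (T z))" by (simp add: G_def algebra_simps)
          then have "cmod (G (- \<omega>) z - G \<omega> z) = 2 * \<omega> * \<bar>T z\<bar>" using \<omega> by (simp add: norm_mult)
          also have "\<dots> \<le> 2 * \<omega> * \<beta>" using Tb \<omega> by (intro mult_left_mono) auto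
          finally show ?thesis .
        qed
        have "cmod (\<alpha>1 z - \<alpha>2 z) \<le> 2 * \<omega> * \<beta> / \<sigma>0 + (2 * \<beta>) * (2 * \<omega> * \<beta>) / (\<sigma>0 * \<sigma>0)"
          unfolding a by (rule norm_quotient_diff_le[OF \<sigma>0 G G d1 D2(2) d2])
        also have "\<dots> = 2 * \<delta>" by (simp add: \<delta>_def \<kappa>_def power2_eq_square algebra_simps)
        finally have ad: "cmod (\<alpha>1 z - \<alpha>2 z) \<le> 2 * \<delta>" .
        have "p' z - p z = - (1/2) * cnj (\<alpha>1 z - \<alpha>2 z)" by (simp add: p_def p'_def algebra_simps)
        then have "cmod (p' z - p z) = (1/2) * cmod (\<alpha>1 z - \<alpha>2 z)" by (simp only: norm_mult complex_mod_cnj) simp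
        then have "cmod (p' z - p z) \<le> \<delta>" using ad by simp
        moreover have "cmod (p z) \<le> A" "cmod (p' z) \<le> A" using al by (simp_all add: p_def p'_def norm_mult A_def mult.commute[of 2])
        ultimately show ?thesis using True by (simp add: P_def P'_def)
      qed
    qed
    have Q12P: "AE z in lborel. Q12 ?\<gamma> z = P z" using Q12p pP by eventually_elim simp
    have Q21P: "AE z in lborel. Q21 ?\<gamma> z = cnj (P' z)" using Q21p pP by eventually_elim simp

    \<comment> \<open>The first-order system at k = 0\<close>
    have c0: "cgo_matrix ?\<gamma> 0 (\<lambda>z. M z 0)" using cgo by blast
    let ?m = "\<lambda>i j z. M z 0 $ i $ j"
    obtain q where q: "2 < q" and Lq: "\<And>i j. Lq q (\<lambda>z. (M z 0 - mat 1) $ i $ j)" using c0 unfolding cgo_matrix_def by blast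
    have wd: "weakly_diff dzbar UNIV (?m 1 1)" "weakly_diff dzbar UNIV (?m 1 2)" "weakly_diff dz UNIV (?m 2 1)" "weakly_diff dz UNIV (?m 2 2)"
      using c0 unfolding cgo_matrix_def by blast+
    have eqs: "AE z in lborel. weak_deriv dzbar UNIV (?m 1 1) z = Q12 ?\<gamma> z * ?m 2 1 z"
      "AE z in lborel. weak_deriv dzbar UNIV (?m 1 2) z = Q12 ?\<gamma> z * ?m 2 2 z"
      "AE z in lborel. weak_deriv dz UNIV (?m 2 1) z = Q21 ?\<gamma> z * ?m 1 1 z"
      "AE z in lborel. weak_deriv dz UNIV (?m 2 2) z = Q21 ?\<gamma> z * ?m 1 2 z"
      using c0 unfolding cgo_matrix_def AE_lebesgue_iff by simp_all
    have rep: "\<exists>f. f \<in> borel_measurable borel \<and> (AE z in lborel. F z = f z)" if "weakly_diff Q UNIV F" for Q F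
      using borel_representative[OF loc_integrable_measurable[of F]] that by (auto simp: weakly_diff_def has_weak_deriv_def)
    obtain f11 where f11[measurable]: "f11 \<in> borel_measurable borel" and e11: "AE z in lborel. ?m 1 1 z = f11 z" using rep[OF wd(1)] by blast
    obtain f12 where f12[measurable]: "f12 \<in> borel_measurable borel" and e12: "AE z in lborel. ?m 1 2 z = f12 z" using rep[OF wd(2)] by blast
    obtain f21 where f21[measurable]: "f21 \<in> borel_measurable borel" and e21: "AE z in lborel. ?m 2 1 z = f21 z" using rep[OF wd(3)] by blast
    obtain f22 where f22[measurable]: "f22 \<in> borel_measurable borel" and e22: "AE z in lborel. ?m 2 2 z = f22 z" using rep[OF wd(4)] by blast
    define u where "u z = f11 z + f12 z" for z
    \<comment> \<open>The conjugate turns \<partial> v = Q21 u into \<partial>-bar a = P' cnj u,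
      matching the equation for u.\<close>
    define a where "a z = cnj (f22 z + f21 z)" for z
    have um[measurable]: "u \<in> borel_measurable borel" and am'[measurable]: "a \<in> borel_measurable borel"
      unfolding u_def[abs_def] a_def[abs_def] by measurable
    have Mp: "AE z in lborel. M_plus M z 0 = u z" using e11 e12 by eventually_elim (simp add: M_plus_def e_0 u_def)
    have Mm: "AE z in lborel. M_minus M z 0 = cnj (a z)" using e21 e22 by eventually_elim (simp add: M_minus_def e_0 a_def)
    have wu: "borel_weak_deriv dzbar u (\<lambda>z. P z * cnj (a z))"
      unfolding u_def[abs_def]
    proof (rule borel_weak_deriv_sum_rep[OF _ wd(1,2) f11 e11 f12 e12])
      show "AE z in lborel. weak_deriv dzbar UNIV (?m 1 1) z + weak_deriv dzbar UNIV (?m 1 2) z = P z * cnj (a z)"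
        using eqs(1,2) Q12P e21 e22 by eventually_elim (simp add: a_def algebra_simps)
    qed auto
    have wv: "borel_weak_deriv dz (\<lambda>z. f21 z + f22 z) (\<lambda>z. cnj (P' z) * u z)"
    proof (rule borel_weak_deriv_sum_rep[OF _ wd(3,4) f21 e21 f22 e22])
      show "AE z in lborel. weak_deriv dz UNIV (?m 2 1) z + weak_deriv dz UNIV (?m 2 2) z = cnj (P' z) * u z"
        using eqs(3,4) Q21P e11 e12 by eventually_elim (simp add: u_def algebra_simps)
    qed auto
    have "borel_weak_deriv dzbar (\<lambda>z. cnj (f21 z + f22 z)) (\<lambda>z. cnj (cnj (P' z) * u z))"
      by (rule borel_weak_deriv_cnj[OF wv test_function_cnj(3)])
    then have wa: "borel_weak_deriv dzbar a (\<lambda>z. P' z * cnj (u z))" by (simp add: a_def[abs_def] add.commute)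
    have int: "integrable lborel (\<lambda>z. cmod (f11 z - 1) powr q)" "integrable lborel (\<lambda>z. cmod (f12 z) powr q)"
      "integrable lborel (\<lambda>z. cmod (f21 z) powr q)" "integrable lborel (\<lambda>z. cmod (f22 z - 1) powr q)"
    proof -
      have "AE z in lborel. (M z 0 - mat 1) $ 1 $ 1 = f11 z - 1" using e11 by eventually_elim (simp add: mat_def)
      then show "integrable lborel (\<lambda>z. cmod (f11 z - 1) powr q)" by (intro Lq_borel[OF Lq[of 1 1]]) measurable
      have "AE z in lborel. (M z 0 - mat 1) $ 1 $ 2 = f12 z" using e12 by eventually_elim (simp add: mat_def)
      then show "integrable lborel (\<lambda>z. cmod (f12 z) powr q)" by (intro Lq_borel[OF Lq[of 1 2]]) measurable
      have "AE z in lborel. (M z 0 - mat 1) $ 2 $ 1 = f21 z" using e21 by eventually_elim (simp add: mat_def)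
      then show "integrable lborel (\<lambda>z. cmod (f21 z) powr q)" by (intro Lq_borel[OF Lq[of 2 1]]) measurable
      have "AE z in lborel. (M z 0 - mat 1) $ 2 $ 2 = f22 z - 1" using e22 by eventually_elim (simp add: mat_def)
      then show "integrable lborel (\<lambda>z. cmod (f22 z - 1) powr q)" by (intro Lq_borel[OF Lq[of 2 2]]) measurable
    qed
    have "integrable lborel (\<lambda>z. cmod ((f11 z - 1) + f12 z) powr q)" by (intro integrable_powr_add int; (use q in simp)?)
    then have ui: "integrable lborel (\<lambda>z. cmod (u z - 1) powr q)" by (simp add: u_def algebra_simps)
    have "integrable lborel (\<lambda>z. cmod ((f22 z - 1) + f21 z) powr q)" by (intro integrable_powr_add int; (use q in simp)?)
    moreover have "cmod ((f22 z - 1) + f21 z) = cmod (a z - 1)" for z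
    proof -
      have "a z - 1 = cnj ((f22 z - 1) + f21 z)" by (simp add: a_def)
      then show ?thesis by (simp only: complex_mod_cnj)
    qed
    ultimately have ai: "integrable lborel (\<lambda>z. cmod (a z - 1) powr q)" by simp
    have nz: "AE z in lborel. u z \<noteq> 0 \<and> a z \<noteq> 0"
      by (rule perturbed_pseudoanalytic_AE_nonzero[OF K K0 Pm(1) Pb(1) Pm(2) Pb(2) Pb(3) A0 \<delta>0 E_def small q um am' ui ai wu wa])
    have dMp: "weakly_diff dzbar UNIV (\<lambda>z. M_plus M z 0)" "AE z in lborel. weak_deriv dzbar UNIV (\<lambda>z. M_plus M z 0) z = P z * cnj (a z)"
      using weak_deriv_AE_eq[of dzbar, OF cont(2) Mp wu] by auto
    have Mm': "AE z in lborel. M_minus M z 0 = f21 z + f22 z" using Mm by eventually_elim (simp add: a_def)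
    have dMm: "weakly_diff dz UNIV (\<lambda>z. M_minus M z 0)" "AE z in lborel. weak_deriv dz UNIV (\<lambda>z. M_minus M z 0) z = cnj (P' z) * u z"
      using weak_deriv_AE_eq[of dz, OF cont(1) Mm' wv] by auto
    have r1: "AE z in lebesgue. M_minus M z 0 \<noteq> 0 \<and> Q12 ?\<gamma> z = weak_deriv dzbar UNIV (\<lambda>w. M_plus M w 0) z / M_minus M z 0"
      unfolding AE_lebesgue_iff using nz Mm dMp(2) Q12P by eventually_elim simp
    have r2: "AE z in lebesgue. M_plus M z 0 \<noteq> 0 \<and> Q21 ?\<gamma> z = weak_deriv dz UNIV (\<lambda>w. M_minus M w 0) z / M_plus M z 0"
      unfolding AE_lebesgue_iff using nz Mp dMm(2) Q21P by eventually_elim simp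
    show "weakly_diff dz UNIV (\<lambda>z. Ln (?\<gamma> z)) \<and>
       weakly_diff dzbar UNIV (\<lambda>z. Ln (?\<gamma> z)) \<and>
       weakly_diff dzbar UNIV (\<lambda>z. M_plus M z 0) \<and>
       weakly_diff dz UNIV (\<lambda>z. M_minus M z 0) \<and>
       (AE z in lebesgue. M_minus M z 0 \<noteq> 0 \<and>
          Q12 ?\<gamma> z = weak_deriv dzbar UNIV (\<lambda>w. M_plus M w 0) z / M_minus M z 0) \<and>
       (AE z in lebesgue. M_plus M z 0 \<noteq> 0 \<and>
          Q21 ?\<gamma> z = weak_deriv dz UNIV (\<lambda>w. M_minus M w 0) z / M_plus M z 0)"
      by (intro conjI wd_z wd_bar dMp(1) dMm(1) r1 r2)
  qed
qed

end
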